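(* Let $m\ge2$, $d\ge2$, let $\alpha_v^{ij}\in\mathbb{R}$ ($v\in[d]$, $i,j\in[m]$) satisfy $\alpha_v^{ij}=\alpha_v^{ji}$, let $X=\{X(n)\}_{n\ge0}$ be the process of vertex occupation measures of the $m$ interacting walks on $[d]$ with these parameters, and let $F(x)=-x+\pi(x)$ on $\mathfrak{D}$. Then: (i) for each linearly stable equilibrium point $x$ of $F$, $\mathbb{P}\big(\lim_{n\to\infty}X(n)=x\big)>0$; (ii) for each linearly unstable equilibrium point $x$ of $F$, $\mathbb{P}\big(\lim_{n\to\infty}X(n)=x\big)=0$; (iii) if the equilibrium points of $F$ are isolated, then $\sum_{x\in F^{-1}(0)}\mathbb{P}\big(\lim_{n\to\infty}X(n)=x\big)=1$.
   Context: Notation: $[n]=\{1,\dots,n\}$. $\triangle=\{x\in\mathbb{R}^d:x_v\ge0,\ \sum_vx_v=1\}$, $\mathfrak{D}=\triangle^m\subset\mathbb{R}^{dm}$, points $x=(x_v^i)_{i\in[m],v\in[d]}$. The map $\pi=(\pi_v^i):\mathfrak{D}\to\mathfrak{D}$ is $$\pi_v^i(x)=\frac{\exp\big(\sum_{j=1}^m\alpha_v^{ij}x_v^j\big)}{\sum_{u=1}^d\exp\big(\sum_{j=1}^m\alpha_u^{ij}x_u^j\big)},$$ and $F(x)=-x+\pi(x)$; the same formulas define $\pi,F$ on $\mathbb{R}^{dm}$. $F^{-1}(0)=\{x\in\mathfrak{D}:F(x)=0\}$ is the set of equilibrium points. The process: $W(n)=(W^1(n),\dots,W^m(n))$, $n\ge1$,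 takes values in $[d]^m$ ($m$ walks on the complete graph with vertex set $[d]$). Set $X_v^i(0)=1$ and, for $n\ge1$, $X_v^i(n)=\frac{1}{d+n}\big(1+\sum_{k=1}^n\mathbf{1}\{W^i(k)=v\}\big)$. Let $\mathfrak{F}_0$ be the trivial $\sigma$-algebra and $\mathfrak{F}_n=\sigma(W(k):1\le k\le n)$. For all $n\ge0$, $i\in[m]$, $v\in[d]$, $\mathbb{P}(W^i(n+1)=v\mid\mathfrak{F}_n)=\pi_v^i(X(n))$, and $W^1(n+1),\dots,W^m(n+1)$ are conditionally independent given $\mathfrak{F}_n$. $X(n)=(X_v^i(n))_{i,v}$. Stability: an equilibrium point $x$ of $F$ is hyperbolic if the $dm\times dm$ Jacobian matrix $JF(x)$ has no eigenvalue with zero real part. A hyperbolic equilibrium is linearly stable if all eigenvalues of $JF(x)$ have negative real part, and linearly unstable otherwise. *)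

theory Defs
  imports "HOL-Probability.Probability"
begin

text \<open>
  Finite types \<open>'m\<close> (walks) and \<open>'d\<close> (vertices) play the roles of $[m]$ and $[d]$.
  A point \<open>x :: real ^ ('m \<times> 'd)\<close> has coordinates \<open>x $ (i, v)\<close> $= x_v^i$,
  and \<open>\<alpha> v i j\<close> is $\alpha_v^{ij}$.
\<close>

type_synonym ('m, 'd) params = "'d \<Rightarrow> 'm \<Rightarrow> 'm \<Rightarrow> real"

definition simplex_product :: "(real ^ ('m::finite \<times> 'd::finite)) set" where
  "simplex_product = {x. (\<forall>i v. 0 \<le> x $ (i, v)) \<and> (\<forall>i. (\<Sum>v\<in>UNIV. x $ (i, v)) = 1)}"

definition pi_map ::
  "('m::finite, 'd::finite) params \<Rightarrow> real ^ ('m \<times> 'd) \<Rightarrow> real ^ ('m \<times> 'd)" where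
  "pi_map \<alpha> x = vec_lambda (\<lambda>(i, v).
     exp (\<Sum>j\<in>UNIV. \<alpha> v i j * x $ (j, v)) /
     (\<Sum>u\<in>UNIV. exp (\<Sum>j\<in>UNIV. \<alpha> u i j * x $ (j, u))))"

definition F_field ::
  "('m::finite, 'd::finite) params \<Rightarrow> real ^ ('m \<times> 'd) \<Rightarrow> real ^ ('m \<times> 'd)" where
  "F_field \<alpha> x = - x + pi_map \<alpha> x"

definition equilibria :: "('m::finite, 'd::finite) params \<Rightarrow> (real ^ ('m \<times> 'd)) set" where
  "equilibria \<alpha> = {x \<in> simplex_product. F_field \<alpha> x = 0}"

text \<open>The eigenvalues of a real matrix are its complex eigenvalues.\<close>

definition eigenvalues :: "real ^ 'n ^ 'n::finite \<Rightarrow> complex set" where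
  "eigenvalues A = {c. \<exists>z::complex ^ 'n. z \<noteq> 0 \<and> map_matrix complex_of_real A *v z = c *s z}"

text \<open>
  The Jacobian is that of the extension of $F$ to the whole space $\mathbb{R}^{dm}$, so it is
  the full $dm \times dm$ matrix, not its restriction to the tangent space of the simplices.
\<close>

definition hyperbolic_equilibrium ::
  "('m::finite, 'd::finite) params \<Rightarrow> real ^ ('m \<times> 'd) \<Rightarrow> bool" where
  "hyperbolic_equilibrium \<alpha> x \<longleftrightarrow>
     x \<in> equilibria \<alpha> \<and> (\<forall>c \<in> eigenvalues (jacobian (F_field \<alpha>) (at x)). Re c \<noteq> 0)"

definition linearly_stable ::
  "('m::finite, 'd::finite) params \<Rightarrow> real ^ ('m \<times> 'd) \<Rightarrow> bool" where
  "linearly_stable \<alpha> x \<longleftrightarrow>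
     hyperbolic_equilibrium \<alpha> x \<and> (\<forall>c \<in> eigenvalues (jacobian (F_field \<alpha>) (at x)). Re c < 0)"

definition linearly_unstable ::
  "('m::finite, 'd::finite) params \<Rightarrow> real ^ ('m \<times> 'd) \<Rightarrow> bool" where
  "linearly_unstable \<alpha> x \<longleftrightarrow> hyperbolic_equilibrium \<alpha> x \<and> \<not> linearly_stable \<alpha> x"

definition cond_probability :: "'w measure \<Rightarrow> 'w measure \<Rightarrow> 'w set \<Rightarrow> 'w \<Rightarrow> real" where
  "cond_probability M G A = real_cond_exp M G (indicator A)"

text \<open>
  Conditional independence of random variables given a sub-\<open>\<sigma>\<close>-algebra \<open>G\<close>; the analogue of
  \<^const>\<open>prob_space.indep_vars\<close>.
\<close>

definition cond_indep_vars ::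
  "'w measure \<Rightarrow> 'w measure \<Rightarrow> ('i \<Rightarrow> 'b measure) \<Rightarrow> ('i \<Rightarrow> 'w \<Rightarrow> 'b) \<Rightarrow> 'i set \<Rightarrow> bool" where
  "cond_indep_vars M G N Y I \<longleftrightarrow>
     (\<forall>i\<in>I. Y i \<in> M \<rightarrow>\<^sub>M N i) \<and>
     (\<forall>J\<subseteq>I. J \<noteq> {} \<longrightarrow> finite J \<longrightarrow> (\<forall>A \<in> (\<Pi> j\<in>J. sets (N j)).
        AE w in M. cond_probability M G (\<Inter>j\<in>J. Y j -` A j \<inter> space M) w =
                   (\<Prod>j\<in>J. cond_probability M G (Y j -` A j \<inter> space M) w)))"

text \<open>
  \<open>W n w i\<close> is the position of walk \<open>i\<close> at time \<open>n\<close>. Positions exist for \<open>n \<ge> 1\<close> only: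
  the value \<open>W 0\<close> is arbitrary and is used nowhere below.

  Pitfall: the initial vector is \<open>1\<close> in every coordinate, hence not in the product of simplices
  (and it is not the value that the formula for \<open>n \<ge> 1\<close> would give at \<open>0\<close>).
\<close>

definition occupation ::
  "(nat \<Rightarrow> 'w \<Rightarrow> 'm::finite \<Rightarrow> 'd::finite) \<Rightarrow> nat \<Rightarrow> 'w \<Rightarrow> real ^ ('m \<times> 'd)" where
  "occupation W n w = vec_lambda (\<lambda>(i, v).
     if n = 0 then 1
     else (1 + (\<Sum>k = 1..n. of_bool (W k w i = v))) / (real CARD('d) + real n))"

definition history :: "'w measure \<Rightarrow> (nat \<Rightarrow> 'w \<Rightarrow> 'm \<Rightarrow> 'd) \<Rightarrow> nat \<Rightarrow> 'w measure" where
  "history M W n = sigma (space M) {W k -` A \<inter> space M | k A. k \<in> {1..n}}"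

locale interacting_walks = prob_space M
  for M :: "'w measure"
    and \<alpha> :: "('m::finite, 'd::finite) params"
    and W :: "nat \<Rightarrow> 'w \<Rightarrow> 'm \<Rightarrow> 'd" +
  assumes measurable_W: "\<And>n. 1 \<le> n \<Longrightarrow> W n \<in> M \<rightarrow>\<^sub>M count_space UNIV"
    and transition: "\<And>n i v. AE w in M.
      cond_probability M (history M W n) {w \<in> space M. W (n + 1) w i = v} w =
      pi_map \<alpha> (occupation W n w) $ (i, v)"
    and cond_indep: "\<And>n. cond_indep_vars M (history M W n)
      (\<lambda>_. count_space UNIV) (\<lambda>i w. W (n + 1) w i) UNIV"

end

theory Submission
  imports Defs
begin

text \<open>
  For \<open>n \<ge> 1\<close> the occupation vector \<open>X n\<close> lies in the product of simplices and moves by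
  \<open>X (n + 1) = X n + g n * (e (W (n + 1)) - X n)\<close>, where \<open>g n = 1 / (d + n + 1)\<close> and \<open>e w\<close> is the vertex of the
  product of simplices that belongs to the joint position \<open>w\<close>. Given the past, the increment has the mean
  \<open>g n * F (X n)\<close>. Lemma \<open>tower\<close> integrates a function of \<open>X (n + 1)\<close> over an event of the past by averaging
  over the next joint position; the three claims follow by applying it to suitable test functions.

  Convergence. The symmetry of the parameters makes the free energy \<open>L x = (\<Sum>k. x $ k * ln (x $ k)) - (x \<bullet> A x) / 2\<close> a
  Lyapunov function, where \<open>A\<close> is the matrix of the parameters. The function \<open>V x = L (\<pi> x) + |F x|\<^sup>2\<close> is smooth
  up to the boundary and beyond, and its derivative along \<open>F\<close> is at most \<open>- |F|\<^sup>2\<close> (lemma \<open>lyapunov_descent\<close>). So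
  the sum of the means of \<open>g n * |F (X n)|\<^sup>2\<close> is finite, and since \<open>X n\<close> moves slowly, \<open>F (X n)\<close> tends to \<open>0\<close>
  almost surely (lemma \<open>AE_F_tendsto_zero\<close>). Isolated equilibria are finite in number, and the steps tend to
  zero, so the process converges to one of them.

  The linearisation. At an equilibrium \<open>p\<close> the Jacobian acts on tangent vectors as \<open>- C H\<close>, where \<open>C\<close> is the covariance
  matrix of a random vertex with marginals \<open>p\<close> and \<open>H = diag (1 / p) - A\<close> is the Hessian of \<open>L\<close>. As \<open>C\<close> is semidefinite
  and \<open>H\<close> symmetric, the eigenvalues with positive real part are real, and stability means that \<open>H\<close> is positive
  definite on the tangent space.

  Stable equilibria. The form of \<open>H\<close> is a Lyapunov function near \<open>p\<close>, with which a process that starts late and close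
  to \<open>p\<close> remains close to \<open>p\<close> with a probability that is bounded below (lemma \<open>stay_prob_lower_bound\<close>). It comes close
  to \<open>p\<close> with positive probability because every finite path of the walks has positive probability
  (lemma \<open>steering\<close>).

  Unstable equilibria. Let \<open>u\<close> be a tangent eigenvector for an eigenvalue \<open>\<rho> > 0\<close>. Then \<open>H u\<close> is a left eigenvector, and
  \<open>h z = K * (H u \<bullet> z)\<^sup>2 - H z \<bullet> z\<close> increases along the linearised flow for each \<open>K > 0\<close>; for large \<open>K\<close> the noise
  increases it too. The difference of two solutions follows the linearised flow approximately
  wherever they are near \<open>p\<close>. So let two independent copies \<open>X\<close>, \<open>X'\<close> of the process start at time \<open>n\<close> from the
  same point, and consider the mean of \<open>exp (- \<theta> * n * h (X l - X' l))\<close> over the pairs that have not left a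
  neighbourhood of \<open>p\<close>. It starts from the value \<open>1\<close> and loses in total a factor \<open>\<rho>' < 1\<close> that does not depend on \<open>n\<close>,
  by the noise of the steps alone (lemma \<open>pair_decay\<close>). Pairs of paths that converge to \<open>p\<close> retain the value \<open>1\<close>
  in the limit. Therefore, whatever happened up to time \<open>n\<close>, the conditional probability of
  convergence to \<open>p\<close> without leaving the neighbourhood is bounded away from \<open>1\<close> (lemma \<open>escape_from_point\<close>), which
  forces it to vanish (lemma \<open>unstable_prob_zero\<close>). The comparison of two copies replaces the stable
  manifold of \<open>p\<close>, whose position is unknown: wherever the process is relative to it, two copies separate.
\<close>

section \<open>The product of simplices\<close>

definition block_sum :: "real ^ ('m::finite \<times> 'd::finite) \<Rightarrow> 'm \<Rightarrow> real" where
  "block_sum x i = (\<Sum>v\<in>UNIV. x $ (i, v))"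

definition tangent :: "(real ^ ('m::finite \<times> 'd::finite)) set" where
  "tangent = {z. \<forall>i. block_sum z i = 0}"

text \<open>
  The matrix of the interaction energy: the exponents that define \<^const>\<open>pi_map\<close> are the coordinates
  of \<open>coupling \<alpha> x\<close>.
\<close>

definition coupling ::
  "('m::finite, 'd::finite) params \<Rightarrow> real ^ ('m \<times> 'd) \<Rightarrow> real ^ ('m \<times> 'd)" where
  "coupling \<alpha> x = (\<chi> k. \<Sum>j\<in>UNIV. \<alpha> (snd k) (fst k) j * x $ (j, snd k))"

definition partition_fun ::
  "('m::finite, 'd::finite) params \<Rightarrow> 'm \<Rightarrow> real ^ ('m \<times> 'd) \<Rightarrow> real" where
  "partition_fun \<alpha> i x = (\<Sum>u\<in>UNIV. exp (coupling \<alpha> x $ (i, u)))"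

text \<open>
  \<open>cov p\<close> is the covariance matrix of the vertex that is picked by drawing one coordinate
  independently in each block \<open>i\<close> with the probabilities \<open>p $ (i, _)\<close>. It is also the derivative of the
  normalised exponential.
\<close>

definition cov ::
  "real ^ ('m::finite \<times> 'd::finite) \<Rightarrow> real ^ ('m \<times> 'd) \<Rightarrow> real ^ ('m \<times> 'd)" where
  "cov p b = (\<chi> k. p $ k * (b $ k - (\<Sum>u\<in>UNIV. p $ (fst k, u) * b $ (fst k, u))))"

lemma inner_blocks:
  fixes x y :: "real ^ ('m::finite \<times> 'd::finite)"
  shows "x \<bullet> y = (\<Sum>i\<in>UNIV. \<Sum>v\<in>UNIV. x $ (i, v) * y $ (i, v))"
  by (simp add: inner_vec_def sum.cartesian_product)

lemma coupling_nth: "coupling \<alpha> x $ (i, v) = (\<Sum>j\<in>UNIV. \<alpha> v i j * x $ (j, v))"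
  by (simp add: coupling_def)

lemma cov_nth: "cov p b $ (i, v) = p $ (i, v) * (b $ (i, v) - (\<Sum>u\<in>UNIV. p $ (i, u) * b $ (i, u)))"
  by (simp add: cov_def)

lemma linear_coupling: "linear (coupling \<alpha>)"
  by (rule linearI) (auto simp: vec_eq_iff coupling_nth algebra_simps sum.distrib sum_distrib_left)

lemma linear_cov: "linear (cov p)"
  by (rule linearI) (auto simp: vec_eq_iff cov_nth algebra_simps sum.distrib sum_distrib_left)

lemma coupling_symmetric:
  assumes "\<And>v i j. \<alpha> v i j = \<alpha> v j i"
  shows "coupling \<alpha> x \<bullet> y = x \<bullet> coupling \<alpha> y"
proof -
  have "coupling \<alpha> x \<bullet> y = (\<Sum>v\<in>UNIV. \<Sum>i\<in>UNIV. \<Sum>j\<in>UNIV. \<alpha> v i j * x $ (j, v) * y $ (i, v))"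
    unfolding inner_blocks by (subst sum.swap) (simp add: coupling_nth sum_distrib_right)
  also have "\<dots> = (\<Sum>v\<in>UNIV. \<Sum>j\<in>UNIV. \<Sum>i\<in>UNIV. \<alpha> v i j * x $ (j, v) * y $ (i, v))"
    by (subst sum.swap) simp
  also have "\<dots> = (\<Sum>v\<in>UNIV. \<Sum>j\<in>UNIV. \<Sum>i\<in>UNIV. x $ (j, v) * (\<alpha> v j i * y $ (i, v)))"
    using assms by (simp add: mult_ac)
  also have "\<dots> = x \<bullet> coupling \<alpha> y"
    unfolding inner_blocks by (subst (2) sum.swap) (simp add: coupling_nth sum_distrib_left)
  finally show ?thesis .
qed

lemma partition_fun_pos: "partition_fun \<alpha> i x > 0"
  unfolding partition_fun_def by (intro sum_pos) auto

lemma pi_map_nth: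
  "pi_map \<alpha> x $ (i, v) = exp (coupling \<alpha> x $ (i, v)) / partition_fun \<alpha> i x"
  by (simp add: pi_map_def partition_fun_def coupling_nth)

lemma pi_map_pos: "pi_map \<alpha> x $ k > 0"
  using partition_fun_pos[of \<alpha> "fst k" x] by (cases k) (simp add: pi_map_nth)

lemma pi_map_block_sum: "(\<Sum>v\<in>UNIV. pi_map \<alpha> x $ (i, v)) = 1"
  using partition_fun_pos[of \<alpha> i x]
  by (simp add: pi_map_nth sum_divide_distrib[symmetric] partition_fun_def[symmetric])

lemma pi_map_in_simplex: "pi_map \<alpha> x \<in> simplex_product"
  using pi_map_pos[of \<alpha> x] by (auto simp: simplex_product_def pi_map_block_sum less_imp_le)

lemma simplex_le_1:
  assumes "x \<in> simplex_product" shows "x $ k \<le> 1"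
proof -
  obtain i v where k: "k = (i, v)" by fastforce
  have "x $ (i, v) \<le> (\<Sum>v\<in>UNIV. x $ (i, v))"
    by (rule member_le_sum) (use assms in \<open>auto simp: simplex_product_def\<close>)
  then show ?thesis using assms k by (auto simp: simplex_product_def)
qed

lemma simplex_nonneg: "x \<in> simplex_product \<Longrightarrow> 0 \<le> x $ k"
  by (cases k) (auto simp: simplex_product_def)

lemma simplex_block_sum: "x \<in> simplex_product \<Longrightarrow> (\<Sum>v\<in>UNIV. x $ (i, v)) = 1"
  by (auto simp: simplex_product_def)

lemma simplex_norm_le:
  assumes "x \<in> (simplex_product :: (real ^ ('m::finite \<times> 'd::finite)) set)"
  shows "norm x \<le> real CARD('m)"
proof -
  have "norm x \<le> (\<Sum>k\<in>UNIV. \<bar>x $ k\<bar>)" by (rule norm_le_l1_cart)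
  also have "\<dots> = (\<Sum>k\<in>UNIV. x $ k)" using assms by (simp add: simplex_nonneg)
  also have "\<dots> = (\<Sum>i\<in>UNIV. \<Sum>v\<in>UNIV. x $ (i, v))"
    by (simp add: sum.cartesian_product)
  also have "\<dots> = real CARD('m)" using assms by (simp add: simplex_block_sum)
  finally show ?thesis .
qed

lemma simplex_diff_norm:
  fixes x y :: "real ^ ('m::finite \<times> 'd::finite)"
  assumes "x \<in> simplex_product" "y \<in> simplex_product"
  shows "norm (x - y) \<le> 2 * real CARD('m)"
  using norm_triangle_ineq4[of x y] simplex_norm_le[OF assms(1)] simplex_norm_le[OF assms(2)] by linarith

lemma compact_simplex: "compact (simplex_product :: (real ^ ('m::finite \<times> 'd::finite)) set)"
proof -
  have "closed (simplex_product :: (real ^ ('m::finite \<times> 'd::finite)) set)"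
    unfolding simplex_product_def
    by (intro closed_Collect_conj closed_Collect_all closed_Collect_le closed_Collect_eq continuous_intros)
  moreover have "bounded (simplex_product :: (real ^ ('m::finite \<times> 'd::finite)) set)"
    using simplex_norm_le by (auto simp: bounded_iff)
  ultimately show ?thesis by (simp add: compact_eq_bounded_closed)
qed

lemma subspace_tangent: "subspace tangent"
  by (auto simp: subspace_def tangent_def block_sum_def sum.distrib sum_distrib_left[symmetric])

lemma simplex_diff_tangent: "x \<in> simplex_product \<Longrightarrow> y \<in> simplex_product \<Longrightarrow> x - y \<in> tangent"
  by (simp add: tangent_def block_sum_def sum_subtractf simplex_block_sum)

lemma cov_tangent: "p \<in> simplex_product \<Longrightarrow> cov p b \<in> tangent"
  by (simp add: tangent_def block_sum_def cov_nth right_diff_distrib sum_subtractf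
      sum_distrib_right[symmetric] simplex_block_sum)

lemma cov_symmetric: "cov p b \<bullet> c = b \<bullet> cov p c"
proof -
  have e: "cov p b \<bullet> c = (\<Sum>i\<in>UNIV. (\<Sum>v\<in>UNIV. p $ (i, v) * b $ (i, v) * c $ (i, v))
      - (\<Sum>u\<in>UNIV. p $ (i, u) * b $ (i, u)) * (\<Sum>v\<in>UNIV. p $ (i, v) * c $ (i, v)))" for b c
    by (simp add: inner_blocks cov_nth algebra_simps sum_subtractf sum_distrib_left)
  show ?thesis
    unfolding e inner_commute[of b] by (simp add: mult_ac)
qed

text \<open>
  A covariance matrix of indicator variables is positive semidefinite with norm at most \<open>1\<close>, since the
  weights \<open>p\<close> are at most \<open>1\<close>. Hence the square of \<open>cov p\<close> is at most \<open>cov p\<close>. Both the decrease of the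
  Lyapunov function and the linear analysis rest on this inequality.
\<close>

lemma cov_norm:
  assumes "p \<in> simplex_product"
  shows "(norm (cov p b))\<^sup>2 \<le> cov p b \<bullet> b"
proof -
  have block: "(\<Sum>v\<in>UNIV. (cov p b $ (i, v)) * cov p b $ (i, v)) \<le> (\<Sum>v\<in>UNIV. cov p b $ (i, v) * b $ (i, v))" for i
  proof -
    define m where "m = (\<Sum>u\<in>UNIV. p $ (i, u) * b $ (i, u))"
    have c: "cov p b $ (i, v) = p $ (i, v) * (b $ (i, v) - m)" for v by (simp add: cov_nth m_def)
    have "(\<Sum>v\<in>UNIV. cov p b $ (i, v)) = 0"
      using cov_tangent[OF assms] by (auto simp: tangent_def block_sum_def)
    then have "(\<Sum>v\<in>UNIV. cov p b $ (i, v) * b $ (i, v)) = (\<Sum>v\<in>UNIV. cov p b $ (i, v) * (b $ (i, v) - m))"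
      by (simp add: right_diff_distrib sum_subtractf sum_distrib_right[symmetric])
    moreover have "cov p b $ (i, v) * cov p b $ (i, v) \<le> cov p b $ (i, v) * (b $ (i, v) - m)" for v
    proof -
      have "p $ (i, v) * (p $ (i, v) * (b $ (i, v) - m)\<^sup>2) \<le> 1 * (p $ (i, v) * (b $ (i, v) - m)\<^sup>2)"
        using simplex_nonneg[OF assms] simplex_le_1[OF assms] by (intro mult_right_mono) auto
      then show ?thesis by (simp add: c power2_eq_square mult_ac)
    qed
    ultimately show ?thesis by (simp add: sum_mono)
  qed
  show ?thesis
    unfolding power2_norm_eq_inner inner_blocks by (intro sum_mono block)
qed

text \<open>
  Division by the weights inverts the covariance matrix on the tangent space of the simplices.
\<close>

lemma cov_recip:
  assumes "\<And>k. p $ k > 0" "z \<in> tangent"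
  shows "cov p (\<chi> k. z $ k / p $ k) = z"
proof -
  have "p $ k \<noteq> 0" for k using assms(1)[of k] by simp
  then show ?thesis using assms(2)
    by (auto simp: vec_eq_iff cov_nth tangent_def block_sum_def)
qed

lemma equilibriumD:
  assumes "p \<in> equilibria \<alpha>" shows "p \<in> simplex_product" "pi_map \<alpha> p = p" "p $ k > 0"
proof -
  show "p \<in> simplex_product" "pi_map \<alpha> p = p" using assms by (auto simp: equilibria_def F_field_def)
  then show "p $ k > 0" using pi_map_pos[of \<alpha> p k] by simp
qed

section \<open>Functions with a Lipschitz derivative\<close>

text \<open>
  Second-order estimates of the drift need functions with a Lipschitz derivative, with constants that
  are uniform on a bounded set. The derivative is kept as a function \<open>f' x\<close> of the direction, so that
  sums, products and compositions of explicit functions have explicit derivatives.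
\<close>

definition bdd_lipschitz :: "'a::real_normed_vector set \<Rightarrow> ('a \<Rightarrow> real) \<Rightarrow> bool" where
  "bdd_lipschitz S f \<longleftrightarrow>
     (\<exists>C\<ge>0. \<forall>x\<in>S. \<forall>y\<in>S. \<bar>f x\<bar> \<le> C \<and> \<bar>f x - f y\<bar> \<le> C * norm (x - y))"

definition bdd_lipschitz_form :: "'a::real_normed_vector set \<Rightarrow> ('a \<Rightarrow> 'a \<Rightarrow> real) \<Rightarrow> bool" where
  "bdd_lipschitz_form S f' \<longleftrightarrow>
     (\<exists>C\<ge>0. \<forall>x\<in>S. \<forall>y\<in>S. \<forall>z. \<bar>f' x z\<bar> \<le> C * norm z \<and>
        \<bar>f' x z - f' y z\<bar> \<le> C * norm (x - y) * norm z)"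

text \<open>
  The bound on the remainder is a clause of its own, so that the closure properties hold on sets of any shape and
  no segment between points of \<open>S\<close> has to be considered.
\<close>

definition C11_on :: "'a::real_normed_vector set \<Rightarrow> ('a \<Rightarrow> real) \<Rightarrow> ('a \<Rightarrow> 'a \<Rightarrow> real) \<Rightarrow> bool" where
  "C11_on S f f' \<longleftrightarrow> bdd_lipschitz S f \<and> bdd_lipschitz_form S f' \<and>
     (\<exists>C\<ge>0. \<forall>x\<in>S. \<forall>y\<in>S. \<bar>f y - f x - f' x (y - x)\<bar> \<le> C * (norm (y - x))\<^sup>2)"

lemma abs_mult_diff_le:
  fixes a b c d :: real
  assumes "\<bar>a\<bar> \<le> A" "\<bar>d\<bar> \<le> B" "\<bar>b - d\<bar> \<le> s" "\<bar>a - c\<bar> \<le> t"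
  shows "\<bar>a * b - c * d\<bar> \<le> A * s + t * B"
proof -
  have "a * b - c * d = a * (b - d) + (a - c) * d" by (simp add: algebra_simps)
  then have "\<bar>a * b - c * d\<bar> \<le> \<bar>a\<bar> * \<bar>b - d\<bar> + \<bar>a - c\<bar> * \<bar>d\<bar>"
    by (metis abs_mult abs_triangle_ineq)
  also have "\<dots> \<le> A * s + t * B"
    using assms by (intro add_mono mult_mono) auto
  finally show ?thesis .
qed

lemma bdd_lipschitz_add:
  assumes "bdd_lipschitz S f" "bdd_lipschitz S g"
  shows "bdd_lipschitz S (\<lambda>x. f x + g x)"
proof -
  obtain C where C: "C \<ge> 0" "\<And>x y. x \<in> S \<Longrightarrow> y \<in> S \<Longrightarrow> \<bar>f x\<bar> \<le> C \<and> \<bar>f x - f y\<bar> \<le> C * norm (x - y)"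
    using assms(1) unfolding bdd_lipschitz_def by blast
  obtain D where D: "D \<ge> 0" "\<And>x y. x \<in> S \<Longrightarrow> y \<in> S \<Longrightarrow> \<bar>g x\<bar> \<le> D \<and> \<bar>g x - g y\<bar> \<le> D * norm (x - y)"
    using assms(2) unfolding bdd_lipschitz_def by blast
  have "\<bar>f x + g x\<bar> \<le> C + D \<and> \<bar>f x + g x - (f y + g y)\<bar> \<le> (C + D) * norm (x - y)"
    if "x \<in> S" "y \<in> S" for x y
    using C(2)[OF that] D(2)[OF that] unfolding distrib_right by linarith
  then show ?thesis unfolding bdd_lipschitz_def using C D by (intro exI[of _ "C + D"]) auto
qed

lemma bdd_lipschitz_mult:
  assumes "bdd_lipschitz S f" "bdd_lipschitz S g"
  shows "bdd_lipschitz S (\<lambda>x. f x * g x)"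
proof -
  obtain C where C: "C \<ge> 0" "\<And>x y. x \<in> S \<Longrightarrow> y \<in> S \<Longrightarrow> \<bar>f x\<bar> \<le> C \<and> \<bar>f x - f y\<bar> \<le> C * norm (x - y)"
    using assms(1) unfolding bdd_lipschitz_def by blast
  obtain D where D: "D \<ge> 0" "\<And>x y. x \<in> S \<Longrightarrow> y \<in> S \<Longrightarrow> \<bar>g x\<bar> \<le> D \<and> \<bar>g x - g y\<bar> \<le> D * norm (x - y)"
    using assms(2) unfolding bdd_lipschitz_def by blast
  have "\<bar>f x * g x\<bar> \<le> 2 * C * D \<and> \<bar>f x * g x - (f y * g y)\<bar> \<le> (2 * C * D) * norm (x - y)"
    if xy: "x \<in> S" "y \<in> S" for x y
  proof
    have "\<bar>f x * g x\<bar> \<le> C * D"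
      using C(2)[OF xy] D(2)[OF xy] C(1) unfolding abs_mult by (intro mult_mono) auto
    moreover have "0 \<le> C * D" using C D by simp
    ultimately show "\<bar>f x * g x\<bar> \<le> 2 * C * D" by linarith
    have "\<bar>f x * g x - f y * g y\<bar> \<le> C * (D * norm (x - y)) + (C * norm (x - y)) * D"
      using C(2)[OF xy] D(2)[OF xy(2,2)] D(2)[OF xy] by (intro abs_mult_diff_le) auto
    then show "\<bar>f x * g x - (f y * g y)\<bar> \<le> (2 * C * D) * norm (x - y)" by (simp add: algebra_simps)
  qed
  then show ?thesis unfolding bdd_lipschitz_def using C D by (intro exI[of _ "2 * C * D"]) auto
qed

lemma bdd_lipschitz_form_add:
  assumes "bdd_lipschitz_form S f" "bdd_lipschitz_form S g"
  shows "bdd_lipschitz_form S (\<lambda>x z. f x z + g x z)"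
proof -
  obtain C where C: "C \<ge> 0" "\<And>x y z. x \<in> S \<Longrightarrow> y \<in> S \<Longrightarrow> \<bar>f x z\<bar> \<le> C * norm z \<and> \<bar>f x z - f y z\<bar> \<le> C * norm (x - y) * norm z"
    using assms(1) unfolding bdd_lipschitz_form_def by blast
  obtain D where D: "D \<ge> 0" "\<And>x y z. x \<in> S \<Longrightarrow> y \<in> S \<Longrightarrow> \<bar>g x z\<bar> \<le> D * norm z \<and> \<bar>g x z - g y z\<bar> \<le> D * norm (x - y) * norm z"
    using assms(2) unfolding bdd_lipschitz_form_def by blast
  have "\<bar>f x z + g x z\<bar> \<le> (C + D) * norm z \<and> \<bar>f x z + g x z - (f y z + g y z)\<bar> \<le> (C + D) * norm (x - y) * norm z"
    if "x \<in> S" "y \<in> S" for x y z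
    using C(2)[OF that, of z] D(2)[OF that, of z] unfolding distrib_right by linarith
  then show ?thesis unfolding bdd_lipschitz_form_def using C D by (intro exI[of _ "C + D"]) auto
qed

lemma bdd_lipschitz_form_scale:
  assumes "bdd_lipschitz S f" "bdd_lipschitz_form S g"
  shows "bdd_lipschitz_form S (\<lambda>x z. f x * g x z)"
proof -
  obtain C where C: "C \<ge> 0" "\<And>x y. x \<in> S \<Longrightarrow> y \<in> S \<Longrightarrow> \<bar>f x\<bar> \<le> C \<and> \<bar>f x - f y\<bar> \<le> C * norm (x - y)"
    using assms(1) unfolding bdd_lipschitz_def by blast
  obtain D where D: "D \<ge> 0" "\<And>x y z. x \<in> S \<Longrightarrow> y \<in> S \<Longrightarrow> \<bar>g x z\<bar> \<le> D * norm z \<and> \<bar>g x z - g y z\<bar> \<le> D * norm (x - y) * norm z"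
    using assms(2) unfolding bdd_lipschitz_form_def by blast
  have "\<bar>f x * g x z\<bar> \<le> 2 * C * D * norm z \<and> \<bar>f x * g x z - (f y * g y z)\<bar> \<le> (2 * C * D) * norm (x - y) * norm z"
    if xy: "x \<in> S" "y \<in> S" for x y z
  proof
    have "\<bar>f x * g x z\<bar> \<le> C * (D * norm z)"
      using C(2)[OF xy] D(2)[OF xy, of z] C(1) unfolding abs_mult by (intro mult_mono) auto
    moreover have "0 \<le> C * (D * norm z)" using C D by simp
    ultimately show "\<bar>f x * g x z\<bar> \<le> 2 * C * D * norm z" by (simp add: mult_ac)
    have "\<bar>f x * g x z - f y * g y z\<bar> \<le> C * (D * norm (x - y) * norm z) + (C * norm (x - y)) * (D * norm z)"
      using C(2)[OF xy] D(2)[OF xy(2,2), of z] D(2)[OF xy, of z] by (intro abs_mult_diff_le) auto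
    then show "\<bar>f x * g x z - (f y * g y z)\<bar> \<le> (2 * C * D) * norm (x - y) * norm z" by (simp add: algebra_simps)
  qed
  then show ?thesis unfolding bdd_lipschitz_form_def using C D by (intro exI[of _ "2 * C * D"]) auto
qed

lemma C11_on_add:
  assumes "C11_on S f f'" "C11_on S g g'"
  shows "C11_on S (\<lambda>x. f x + g x) (\<lambda>x z. f' x z + g' x z)"
proof -
  obtain C where C: "C \<ge> 0" "\<And>x y. x \<in> S \<Longrightarrow> y \<in> S \<Longrightarrow> \<bar>f y - f x - f' x (y - x)\<bar> \<le> C * (norm (y - x))\<^sup>2"
    using assms(1) unfolding C11_on_def by blast
  obtain D where D: "D \<ge> 0" "\<And>x y. x \<in> S \<Longrightarrow> y \<in> S \<Longrightarrow> \<bar>g y - g x - g' x (y - x)\<bar> \<le> D * (norm (y - x))\<^sup>2"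
    using assms(2) unfolding C11_on_def by blast
  have "\<bar>f y + g y - (f x + g x) - (f' x (y - x) + g' x (y - x))\<bar> \<le> (C + D) * (norm (y - x))\<^sup>2"
    if "x \<in> S" "y \<in> S" for x y
    using C(2)[OF that] D(2)[OF that] by (simp add: algebra_simps)
  then show ?thesis using assms C D bdd_lipschitz_add bdd_lipschitz_form_add
    unfolding C11_on_def by (auto intro!: exI[of _ "C + D"])
qed

lemma C11_on_mult:
  assumes "C11_on S f f'" "C11_on S g g'"
  shows "C11_on S (\<lambda>x. f x * g x) (\<lambda>x z. f x * g' x z + g x * f' x z)"
proof -
  obtain C where C: "C \<ge> 0" "\<And>x y. x \<in> S \<Longrightarrow> y \<in> S \<Longrightarrow> \<bar>f y - f x - f' x (y - x)\<bar> \<le> C * (norm (y - x))\<^sup>2"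
    using assms(1) unfolding C11_on_def by blast
  obtain D where D: "D \<ge> 0" "\<And>x y. x \<in> S \<Longrightarrow> y \<in> S \<Longrightarrow> \<bar>g y - g x - g' x (y - x)\<bar> \<le> D * (norm (y - x))\<^sup>2"
    using assms(2) unfolding C11_on_def by blast
  obtain E where E: "E \<ge> 0" "\<And>x y. x \<in> S \<Longrightarrow> y \<in> S \<Longrightarrow> \<bar>f x\<bar> \<le> E \<and> \<bar>f x - f y\<bar> \<le> E * norm (x - y)"
    using assms(1) unfolding C11_on_def bdd_lipschitz_def by blast
  obtain G where G: "G \<ge> 0" "\<And>x y. x \<in> S \<Longrightarrow> y \<in> S \<Longrightarrow> \<bar>g x\<bar> \<le> G \<and> \<bar>g x - g y\<bar> \<le> G * norm (x - y)"
    using assms(2) unfolding C11_on_def bdd_lipschitz_def by blast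
  have "\<bar>f y * g y - f x * g x - (f x * g' x (y - x) + g x * f' x (y - x))\<bar>
      \<le> (E * D + G * C + E * G) * (norm (y - x))\<^sup>2"
    if xy: "x \<in> S" "y \<in> S" for x y
  proof -
    have "f y * g y - f x * g x - (f x * g' x (y - x) + g x * f' x (y - x))
      = f x * (g y - g x - g' x (y - x)) + g x * (f y - f x - f' x (y - x)) + (f y - f x) * (g y - g x)"
      by (simp add: algebra_simps)
    also have "\<bar>\<dots>\<bar> \<le> \<bar>f x\<bar> * \<bar>g y - g x - g' x (y - x)\<bar> + \<bar>g x\<bar> * \<bar>f y - f x - f' x (y - x)\<bar>
        + \<bar>f y - f x\<bar> * \<bar>g y - g x\<bar>"
      unfolding abs_mult[symmetric] by linarith
    also have "\<dots> \<le> E * (D * (norm (y - x))\<^sup>2) + G * (C * (norm (y - x))\<^sup>2) + (E * norm (y - x)) * (G * norm (y - x))"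
      using C(2)[OF xy] D(2)[OF xy] E(2)[OF xy] G(2)[OF xy] E(2)[OF xy(2,1)] G(2)[OF xy(2,1)] E(1) G(1)
      by (intro add_mono mult_mono) auto
    finally show ?thesis by (simp add: algebra_simps power2_eq_square)
  qed
  then have "\<exists>C\<ge>0. \<forall>x\<in>S. \<forall>y\<in>S.
      \<bar>f y * g y - f x * g x - (f x * g' x (y - x) + g x * f' x (y - x))\<bar> \<le> C * (norm (y - x))\<^sup>2"
    using C D E G by (intro exI[of _ "E * D + G * C + E * G"]) auto
  moreover have "bdd_lipschitz_form S (\<lambda>x z. f x * g' x z + g x * f' x z)"
    using assms by (intro bdd_lipschitz_form_add bdd_lipschitz_form_scale) (auto simp: C11_on_def)
  ultimately show ?thesis using assms bdd_lipschitz_mult unfolding C11_on_def by auto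
qed

lemma C11_on_const: "C11_on S (\<lambda>x. c) (\<lambda>x z. 0)"
  unfolding C11_on_def bdd_lipschitz_def bdd_lipschitz_form_def
  by (intro conjI exI[of _ "\<bar>c\<bar>"]) auto

lemma C11_on_linear:
  assumes "bounded S" "bounded_linear l"
  shows "C11_on S l (\<lambda>x z. l z)"
proof -
  obtain K where K: "K \<ge> 0" "\<And>x. norm (l x) \<le> norm x * K"
    using bounded_linear.nonneg_bounded[OF assms(2)] by blast
  obtain R where R: "R \<ge> 0" "\<And>x. x \<in> S \<Longrightarrow> norm x \<le> R"
    using assms(1) unfolding bounded_pos by (meson less_imp_le)
  have lin: "l (x - y) = l x - l y" for x y
    using assms(2) by (simp add: bounded_linear.linear linear_diff)
  have "\<bar>l x\<bar> \<le> K * R + K" if "x \<in> S" for x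
  proof -
    have "norm x * K \<le> R * K" using R(2)[OF that] K by (intro mult_right_mono) auto
    then show ?thesis using K(2)[of x] K(1) by (simp add: mult_ac)
  qed
  moreover have "\<bar>l x - l y\<bar> \<le> (K * R + K) * norm (x - y)" for x y
  proof -
    have "\<bar>l x - l y\<bar> \<le> K * norm (x - y)" using K(2)[of "x - y"] by (simp add: lin mult_ac)
    moreover have "K * R * norm (x - y) \<ge> 0" using K R by simp
    ultimately show ?thesis by (simp add: algebra_simps)
  qed
  ultimately have "bdd_lipschitz S l"
    unfolding bdd_lipschitz_def using K R by (intro exI[of _ "K * R + K"]) auto
  moreover have "bdd_lipschitz_form S (\<lambda>x z. l z)"
    unfolding bdd_lipschitz_form_def using K by (intro exI[of _ K]) (auto simp: mult.commute)
  ultimately show ?thesis unfolding C11_on_def by (auto simp: lin intro: exI[of _ 0])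
qed

lemma C11_on_cong:
  assumes "C11_on S f f'" "\<And>x. x \<in> S \<Longrightarrow> g x = f x" "\<And>x z. x \<in> S \<Longrightarrow> g' x z = f' x z"
  shows "C11_on S g g'"
  using assms unfolding C11_on_def bdd_lipschitz_def bdd_lipschitz_form_def by auto

lemma C11_on_cmult:
  assumes "C11_on S f f'"
  shows "C11_on S (\<lambda>x. c * f x) (\<lambda>x z. c * f' x z)"
  by (rule C11_on_cong[OF C11_on_mult[OF C11_on_const[of S c] assms]]) auto

lemma C11_on_diff:
  assumes "C11_on S f f'" "C11_on S g g'"
  shows "C11_on S (\<lambda>x. f x - g x) (\<lambda>x z. f' x z - g' x z)"
  by (rule C11_on_cong[OF C11_on_add[OF assms(1) C11_on_cmult[OF assms(2), of "-1"]]]) auto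

lemma C11_on_sum:
  assumes "finite I" "\<And>i. i \<in> I \<Longrightarrow> C11_on S (f i) (f' i)"
  shows "C11_on S (\<lambda>x. \<Sum>i\<in>I. f i x) (\<lambda>x z. \<Sum>i\<in>I. f' i x z)"
  using assms by (induction I rule: finite_induct) (simp_all add: C11_on_const C11_on_add)

text \<open>
  A twice continuously differentiable function on a compact interval has uniform constants. The remainder is
  estimated by two applications of the mean value theorem.
\<close>

lemma scalar_C11:
  fixes \<phi> \<phi>' \<phi>'' :: "real \<Rightarrow> real"
  assumes d1: "\<And>t. t \<in> {a..b} \<Longrightarrow> (\<phi> has_real_derivative \<phi>' t) (at t)"
    and d2: "\<And>t. t \<in> {a..b} \<Longrightarrow> (\<phi>' has_real_derivative \<phi>'' t) (at t)"
    and cont: "continuous_on {a..b} \<phi>''"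
  obtains K where "K \<ge> 0" "\<And>s t. s \<in> {a..b} \<Longrightarrow> t \<in> {a..b} \<Longrightarrow>
      \<bar>\<phi> s\<bar> \<le> K \<and> \<bar>\<phi>' s\<bar> \<le> K \<and> \<bar>\<phi> s - \<phi> t\<bar> \<le> K * \<bar>s - t\<bar> \<and> \<bar>\<phi>' s - \<phi>' t\<bar> \<le> K * \<bar>s - t\<bar> \<and>
      \<bar>\<phi> s - \<phi> t - \<phi>' t * (s - t)\<bar> \<le> K * (s - t)\<^sup>2"
proof -
  have bdd: "\<exists>K\<ge>0. \<forall>t\<in>{a..b}. \<bar>g t\<bar> \<le> K" if "continuous_on {a..b} g" for g :: "real \<Rightarrow> real"
  proof -
    have "bounded (g ` {a..b})" using that compact_continuous_image compact_imp_bounded by blast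
    then show ?thesis unfolding bounded_pos by (auto intro: less_imp_le)
  qed
  have c0: "continuous_on {a..b} \<phi>" and c1: "continuous_on {a..b} \<phi>'"
    using d1 d2 by (meson DERIV_continuous_on has_field_derivative_at_within)+
  obtain K0 K1 K2 where K: "K0 \<ge> 0" "K1 \<ge> 0" "K2 \<ge> 0"
    "\<And>t. t \<in> {a..b} \<Longrightarrow> \<bar>\<phi> t\<bar> \<le> K0" "\<And>t. t \<in> {a..b} \<Longrightarrow> \<bar>\<phi>' t\<bar> \<le> K1" "\<And>t. t \<in> {a..b} \<Longrightarrow> \<bar>\<phi>'' t\<bar> \<le> K2"
    using bdd[OF c0] bdd[OF c1] bdd[OF cont] by metis
  have mvt: "\<exists>\<xi>\<in>{a..b}. \<bar>\<xi> - t\<bar> \<le> \<bar>s - t\<bar> \<and> g s - g t = g' \<xi> * (s - t)"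
    if g: "\<And>t. t \<in> {a..b} \<Longrightarrow> (g has_real_derivative g' t) (at t)" and st: "s \<in> {a..b}" "t \<in> {a..b}"
    for g g' :: "real \<Rightarrow> real" and s t
  proof (cases s t rule: linorder_cases)
    case less
    have "\<And>x. s \<le> x \<Longrightarrow> x \<le> t \<Longrightarrow> (g has_real_derivative g' x) (at x)" using g st by auto
    from MVT2[OF less this] obtain z where "z > s" "z < t" "g t - g s = (t - s) * g' z" by blast
    then show ?thesis using st by (intro bexI[of _ z]) (auto simp: algebra_simps)
  next
    case equal
    then show ?thesis using st by auto
  next
    case greater
    have "\<And>x. t \<le> x \<Longrightarrow> x \<le> s \<Longrightarrow> (g has_real_derivative g' x) (at x)" using g st by auto
    from MVT2[OF greater this] obtain z where "z > t" "z < s" "g s - g t = (s - t) * g' z" by blast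
    then show ?thesis using st by (intro bexI[of _ z]) (auto simp: algebra_simps)
  qed
  have lip: "\<bar>\<phi> s - \<phi> t\<bar> \<le> K1 * \<bar>s - t\<bar>" if st: "s \<in> {a..b}" "t \<in> {a..b}" for s t
  proof -
    obtain \<xi> where "\<xi> \<in> {a..b}" "\<phi> s - \<phi> t = \<phi>' \<xi> * (s - t)" using mvt[where g=\<phi> and g'=\<phi>' and s=s and t=t] d1 st by blast
    then show ?thesis using K(5)[of \<xi>] by (simp add: abs_mult mult_right_mono)
  qed
  have lip': "\<bar>\<phi>' s - \<phi>' t\<bar> \<le> K2 * \<bar>s - t\<bar>" if st: "s \<in> {a..b}" "t \<in> {a..b}" for s t
  proof -
    obtain \<xi> where "\<xi> \<in> {a..b}" "\<phi>' s - \<phi>' t = \<phi>'' \<xi> * (s - t)" using mvt[where g=\<phi>' and g'=\<phi>'' and s=s and t=t] d2 st by blast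
    then show ?thesis using K(6)[of \<xi>] by (simp add: abs_mult mult_right_mono)
  qed
  have taylor: "\<bar>\<phi> s - \<phi> t - \<phi>' t * (s - t)\<bar> \<le> K2 * (s - t)\<^sup>2" if st: "s \<in> {a..b}" "t \<in> {a..b}" for s t
  proof -
    obtain \<xi> where x: "\<xi> \<in> {a..b}" "\<bar>\<xi> - t\<bar> \<le> \<bar>s - t\<bar>" "\<phi> s - \<phi> t = \<phi>' \<xi> * (s - t)"
      using mvt[where g=\<phi> and g'=\<phi>' and s=s and t=t] d1 st by blast
    have "\<bar>\<phi> s - \<phi> t - \<phi>' t * (s - t)\<bar> = \<bar>\<phi>' \<xi> - \<phi>' t\<bar> * \<bar>s - t\<bar>"
      by (simp add: x(3) abs_mult[symmetric] algebra_simps)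
    also have "\<dots> \<le> (K2 * \<bar>s - t\<bar>) * \<bar>s - t\<bar>"
      using lip'[OF x(1) st(2)] mult_left_mono[OF x(2) K(3)] by (intro mult_right_mono) auto
    finally show ?thesis by (simp add: power2_eq_square abs_mult_self_eq mult.assoc)
  qed
  define K where "K = K0 + K1 + K2"
  show ?thesis
  proof (rule that[of K])
    show "K \<ge> 0" using K by (simp add: K_def)
    fix s t assume st: "s \<in> {a..b}" "t \<in> {a..b}"
    have m: "K1 * \<bar>s - t\<bar> \<le> K * \<bar>s - t\<bar>" "K2 * \<bar>s - t\<bar> \<le> K * \<bar>s - t\<bar>" "K2 * (s - t)\<^sup>2 \<le> K * (s - t)\<^sup>2"
      using K(1-3) by (auto simp: K_def intro!: mult_right_mono)
    have "\<bar>\<phi> s\<bar> \<le> K" "\<bar>\<phi>' s\<bar> \<le> K" using K(4,5)[OF st(1)] K(1-3) by (auto simp: K_def)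
    then show "\<bar>\<phi> s\<bar> \<le> K \<and> \<bar>\<phi>' s\<bar> \<le> K \<and> \<bar>\<phi> s - \<phi> t\<bar> \<le> K * \<bar>s - t\<bar> \<and> \<bar>\<phi>' s - \<phi>' t\<bar> \<le> K * \<bar>s - t\<bar> \<and>
      \<bar>\<phi> s - \<phi> t - \<phi>' t * (s - t)\<bar> \<le> K * (s - t)\<^sup>2"
      using lip[OF st] lip'[OF st] taylor[OF st] m by auto
  qed
qed

lemma C11_on_compose:
  fixes \<phi> \<phi>' \<phi>'' :: "real \<Rightarrow> real"
  assumes f: "C11_on S f f'" and range: "\<And>x. x \<in> S \<Longrightarrow> f x \<in> {a..b}"
    and d1: "\<And>t. t \<in> {a..b} \<Longrightarrow> (\<phi> has_real_derivative \<phi>' t) (at t)"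
    and d2: "\<And>t. t \<in> {a..b} \<Longrightarrow> (\<phi>' has_real_derivative \<phi>'' t) (at t)"
    and cont: "continuous_on {a..b} \<phi>''"
  shows "C11_on S (\<lambda>x. \<phi> (f x)) (\<lambda>x z. \<phi>' (f x) * f' x z)"
proof -
  obtain K where K: "K \<ge> 0" "\<And>s t. s \<in> {a..b} \<Longrightarrow> t \<in> {a..b} \<Longrightarrow>
      \<bar>\<phi> s\<bar> \<le> K \<and> \<bar>\<phi>' s\<bar> \<le> K \<and> \<bar>\<phi> s - \<phi> t\<bar> \<le> K * \<bar>s - t\<bar> \<and> \<bar>\<phi>' s - \<phi>' t\<bar> \<le> K * \<bar>s - t\<bar> \<and>
      \<bar>\<phi> s - \<phi> t - \<phi>' t * (s - t)\<bar> \<le> K * (s - t)\<^sup>2"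
    using scalar_C11[OF d1 d2 cont] by blast
  obtain E where E: "E \<ge> 0" "\<And>x y. x \<in> S \<Longrightarrow> y \<in> S \<Longrightarrow> \<bar>f x\<bar> \<le> E \<and> \<bar>f x - f y\<bar> \<le> E * norm (x - y)"
    using f unfolding C11_on_def bdd_lipschitz_def by blast
  obtain C where C: "C \<ge> 0" "\<And>x y. x \<in> S \<Longrightarrow> y \<in> S \<Longrightarrow> \<bar>f y - f x - f' x (y - x)\<bar> \<le> C * (norm (y - x))\<^sup>2"
    using f unfolding C11_on_def by blast
  have KE: "K * \<bar>f x - f y\<bar> \<le> (K + K * E) * norm (x - y)" if "x \<in> S" "y \<in> S" for x y
  proof -
    have "K * \<bar>f x - f y\<bar> \<le> K * (E * norm (x - y))" using E(2)[OF that] K(1) by (intro mult_left_mono) auto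
    moreover have "0 \<le> K * norm (x - y)" using K by simp
    ultimately show ?thesis by (simp add: algebra_simps)
  qed
  have K': "K \<le> K + K * E" using K E by simp
  have "\<bar>\<phi> (f x)\<bar> \<le> K + K * E \<and> \<bar>\<phi> (f x) - \<phi> (f y)\<bar> \<le> (K + K * E) * norm (x - y)"
    "\<bar>\<phi>' (f x)\<bar> \<le> K + K * E \<and> \<bar>\<phi>' (f x) - \<phi>' (f y)\<bar> \<le> (K + K * E) * norm (x - y)"
    if xy: "x \<in> S" "y \<in> S" for x y
    using K(2)[OF range[OF xy(1)] range[OF xy(2)]] KE[OF xy] K' by linarith+
  then have "bdd_lipschitz S (\<lambda>x. \<phi> (f x))" "bdd_lipschitz S (\<lambda>x. \<phi>' (f x))"
    unfolding bdd_lipschitz_def using K(1) E(1) by (auto intro!: exI[of _ "K + K * E"])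
  moreover have "\<bar>\<phi> (f y) - \<phi> (f x) - \<phi>' (f x) * f' x (y - x)\<bar> \<le> (K * E\<^sup>2 + K * C) * (norm (y - x))\<^sup>2"
    if xy: "x \<in> S" "y \<in> S" for x y
  proof -
    have 1: "(f y - f x)\<^sup>2 \<le> (E * norm (y - x))\<^sup>2"
      using E(2)[OF xy(2,1)] by (metis abs_ge_zero power2_abs power_mono)
    have "\<phi> (f y) - \<phi> (f x) - \<phi>' (f x) * f' x (y - x)
      = (\<phi> (f y) - \<phi> (f x) - \<phi>' (f x) * (f y - f x)) + \<phi>' (f x) * (f y - f x - f' x (y - x))"
      by (simp add: algebra_simps)
    also have "\<bar>\<dots>\<bar> \<le> \<bar>\<phi> (f y) - \<phi> (f x) - \<phi>' (f x) * (f y - f x)\<bar> + \<bar>\<phi>' (f x)\<bar> * \<bar>f y - f x - f' x (y - x)\<bar>"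
      unfolding abs_mult[symmetric] by linarith
    also have "\<dots> \<le> K * (E * norm (y - x))\<^sup>2 + K * (C * (norm (y - x))\<^sup>2)"
    proof (intro add_mono mult_mono)
      have "\<bar>\<phi> (f y) - \<phi> (f x) - \<phi>' (f x) * (f y - f x)\<bar> \<le> K * (f y - f x)\<^sup>2"
        using K(2)[OF range[OF xy(2)] range[OF xy(1)]] by blast
      also have "\<dots> \<le> K * (E * norm (y - x))\<^sup>2" using 1 K(1) by (rule mult_left_mono)
      finally show "\<bar>\<phi> (f y) - \<phi> (f x) - \<phi>' (f x) * (f y - f x)\<bar> \<le> K * (E * norm (y - x))\<^sup>2" .
    qed (use K(1) C(2)[OF xy] K(2)[OF range[OF xy(1)] range[OF xy(2)]] in auto)
    finally show ?thesis by (simp add: algebra_simps power2_eq_square)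
  qed
  ultimately show ?thesis using f K(1) E C(1) bdd_lipschitz_form_scale
    unfolding C11_on_def by (auto intro!: exI[of _ "K * E\<^sup>2 + K * C"])
qed

lemma C11_on_bounded:
  assumes "C11_on S f f'"
  obtains E where "E \<ge> 0" "\<And>x. x \<in> S \<Longrightarrow> \<bar>f x\<bar> \<le> E"
  using assms unfolding C11_on_def bdd_lipschitz_def by blast

lemma C11_on_exp:
  assumes "C11_on S f f'"
  shows "C11_on S (\<lambda>x. exp (f x)) (\<lambda>x z. exp (f x) * f' x z)"
proof -
  obtain E where E: "\<And>x. x \<in> S \<Longrightarrow> \<bar>f x\<bar> \<le> E" using C11_on_bounded[OF assms] by blast
  show ?thesis
  proof (rule C11_on_compose[OF assms, of "-E" E exp exp exp])
    show "f x \<in> {-E..E}" if "x \<in> S" for x using E[OF that] by auto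
  qed (auto intro!: continuous_intros derivative_intros)
qed

lemma C11_on_ln:
  assumes "C11_on S f f'" "c > 0" "\<And>x. x \<in> S \<Longrightarrow> f x \<ge> c"
  shows "C11_on S (\<lambda>x. ln (f x)) (\<lambda>x z. inverse (f x) * f' x z)"
proof -
  obtain E where E: "\<And>x. x \<in> S \<Longrightarrow> \<bar>f x\<bar> \<le> E" using C11_on_bounded[OF assms(1)] by blast
  show ?thesis
  proof (rule C11_on_compose[OF assms(1), of c E ln inverse "\<lambda>t. - (inverse t)\<^sup>2"])
    show "f x \<in> {c..E}" if "x \<in> S" for x using E[OF that] assms(3)[OF that] by auto
    show "(ln has_real_derivative inverse t) (at t)" if "t \<in> {c..E}" for t
      using that assms(2) by (auto intro!: derivative_eq_intros simp: divide_inverse)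
    show "(inverse has_real_derivative - (inverse t)\<^sup>2) (at t)" if "t \<in> {c..E}" for t
      using that assms(2) by (auto intro!: derivative_eq_intros simp: power2_eq_square)
  qed (use assms(2) in \<open>auto intro!: continuous_intros\<close>)
qed

definition C11_vec_on ::
  "'a::real_normed_vector set \<Rightarrow> ('a \<Rightarrow> real ^ 'n::finite) \<Rightarrow> ('a \<Rightarrow> 'a \<Rightarrow> real ^ 'n) \<Rightarrow> bool" where
  "C11_vec_on S f f' \<longleftrightarrow> (\<forall>k. C11_on S (\<lambda>x. f x $ k) (\<lambda>x z. f' x z $ k))"

lemma C11_vec_on_id:
  assumes "bounded S" shows "C11_vec_on S (\<lambda>x. x) (\<lambda>x z. z)"
  unfolding C11_vec_on_def using C11_on_linear[OF assms bounded_linear_vec_nth] by blast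

lemma C11_vec_on_linear:
  assumes f: "C11_vec_on S f f'" and L: "linear L"
  shows "C11_vec_on S (\<lambda>x. L (f x)) (\<lambda>x z. L (f' x z))"
proof -
  have L': "L y $ k = (\<Sum>j\<in>UNIV. matrix L $ k $ j * y $ j)" for y k
    using matrix_works[of L y] L unfolding linear_matrix_vector_mul_eq[symmetric] by (metis (no_types) matrix_vector_mult_def vec_lambda_beta)
  show ?thesis
    unfolding C11_vec_on_def L'
    using f by (auto simp: C11_vec_on_def intro!: C11_on_sum C11_on_cmult)
qed

lemma C11_vec_on_diff:
  assumes "C11_vec_on S f f'" "C11_vec_on S g g'"
  shows "C11_vec_on S (\<lambda>x. f x - g x) (\<lambda>x z. f' x z - g' x z)"
  using assms by (auto simp: C11_vec_on_def intro!: C11_on_diff)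

lemma C11_on_inner:
  assumes "C11_vec_on S f f'" "C11_vec_on S g g'"
  shows "C11_on S (\<lambda>x. f x \<bullet> g x) (\<lambda>x z. f x \<bullet> g' x z + g x \<bullet> f' x z)"
proof -
  have "C11_on S (\<lambda>x. \<Sum>k\<in>UNIV. f x $ k * g x $ k) (\<lambda>x z. \<Sum>k\<in>UNIV. f x $ k * g' x z $ k + g x $ k * f' x z $ k)"
    using assms by (intro C11_on_sum C11_on_mult) (auto simp: C11_vec_on_def)
  then show ?thesis by (simp add: inner_vec_def sum.distrib)
qed

lemma C11_vec_on_norm_bounds:
  fixes f :: "'a::real_normed_vector \<Rightarrow> real ^ 'n::finite"
  assumes "C11_vec_on S f f'"
  obtains C where "C \<ge> 0"
    "\<And>x y. x \<in> S \<Longrightarrow> y \<in> S \<Longrightarrow> norm (f y - f x - f' x (y - x)) \<le> C * (norm (y - x))\<^sup>2"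
    "\<And>x y. x \<in> S \<Longrightarrow> y \<in> S \<Longrightarrow> norm (f y - f x) \<le> C * norm (y - x)"
    "\<And>x y z. x \<in> S \<Longrightarrow> y \<in> S \<Longrightarrow> norm (f' y z - f' x z) \<le> C * norm (y - x) * norm z"
proof -
  have "\<forall>k. \<exists>C\<ge>0. \<forall>x\<in>S. \<forall>y\<in>S. \<forall>z. \<bar>f y $ k - f x $ k - f' x (y - x) $ k\<bar> \<le> C * (norm (y - x))\<^sup>2 \<and>
      \<bar>f y $ k - f x $ k\<bar> \<le> C * norm (y - x) \<and> \<bar>f' y z $ k - f' x z $ k\<bar> \<le> C * norm (y - x) * norm z"
  proof
    fix k
    have a: "C11_on S (\<lambda>x. f x $ k) (\<lambda>x z. f' x z $ k)" using assms by (simp add: C11_vec_on_def)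
    obtain A where A: "A \<ge> 0" "\<And>x y. x \<in> S \<Longrightarrow> y \<in> S \<Longrightarrow> \<bar>f y $ k - f x $ k - f' x (y - x) $ k\<bar> \<le> A * (norm (y - x))\<^sup>2"
      using a unfolding C11_on_def by blast
    obtain B where B: "B \<ge> 0" "\<And>x y. x \<in> S \<Longrightarrow> y \<in> S \<Longrightarrow> \<bar>f x $ k - f y $ k\<bar> \<le> B * norm (x - y)"
      using a unfolding C11_on_def bdd_lipschitz_def by blast
    obtain D where D: "D \<ge> 0" "\<And>x y z. x \<in> S \<Longrightarrow> y \<in> S \<Longrightarrow> \<bar>f' x z $ k - f' y z $ k\<bar> \<le> D * norm (x - y) * norm z"
      using a unfolding C11_on_def bdd_lipschitz_form_def by blast
    have m: "A * t \<le> (A + B + D) * t" "B * t \<le> (A + B + D) * t" "D * t * u \<le> (A + B + D) * t * u" if "t \<ge> 0" "u \<ge> 0" for t u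
      using A B D that by (auto intro!: mult_right_mono)
    have "\<bar>f y $ k - f x $ k - f' x (y - x) $ k\<bar> \<le> (A + B + D) * (norm (y - x))\<^sup>2 \<and>
      \<bar>f y $ k - f x $ k\<bar> \<le> (A + B + D) * norm (y - x) \<and> \<bar>f' y z $ k - f' x z $ k\<bar> \<le> (A + B + D) * norm (y - x) * norm z"
      if xy: "x \<in> S" "y \<in> S" for x y z
      using order_trans[OF A(2)[OF xy] m(1)[where u = 0]] order_trans[OF B(2)[OF xy(2,1)] m(2)[where u = 0]]
        order_trans[OF D(2)[OF xy(2,1)] m(3)] by simp
    then show "\<exists>C\<ge>0. \<forall>x\<in>S. \<forall>y\<in>S. \<forall>z. \<bar>f y $ k - f x $ k - f' x (y - x) $ k\<bar> \<le> C * (norm (y - x))\<^sup>2 \<and>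
      \<bar>f y $ k - f x $ k\<bar> \<le> C * norm (y - x) \<and> \<bar>f' y z $ k - f' x z $ k\<bar> \<le> C * norm (y - x) * norm z"
      using A(1) B(1) D(1) by (intro exI[of _ "A + B + D"]) simp
  qed
  from choice[OF this] obtain c where "\<forall>k. c k \<ge> 0 \<and> (\<forall>x\<in>S. \<forall>y\<in>S. \<forall>z.
      \<bar>f y $ k - f x $ k - f' x (y - x) $ k\<bar> \<le> c k * (norm (y - x))\<^sup>2 \<and>
      \<bar>f y $ k - f x $ k\<bar> \<le> c k * norm (y - x) \<and> \<bar>f' y z $ k - f' x z $ k\<bar> \<le> c k * norm (y - x) * norm z)"
    by blast
  then have c: "\<And>k. c k \<ge> 0"
    "\<And>k x y z. x \<in> S \<Longrightarrow> y \<in> S \<Longrightarrow> \<bar>(f y - f x - f' x (y - x)) $ k\<bar> \<le> c k * (norm (y - x))\<^sup>2"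
    "\<And>k x y z. x \<in> S \<Longrightarrow> y \<in> S \<Longrightarrow> \<bar>(f y - f x) $ k\<bar> \<le> c k * norm (y - x)"
    "\<And>k x y z. x \<in> S \<Longrightarrow> y \<in> S \<Longrightarrow> \<bar>(f' y z - f' x z) $ k\<bar> \<le> c k * norm (y - x) * norm z"
    by simp_all
  have s: "norm v \<le> (\<Sum>k\<in>UNIV. c k) * t" if "\<And>k. \<bar>v $ k\<bar> \<le> c k * t" for v :: "real ^ 'n" and t
    unfolding sum_distrib_right using norm_le_l1_cart[of v] sum_mono[of UNIV "\<lambda>k. \<bar>v $ k\<bar>" "\<lambda>k. c k * t"] that by auto
  show ?thesis
  proof (rule that[of "\<Sum>k\<in>UNIV. c k"])
    show "(\<Sum>k\<in>UNIV. c k) \<ge> 0" using c(1) by (simp add: sum_nonneg)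
    show "norm (f' y z - f' x z) \<le> (\<Sum>k\<in>UNIV. c k) * norm (y - x) * norm z" if "x \<in> S" "y \<in> S" for x y z
      using s[of "f' y z - f' x z" "norm (y - x) * norm z"] c(4)[OF that] by (simp add: mult.assoc)
  qed (use s c in blast)+
qed

lemma C11_vec_on_has_derivative:
  fixes f :: "'a::real_normed_vector \<Rightarrow> real ^ 'n::finite"
  assumes "C11_vec_on S f f'" "open S" "x \<in> S" "bounded_linear (f' x)"
  shows "(f has_derivative f' x) (at x)"
proof -
  obtain C where C: "C \<ge> 0"
    "\<And>x y. x \<in> S \<Longrightarrow> y \<in> S \<Longrightarrow> norm (f y - f x - f' x (y - x)) \<le> C * (norm (y - x))\<^sup>2"
    using C11_vec_on_norm_bounds[OF assms(1)] by metis
  obtain e where e: "e > 0" "ball x e \<subseteq> S" using assms(2,3) openE by blast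
  show ?thesis
  proof (rule has_derivativeI_sandwich[OF e(1) assms(4)])
    show "norm (f y - f x - f' x (y - x)) / norm (y - x) \<le> C * norm (y - x)" if "y \<noteq> x" "dist y x < e" for y
    proof -
      have "y \<in> S" using that e by (auto simp: dist_commute)
      then show ?thesis using C(2)[OF assms(3), of y] that(1)
        by (simp add: divide_simps power2_eq_square mult_ac)
    qed
    have "(\<lambda>y. C * norm (y - x)) \<midarrow>x\<rightarrow> C * norm (x - x)" by (intro tendsto_intros)
    then show "(\<lambda>y. C * norm (y - x)) \<midarrow>x\<rightarrow> 0" by simp
  qed
qed

section \<open>The field and a global Lyapunov function\<close>

definition dpi ::
  "('m::finite, 'd::finite) params \<Rightarrow> real ^ ('m \<times> 'd) \<Rightarrow> real ^ ('m \<times> 'd) \<Rightarrow> real ^ ('m \<times> 'd)" where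
  "dpi \<alpha> x z = cov (pi_map \<alpha> x) (coupling \<alpha> z)"

lemma linear_dpi: "linear (dpi \<alpha> x)"
  unfolding dpi_def using linear_compose[OF linear_coupling linear_cov] by (simp add: o_def)

lemma C11_coupling: "bounded S \<Longrightarrow> C11_vec_on S (coupling \<alpha>) (\<lambda>x z. coupling \<alpha> z)"
  using C11_vec_on_linear[OF C11_vec_on_id linear_coupling] .

text \<open>
  The gradient of the logarithm of the partition function is the vector of probabilities.
\<close>

lemma C11_ln_partition:
  assumes S: "bounded S"
  shows "C11_on S (\<lambda>x. ln (partition_fun \<alpha> i x))
     (\<lambda>x z. \<Sum>u\<in>UNIV. pi_map \<alpha> x $ (i, u) * coupling \<alpha> z $ (i, u))"
proof -
  have lin: "C11_on S (\<lambda>x. coupling \<alpha> x $ k) (\<lambda>x z. coupling \<alpha> z $ k)" for k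
    using C11_coupling[OF S, of \<alpha>] unfolding C11_vec_on_def by blast
  obtain E where E: "\<And>x. x \<in> S \<Longrightarrow> \<bar>coupling \<alpha> x $ (i, undefined)\<bar> \<le> E"
    using C11_on_bounded[OF lin] by metis
  have c: "partition_fun \<alpha> i x \<ge> exp (- E)" if "x \<in> S" for x
  proof -
    have "exp (- E) \<le> exp (coupling \<alpha> x $ (i, undefined))"
      using E[OF that] by (simp add: abs_le_iff)
    also have "\<dots> \<le> partition_fun \<alpha> i x"
      unfolding partition_fun_def by (rule member_le_sum) auto
    finally show ?thesis .
  qed
  have "C11_on S (\<lambda>x. partition_fun \<alpha> i x)
     (\<lambda>x z. \<Sum>u\<in>UNIV. exp (coupling \<alpha> x $ (i, u)) * coupling \<alpha> z $ (i, u))"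
    unfolding partition_fun_def by (intro C11_on_sum C11_on_exp lin) simp
  from C11_on_ln[OF this _ c] show ?thesis
    by (rule C11_on_cong) (auto simp: sum_distrib_left pi_map_nth divide_inverse mult_ac)
qed

lemma C11_pi_map:
  assumes S: "bounded S"
  shows "C11_vec_on S (pi_map \<alpha>) (dpi \<alpha>)"
  unfolding C11_vec_on_def
proof
  fix k :: "'a \<times> 'b"
  obtain i v where k: "k = (i, v)" by fastforce
  have lin: "C11_on S (\<lambda>x. coupling \<alpha> x $ k) (\<lambda>x z. coupling \<alpha> z $ k)" for k
    using C11_coupling[OF S, of \<alpha>] unfolding C11_vec_on_def by blast
  have pi: "pi_map \<alpha> x $ (i, v) = exp (coupling \<alpha> x $ (i, v) - ln (partition_fun \<alpha> i x))" for x
    using partition_fun_pos[of \<alpha> i x] by (simp add: pi_map_nth exp_diff)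
  show "C11_on S (\<lambda>x. pi_map \<alpha> x $ k) (\<lambda>x z. dpi \<alpha> x z $ k)"
    unfolding k dpi_def cov_nth
    by (rule C11_on_cong[OF C11_on_exp[OF C11_on_diff[OF lin[of "(i, v)"] C11_ln_partition[OF S, of \<alpha> i]]]])
      (simp_all add: pi)
qed

definition dF ::
  "('m::finite, 'd::finite) params \<Rightarrow> real ^ ('m \<times> 'd) \<Rightarrow> real ^ ('m \<times> 'd) \<Rightarrow> real ^ ('m \<times> 'd)" where
  "dF \<alpha> x z = dpi \<alpha> x z - z"

lemma linear_dF: "linear (dF \<alpha> x)"
  unfolding dF_def by (intro linear_compose_sub linear_dpi linear_ident)

lemma C11_F_field: "bounded S \<Longrightarrow> C11_vec_on S (F_field \<alpha>) (dF \<alpha>)"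
  using C11_vec_on_diff[OF C11_pi_map C11_vec_on_id, of S \<alpha>]
  by (simp add: F_field_def[abs_def] dF_def[abs_def])

lemma F_field_has_derivative: "(F_field \<alpha> has_derivative dF \<alpha> x) (at x)"
  by (rule C11_vec_on_has_derivative[OF C11_F_field[of "ball x 1"]])
    (auto simp: linear_dF linear_linear)

lemma jacobian_F_field: "jacobian (F_field \<alpha>) (at x) *v z = dF \<alpha> x z"
proof -
  have "frechet_derivative (F_field \<alpha>) (at x) = dF \<alpha> x"
    by (rule frechet_derivative_at[OF F_field_has_derivative, symmetric])
  then show ?thesis by (simp add: jacobian_def matrix_works linear_matrix_vector_mul_eq linear_dF)
qed

text \<open>
  Let \<open>L x = (\<Sum>k. x $ k * ln (x $ k)) - (x \<bullet> coupling \<alpha> x) / 2\<close> be the free energy, which decreases along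
  the flow of \<^const>\<open>F_field\<close> but is singular on the boundary. Its composition with \<^const>\<open>pi_map\<close> is smooth:
  \<open>ln (pi_map \<alpha> x)\<close> is \<open>coupling \<alpha> x\<close> minus the logarithms of the partition functions, so \<open>L (pi_map \<alpha> x)\<close> is the
  part of \<open>lyapunov \<alpha> x\<close> without the last summand. That part is also constant in the directions in which
  \<open>pi_map \<alpha>\<close> is; the summand \<open>|F|\<^sup>2\<close> controls these.
\<close>

definition lyapunov :: "('m::finite, 'd::finite) params \<Rightarrow> real ^ ('m \<times> 'd) \<Rightarrow> real" where
  "lyapunov \<alpha> x = pi_map \<alpha> x \<bullet> coupling \<alpha> x - (1 / 2) * (pi_map \<alpha> x \<bullet> coupling \<alpha> (pi_map \<alpha> x))
     - (\<Sum>i\<in>UNIV. ln (partition_fun \<alpha> i x)) + F_field \<alpha> x \<bullet> F_field \<alpha> x"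

definition dlyapunov :: "('m::finite, 'd::finite) params \<Rightarrow> real ^ ('m \<times> 'd) \<Rightarrow> real ^ ('m \<times> 'd) \<Rightarrow> real" where
  "dlyapunov \<alpha> x z = 2 * (F_field \<alpha> x \<bullet> dF \<alpha> x z) - dpi \<alpha> x z \<bullet> coupling \<alpha> (F_field \<alpha> x)"

lemma linear_dlyapunov: "linear (dlyapunov \<alpha> x)"
  unfolding dlyapunov_def
  by (rule linearI) (simp_all add: linear_add[OF linear_dF] linear_add[OF linear_dpi] linear_scale[OF linear_dF]
      linear_scale[OF linear_dpi] inner_add_left inner_add_right algebra_simps)

lemma C11_lyapunov:
  assumes S: "bounded S" and sym: "\<And>v i j. \<alpha> v i j = \<alpha> v j i"
  shows "C11_on S (lyapunov \<alpha>) (dlyapunov \<alpha>)"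
proof -
  have "C11_on S (lyapunov \<alpha>) (\<lambda>x z. (pi_map \<alpha> x \<bullet> coupling \<alpha> z + coupling \<alpha> x \<bullet> dpi \<alpha> x z)
     - (1 / 2) * (pi_map \<alpha> x \<bullet> coupling \<alpha> (dpi \<alpha> x z) + coupling \<alpha> (pi_map \<alpha> x) \<bullet> dpi \<alpha> x z)
     - (\<Sum>i\<in>UNIV. \<Sum>u\<in>UNIV. pi_map \<alpha> x $ (i, u) * coupling \<alpha> z $ (i, u))
     + (F_field \<alpha> x \<bullet> dF \<alpha> x z + F_field \<alpha> x \<bullet> dF \<alpha> x z))"
    unfolding lyapunov_def[abs_def]
    by (intro C11_on_add C11_on_diff C11_on_cmult C11_on_sum C11_on_inner C11_pi_map C11_coupling
        C11_F_field C11_ln_partition C11_vec_on_linear[OF C11_pi_map linear_coupling] S) simp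
  then show ?thesis
  proof (rule C11_on_cong)
    fix x z
    have 1: "pi_map \<alpha> x \<bullet> coupling \<alpha> (dpi \<alpha> x z) = coupling \<alpha> (pi_map \<alpha> x) \<bullet> dpi \<alpha> x z"
      by (rule coupling_symmetric[OF sym, symmetric])
    have 2: "coupling \<alpha> (F_field \<alpha> x) = coupling \<alpha> (pi_map \<alpha> x) - coupling \<alpha> x"
      by (simp add: F_field_def linear_diff[OF linear_coupling, symmetric])
    have 3: "(\<Sum>i\<in>UNIV. \<Sum>u\<in>UNIV. pi_map \<alpha> x $ (i, u) * coupling \<alpha> z $ (i, u)) = pi_map \<alpha> x \<bullet> coupling \<alpha> z"
      by (simp add: inner_blocks)
    show "dlyapunov \<alpha> x z = (pi_map \<alpha> x \<bullet> coupling \<alpha> z + coupling \<alpha> x \<bullet> dpi \<alpha> x z)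
     - (1 / 2) * (pi_map \<alpha> x \<bullet> coupling \<alpha> (dpi \<alpha> x z) + coupling \<alpha> (pi_map \<alpha> x) \<bullet> dpi \<alpha> x z)
     - (\<Sum>i\<in>UNIV. \<Sum>u\<in>UNIV. pi_map \<alpha> x $ (i, u) * coupling \<alpha> z $ (i, u))
     + (F_field \<alpha> x \<bullet> dF \<alpha> x z + F_field \<alpha> x \<bullet> dF \<alpha> x z)"
      unfolding 1 2 3 dlyapunov_def by (simp add: inner_diff_right inner_commute)
  qed simp
qed

text \<open>
  Put \<open>f = F_field \<alpha> x\<close> and \<open>g = dpi \<alpha> x f\<close>. The two parts of the Lyapunov function contribute \<open>- g \<bullet> coupling \<alpha> f\<close>,
  which is at most \<open>- |g|\<^sup>2\<close>, and \<open>2 * (f \<bullet> g) - 2 * |f|\<^sup>2\<close>; completing the square leaves \<open>- |f|\<^sup>2\<close>.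
\<close>

lemma lyapunov_descent: "dlyapunov \<alpha> x (F_field \<alpha> x) \<le> - (norm (F_field \<alpha> x))\<^sup>2"
proof -
  define f where "f = F_field \<alpha> x"
  define g where "g = dpi \<alpha> x f"
  have "(norm g)\<^sup>2 \<le> g \<bullet> coupling \<alpha> f"
    unfolding g_def dpi_def by (rule cov_norm[OF pi_map_in_simplex])
  moreover have "0 \<le> (g - f) \<bullet> (g - f)" by simp
  moreover have "dlyapunov \<alpha> x f = 2 * (f \<bullet> g) - 2 * (f \<bullet> f) - g \<bullet> coupling \<alpha> f"
    by (simp add: dlyapunov_def dF_def f_def[symmetric] g_def[symmetric] inner_diff_right)
  ultimately show ?thesis
    unfolding f_def[symmetric] power2_norm_eq_inner
    by (simp add: inner_diff_left inner_diff_right inner_commute)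
qed

section \<open>The linearisation at an equilibrium\<close>

lemma eigenvalue_realI:
  fixes A :: "real ^ 'n ^ 'n::finite"
  assumes "A *v w = r *\<^sub>R w" "w \<noteq> 0"
  shows "complex_of_real r \<in> eigenvalues A"
proof -
  define z where "z = (\<chi> k. complex_of_real (w $ k))"
  have "z \<noteq> 0" using assms(2) by (auto simp: z_def vec_eq_iff)
  moreover have "map_matrix complex_of_real A *v z = complex_of_real r *s z"
  proof -
    have "(map_matrix complex_of_real A *v z) $ k = complex_of_real ((A *v w) $ k)" for k
      by (simp add: matrix_vector_mult_def map_matrix_def z_def)
    then show ?thesis by (simp add: vec_eq_iff assms(1) z_def)
  qed
  ultimately show ?thesis unfolding eigenvalues_def by blast
qed

text \<open>
  The real and imaginary parts of a complex eigenvector span a real invariant plane (or line).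
\<close>

lemma eigenvalue_real_parts:
  fixes A :: "real ^ 'n ^ 'n::finite"
  assumes "c \<in> eigenvalues A"
  obtains a b where "a \<noteq> 0 \<or> b \<noteq> 0"
    "A *v a = Re c *\<^sub>R a - Im c *\<^sub>R b" "A *v b = Im c *\<^sub>R a + Re c *\<^sub>R b"
proof -
  obtain z where z: "z \<noteq> 0" "map_matrix complex_of_real A *v z = c *s z"
    using assms unfolding eigenvalues_def by blast
  define a b where "a = (\<chi> k. Re (z $ k))" and "b = (\<chi> k. Im (z $ k))"
  have comp: "(\<Sum>j\<in>UNIV. complex_of_real (A $ k $ j) * z $ j) = c * z $ k" for k
  proof -
    have "(map_matrix complex_of_real A *v z) $ k = (c *s z) $ k" using z(2) by simp
    then show ?thesis by (simp add: matrix_vector_mult_def map_matrix_def)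
  qed
  show ?thesis
  proof (rule that[of a b])
    show "a \<noteq> 0 \<or> b \<noteq> 0" using z(1) by (auto simp: a_def b_def vec_eq_iff complex_eq_iff)
    show "A *v a = Re c *\<^sub>R a - Im c *\<^sub>R b"
      using arg_cong[OF comp, of Re] by (simp add: vec_eq_iff a_def b_def matrix_vector_mult_def)
    show "A *v b = Im c *\<^sub>R a + Re c *\<^sub>R b"
      using arg_cong[OF comp, of Im] by (simp add: vec_eq_iff a_def b_def matrix_vector_mult_def algebra_simps)
  qed
qed

definition recip_mult :: "real ^ 'n::finite \<Rightarrow> real ^ 'n \<Rightarrow> real ^ 'n" where
  "recip_mult p z = (\<chi> k. z $ k / p $ k)"

text \<open>
  The Hessian of the free energy at an interior point \<open>p\<close>: \<open>recip_mult p\<close> comes from the entropy and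
  \<^const>\<open>coupling\<close> from the interaction.
\<close>

definition hess ::
  "('m::finite, 'd::finite) params \<Rightarrow> real ^ ('m \<times> 'd) \<Rightarrow> real ^ ('m \<times> 'd) \<Rightarrow> real ^ ('m \<times> 'd)" where
  "hess \<alpha> p z = recip_mult p z - coupling \<alpha> z"

lemma linear_recip_mult: "linear (recip_mult p)"
  by (rule linearI) (auto simp: vec_eq_iff recip_mult_def add_divide_distrib)

lemma linear_hess: "linear (hess \<alpha> p)"
  unfolding hess_def by (intro linear_compose_sub linear_recip_mult linear_coupling)

lemma recip_mult_symmetric: "recip_mult p y \<bullet> z = y \<bullet> recip_mult p z"
  by (simp add: inner_vec_def recip_mult_def)

lemma hess_symmetric:
  assumes "\<And>v i j. \<alpha> v i j = \<alpha> v j i"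
  shows "hess \<alpha> p y \<bullet> z = y \<bullet> hess \<alpha> p z"
  by (simp add: hess_def inner_diff_left inner_diff_right recip_mult_symmetric coupling_symmetric[OF assms])

text \<open>
  To first order at an equilibrium, the flow is the gradient flow of the free energy for the metric that is
  inverse to the covariance matrix. The Jacobian on the tangent space is thus a product of a semidefinite and
  a symmetric matrix, and it shares many properties of symmetric matrices.
\<close>

lemma dF_eq_cov_hess:
  assumes "p \<in> equilibria \<alpha>" "z \<in> tangent"
  shows "dF \<alpha> p z = - cov p (hess \<alpha> p z)"
proof -
  have "cov p (recip_mult p z) = z"
    unfolding recip_mult_def by (rule cov_recip) (use equilibriumD[OF assms(1)] assms(2) in auto)
  then show ?thesis
    using equilibriumD(2)[OF assms(1)]
    by (simp add: dF_def dpi_def hess_def linear_diff[OF linear_cov])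
qed

lemma hess_dissipation:
  assumes "p \<in> equilibria \<alpha>" "z \<in> tangent"
  shows "hess \<alpha> p z \<bullet> dF \<alpha> p z \<le> - (norm (dF \<alpha> p z))\<^sup>2"
  using cov_norm[OF equilibriumD(1)[OF assms(1)], of "hess \<alpha> p z"] dF_eq_cov_hess[OF assms]
  by (simp add: inner_commute)

lemma hyperbolic_bounded_below:
  assumes "hyperbolic_equilibrium \<alpha> p"
  obtains c where "c > 0" "\<And>z. c * norm z \<le> norm (dF \<alpha> p z)"
proof -
  have "inj (dF \<alpha> p)"
    unfolding linear_injective_0[OF linear_dF]
  proof (intro allI impI, rule ccontr)
    fix z assume z: "dF \<alpha> p z = 0" "z \<noteq> 0"
    then have "complex_of_real 0 \<in> eigenvalues (jacobian (F_field \<alpha>) (at p))"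
      by (intro eigenvalue_realI[of _ z]) (simp_all add: jacobian_F_field)
    then show False using assms unfolding hyperbolic_equilibrium_def by fastforce
  qed
  then show ?thesis using linear_inj_bounded_below_pos[OF linear_dF] that by metis
qed

text \<open>
  The Cauchy--Schwarz inequality for semidefinite forms: a vector that annihilates the quadratic form
  annihilates the bilinear form.
\<close>

lemma psd_kernel:
  fixes R :: "'a::real_vector \<Rightarrow> 'a \<Rightarrow> real"
  assumes lin: "\<And>y. linear (R y)" and sym: "\<And>y z. R y z = R z y"
    and sub: "subspace T" and nonneg: "\<And>z. z \<in> T \<Longrightarrow> R z z \<ge> 0"
    and w: "w \<in> T" "R w w = 0" and z: "z \<in> T"
  shows "R w z = 0"
proof -
  define a b where "a = R w z" and "b = R z z"
  have b: "b \<ge> 0" using nonneg[OF z] by (simp add: b_def)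
  (* the quadratic polynomial in t is negative here unless a = 0; the 1 covers b = 0 *)
  define t where "t = - a / (b + 1)"
  have "w + t *\<^sub>R z \<in> T" using sub w z by (simp add: subspace_add subspace_scale)
  then have "0 \<le> R (w + t *\<^sub>R z) (w + t *\<^sub>R z)" by (rule nonneg)
  also have "\<dots> = R w w + 2 * t * a + t\<^sup>2 * b"
    using sym[of "w + t *\<^sub>R z"]
    by (simp add: linear_add[OF lin] linear_scale[OF lin] a_def b_def sym[of z w] power2_eq_square algebra_simps)
  also have "\<dots> = - (t\<^sup>2 * (b + 2))"
  proof -
    have a: "a = - (t * (b + 1))" using b by (simp add: t_def)
    show ?thesis unfolding w(2) a by (simp add: algebra_simps power2_eq_square)
  qed
  finally have "t\<^sup>2 \<le> 0" using b by (simp add: mult_le_0_iff)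
  then show ?thesis using b by (simp add: t_def a_def)
qed

text \<open>
  Minimise the Rayleigh quotient of the Hessian with respect to \<open>recip_mult p\<close>, the form that the covariance
  matrix inverts. With minimum \<open>\<mu>\<close> the form \<open>hess \<alpha> p - \<mu> * recip_mult p\<close> is semidefinite on the tangent space
  and vanishes at the minimiser, so the minimiser is an eigenvector of the Jacobian for the eigenvalue \<open>- \<mu>\<close>.
  Stability says that \<open>- \<mu>\<close> is negative.
\<close>

lemma stable_hess_positive:
  fixes \<alpha> :: "('m::finite, 'd::finite) params"
  assumes sym: "\<And>v i j. \<alpha> v i j = \<alpha> v j i" and st: "linearly_stable \<alpha> p"
  obtains \<kappa> where "\<kappa> > 0" "\<And>z. z \<in> tangent \<Longrightarrow> \<kappa> * (norm z)\<^sup>2 \<le> hess \<alpha> p z \<bullet> z"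
proof -
  have peq: "p \<in> equilibria \<alpha>" using st unfolding linearly_stable_def hyperbolic_equilibrium_def by blast
  note p = equilibriumD[OF peq]
  let ?D = "recip_mult p"
  have D_ge: "(norm z)\<^sup>2 \<le> ?D z \<bullet> z" for z
  proof -
    have "z $ k * z $ k \<le> z $ k / p $ k * z $ k" for k
    proof -
      have "(z $ k * z $ k) * p $ k \<le> (z $ k * z $ k) * 1"
        using simplex_le_1[OF p(1)] by (intro mult_left_mono) auto
      then show ?thesis using p(3)[of k] by (simp add: field_simps)
    qed
    then show ?thesis unfolding power2_norm_eq_inner inner_vec_def
      by (simp add: recip_mult_def sum_mono)
  qed
  have D_pos: "?D z \<bullet> z > 0" if "z \<noteq> 0" for z
    using D_ge[of z] that by (meson less_le_trans zero_less_norm_iff zero_less_power)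
  define K where "K = sphere 0 1 \<inter> (tangent :: (real ^ ('m \<times> 'd)) set)"
  have normalized: "z /\<^sub>R norm z \<in> K" if "z \<in> tangent" "z \<noteq> 0" for z
    using that subspace_scale[OF subspace_tangent] by (auto simp: K_def)
  show ?thesis
  proof (cases "K = {}")
    case True
    then have zero: "z = 0" if T: "z \<in> tangent" for z :: "real ^ ('m \<times> 'd)" using normalized[of z] T by blast
    show ?thesis
    proof (rule that[of 1])
      show "1 * (norm z)\<^sup>2 \<le> hess \<alpha> p z \<bullet> z" if "z \<in> tangent" for z
        using zero[OF that] by simp
    qed simp
  next
    case False
    have cK: "compact K" unfolding K_def
      by (intro compact_Int_closed compact_sphere closed_subspace subspace_tangent)
    have cont: "continuous_on K (\<lambda>z. (hess \<alpha> p z \<bullet> z) / (?D z \<bullet> z))"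
    proof (intro continuous_intros linear_continuous_on linear_hess linear_recip_mult ballI)
      show "?D z \<bullet> z \<noteq> 0" if "z \<in> K" for z
      proof -
        have "z \<noteq> 0" using that by (auto simp: K_def)
        then show ?thesis using D_pos[of z] by simp
      qed
    qed (simp_all add: linear_conv_bounded_linear[symmetric] linear_hess linear_recip_mult)
    obtain w where w: "w \<in> K"
      "\<And>z. z \<in> K \<Longrightarrow> (hess \<alpha> p w \<bullet> w) / (?D w \<bullet> w) \<le> (hess \<alpha> p z \<bullet> z) / (?D z \<bullet> z)"
      using continuous_attains_inf[OF cK False cont] by blast
    define \<mu> where "\<mu> = (hess \<alpha> p w \<bullet> w) / (?D w \<bullet> w)"
    have wT: "w \<in> tangent" "w \<noteq> 0" using w(1) by (auto simp: K_def)
    define R where "R = (\<lambda>y z. hess \<alpha> p y \<bullet> z - \<mu> * (?D y \<bullet> z))"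
    have R_nonneg: "R z z \<ge> 0" if zT: "z \<in> tangent" for z
    proof (cases "z = 0")
      case False
      have "\<mu> \<le> (hess \<alpha> p (z /\<^sub>R norm z) \<bullet> (z /\<^sub>R norm z)) / (?D (z /\<^sub>R norm z) \<bullet> (z /\<^sub>R norm z))"
        unfolding \<mu>_def by (rule w(2)[OF normalized[OF zT False]])
      also have "\<dots> = (hess \<alpha> p z \<bullet> z) / (?D z \<bullet> z)"
        using False by (simp add: linear_scale[OF linear_hess] linear_scale[OF linear_recip_mult])
      finally show ?thesis using D_pos[OF False] by (simp add: R_def field_simps)
    qed (simp add: R_def)
    define u where "u = hess \<alpha> p w - \<mu> *\<^sub>R ?D w"
    have Ru: "R w z = u \<bullet> z" for z by (simp add: R_def u_def inner_diff_left)
    have "R w (cov p u) = 0"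
    proof (rule psd_kernel[of R tangent])
      show "linear (R y)" for y
        by (rule linearI) (simp_all add: R_def algebra_simps)
      show "R y z = R z y" for y z
        using hess_symmetric[OF sym, where p = p and y = y and z = z] recip_mult_symmetric[of p y z]
        by (simp add: R_def inner_commute)
      show "R w w = 0" using D_pos[OF wT(2)] by (simp add: R_def \<mu>_def)
    qed (use subspace_tangent R_nonneg wT cov_tangent[OF p(1)] in auto)
    then have "(norm (cov p u))\<^sup>2 \<le> 0"
      using cov_norm[OF p(1), of u] by (simp add: Ru inner_commute)
    then have "cov p u = 0" by simp
    moreover have "cov p (?D w) = w"
      unfolding recip_mult_def by (rule cov_recip[OF p(3) wT(1)])
    ultimately have "cov p (hess \<alpha> p w) = \<mu> *\<^sub>R w"
      by (simp add: u_def linear_diff[OF linear_cov] linear_scale[OF linear_cov])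
    then have "jacobian (F_field \<alpha>) (at p) *v w = (- \<mu>) *\<^sub>R w"
      by (simp add: jacobian_F_field dF_eq_cov_hess[OF peq wT(1)])
    then have "complex_of_real (- \<mu>) \<in> eigenvalues (jacobian (F_field \<alpha>) (at p))"
      by (rule eigenvalue_realI) (rule wT)
    then have mu: "\<mu> > 0" using st unfolding linearly_stable_def by fastforce
    show ?thesis
    proof (rule that[OF mu])
      fix z :: "real ^ ('m \<times> 'd)" assume "z \<in> tangent"
      then have "\<mu> * (?D z \<bullet> z) \<le> hess \<alpha> p z \<bullet> z" using R_nonneg by (simp add: R_def)
      then show "\<mu> * (norm z)\<^sup>2 \<le> hess \<alpha> p z \<bullet> z"
        using mult_left_mono[OF D_ge[of z], of \<mu>] mu by linarith
    qed
  qed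
qed

text \<open>
  Let \<open>a + i b\<close> be an eigenvector for an eigenvalue \<open>c\<close> with positive real part. The block sums of a vector are
  multiplied by \<open>- 1\<close> under the Jacobian, so \<open>a\<close> and \<open>b\<close> are tangent. Let \<open>q\<close> be the Hermitian form of the
  Hessian at \<open>a + i b\<close>. Then \<open>c * q\<close> is minus a value of the semidefinite form of the covariance matrix; it is
  real and negative. Hence \<open>q\<close> is not zero and \<open>c\<close> is real, so that \<open>a\<close> and \<open>b\<close> are themselves eigenvectors or zero.
\<close>

lemma unstable_real_eigenvector:
  assumes sym: "\<And>v i j. \<alpha> v i j = \<alpha> v j i" and unst: "linearly_unstable \<alpha> p"
  obtains w \<rho> where "w \<in> tangent" "w \<noteq> 0" "\<rho> > 0" "dF \<alpha> p w = \<rho> *\<^sub>R w"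
proof -
  have hyp: "hyperbolic_equilibrium \<alpha> p" using unst unfolding linearly_unstable_def by blast
  then have peq: "p \<in> equilibria \<alpha>" unfolding hyperbolic_equilibrium_def by blast
  note p = equilibriumD[OF peq]
  obtain c where c: "c \<in> eigenvalues (jacobian (F_field \<alpha>) (at p))" "Re c > 0"
    using unst hyp unfolding linearly_unstable_def linearly_stable_def hyperbolic_equilibrium_def
    by (meson linorder_cases)
  obtain a b where ab: "a \<noteq> 0 \<or> b \<noteq> 0"
    "dF \<alpha> p a = Re c *\<^sub>R a - Im c *\<^sub>R b" "dF \<alpha> p b = Im c *\<^sub>R a + Re c *\<^sub>R b"
    using eigenvalue_real_parts[OF c(1)] unfolding jacobian_F_field by metis
  have lin: "block_sum (x + y) i = block_sum x i + block_sum y i" "block_sum (x - y) i = block_sum x i - block_sum y i"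
    "block_sum (r *\<^sub>R x) i = r * block_sum x i" for x y i r
    by (simp_all add: block_sum_def sum.distrib sum_subtractf sum_distrib_left)
  have dF_sum: "block_sum (dF \<alpha> p z) i = - block_sum z i" for z i
  proof -
    have "dpi \<alpha> p z \<in> tangent" unfolding dpi_def by (rule cov_tangent[OF pi_map_in_simplex])
    then show ?thesis by (simp add: dF_def lin tangent_def)
  qed
  have T: "a \<in> tangent" "b \<in> tangent"
  proof -
    have "block_sum a i = 0 \<and> block_sum b i = 0" for i
    proof -
      define s t where "s = block_sum a i" and "t = block_sum b i"
      have 1: "(1 + Re c) * s = Im c * t" "(1 + Re c) * t = - (Im c * s)"
        using dF_sum[of a i] dF_sum[of b i] unfolding ab lin by (simp_all add: s_def t_def algebra_simps)
      have "(1 + Re c) * (s\<^sup>2 + t\<^sup>2) = ((1 + Re c) * s) * s + ((1 + Re c) * t) * t"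
        by (simp add: algebra_simps power2_eq_square)
      also have "\<dots> = 0" unfolding 1 by simp
      finally have "s\<^sup>2 + t\<^sup>2 = 0" using c(2) by simp
      then show ?thesis by (simp add: s_def t_def sum_power2_eq_zero_iff)
    qed
    then show "a \<in> tangent" "b \<in> tangent" by (auto simp: tangent_def)
  qed
  define q where "q = hess \<alpha> p a \<bullet> a + hess \<alpha> p b \<bullet> b"
  have hs: "hess \<alpha> p y \<bullet> z = hess \<alpha> p z \<bullet> y" for y z
    using hess_symmetric[OF sym, where p = p and y = y and z = z] by (simp add: inner_commute)
  have "hess \<alpha> p a \<bullet> dF \<alpha> p b = hess \<alpha> p b \<bullet> dF \<alpha> p a"
    unfolding dF_eq_cov_hess[OF peq T(1)] dF_eq_cov_hess[OF peq T(2)]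
    using cov_symmetric[of p "hess \<alpha> p a" "hess \<alpha> p b"] by (simp add: inner_commute)
  then have im: "Im c * q = 0"
    unfolding ab q_def by (simp add: inner_add_right inner_diff_right hs[of a b] algebra_simps)
  have "Re c * q = hess \<alpha> p a \<bullet> dF \<alpha> p a + hess \<alpha> p b \<bullet> dF \<alpha> p b"
    unfolding ab q_def by (simp add: inner_add_right inner_diff_right hs[of a b] algebra_simps)
  also have "\<dots> \<le> - (norm (dF \<alpha> p a))\<^sup>2 - (norm (dF \<alpha> p b))\<^sup>2"
    using hess_dissipation[OF peq T(1)] hess_dissipation[OF peq T(2)] by linarith
  also have "\<dots> < 0"
  proof -
    obtain k where k: "k > 0" "\<And>z. k * norm z \<le> norm (dF \<alpha> p z)"
      using hyperbolic_bounded_below[OF hyp] by blast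
    have nz: "(norm (dF \<alpha> p z))\<^sup>2 > 0" if "z \<noteq> 0" for z
      using k(2)[of z] k(1) that by (smt (verit) mult_pos_pos zero_less_norm_iff zero_less_power)
    show ?thesis
      using ab(1) nz[of a] nz[of b] zero_le_power2[of "norm (dF \<alpha> p a)"] zero_le_power2[of "norm (dF \<alpha> p b)"]
      by linarith
  qed
  finally have "q \<noteq> 0" by auto
  then have "Im c = 0" using im by simp
  then have "dF \<alpha> p a = Re c *\<^sub>R a" "dF \<alpha> p b = Re c *\<^sub>R b" using ab by simp_all
  then show ?thesis using ab(1) T c(2) that by blast
qed

section \<open>One step of the process\<close>

definition walk_prob ::
  "('m::finite, 'd::finite) params \<Rightarrow> real ^ ('m \<times> 'd) \<Rightarrow> ('m \<Rightarrow> 'd) \<Rightarrow> real" where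
  "walk_prob \<alpha> x w = (\<Prod>i\<in>UNIV. pi_map \<alpha> x $ (i, w i))"

definition vertex :: "('m::finite \<Rightarrow> 'd::finite) \<Rightarrow> real ^ ('m \<times> 'd)" where
  "vertex w = (\<chi> k. of_bool (w (fst k) = snd k))"

text \<open>
  The step size at time \<open>n\<close>. The type argument stands for the vertex set, whose number of elements enters.
\<close>

definition gain :: "'d::finite itself \<Rightarrow> nat \<Rightarrow> real" where
  "gain _ n = 1 / (real CARD('d) + real n + 1)"

definition occupation_step ::
  "nat \<Rightarrow> real ^ ('m::finite \<times> 'd::finite) \<Rightarrow> ('m \<Rightarrow> 'd) \<Rightarrow> real ^ ('m \<times> 'd)" where
  "occupation_step n x w = x + gain TYPE('d) n *\<^sub>R (vertex w - x)"

lemma gain_pos: "gain TYPE('d::finite) n > 0"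
  by (simp add: gain_def add_nonneg_pos)

lemma gain_le_1: "gain TYPE('d::finite) n \<le> 1"
  by (simp add: gain_def)

lemma vertex_in_simplex: "vertex w \<in> simplex_product"
  by (auto simp: simplex_product_def vertex_def of_bool_def sum.delta)

lemma convex_simplex: "convex simplex_product"
  by (auto simp: convex_def simplex_product_def sum.distrib sum_distrib_left[symmetric])

lemma occupation_step_in_simplex:
  fixes x :: "real ^ ('m::finite \<times> 'd::finite)"
  assumes "x \<in> simplex_product"
  shows "occupation_step n x w \<in> simplex_product"
proof -
  have "occupation_step n x w = (1 - gain TYPE('d) n) *\<^sub>R x + gain TYPE('d) n *\<^sub>R vertex w"
    by (simp add: occupation_step_def algebra_simps)
  then show ?thesis
    using convexD[OF convex_simplex assms vertex_in_simplex[of w], of "1 - gain TYPE('d) n" "gain TYPE('d) n"]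
      gain_pos[of n, where 'd = 'd] gain_le_1[of n, where 'd = 'd] by simp
qed

lemma walk_prob_pos: "walk_prob \<alpha> x w > 0"
  unfolding walk_prob_def by (intro prod_pos ballI pi_map_pos)

lemma sum_prod_functions:
  fixes f :: "'m::finite \<Rightarrow> 'd::finite \<Rightarrow> real"
  shows "(\<Sum>w\<in>UNIV. \<Prod>i\<in>UNIV. f i (w i)) = (\<Prod>i\<in>UNIV. \<Sum>v\<in>UNIV. f i v)"
  using prod_sum_PiE[of "UNIV :: 'm set" "\<lambda>_. UNIV :: 'd set" f] by (simp add: PiE_UNIV_domain)

lemma walk_prob_sum: "(\<Sum>w\<in>UNIV. walk_prob \<alpha> x w) = 1"
  unfolding walk_prob_def by (simp add: sum_prod_functions[where f = "\<lambda>i v. pi_map \<alpha> x $ (i, v)"] pi_map_block_sum)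

lemma walk_prob_mean: "(\<Sum>w\<in>UNIV. walk_prob \<alpha> x w *\<^sub>R vertex w) = pi_map \<alpha> x"
proof -
  have "(\<Sum>w\<in>UNIV. walk_prob \<alpha> x w * of_bool (w j = v)) = pi_map \<alpha> x $ (j, v)" for j v
  proof -
    define f where "f = (\<lambda>i u. pi_map \<alpha> x $ (i, u) * (if i = j then of_bool (u = v) else 1))"
    have "walk_prob \<alpha> x w * of_bool (w j = v) = (\<Prod>i\<in>UNIV. f i (w i))" for w
      by (simp add: walk_prob_def f_def prod.distrib prod.delta)
    then have "(\<Sum>w\<in>UNIV. walk_prob \<alpha> x w * of_bool (w j = v)) = (\<Prod>i\<in>UNIV. \<Sum>u\<in>UNIV. f i u)"
      by (simp add: sum_prod_functions)
    also have "\<dots> = (\<Prod>i\<in>UNIV. if i = j then pi_map \<alpha> x $ (j, v) else 1)"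
    proof (intro prod.cong refl)
      fix i
      have "(\<Sum>u\<in>UNIV. pi_map \<alpha> x $ (j, u) * of_bool (u = v)) = (\<Sum>u\<in>UNIV. if u = v then pi_map \<alpha> x $ (j, u) else 0)"
        by (intro sum.cong) auto
      then show "(\<Sum>u\<in>UNIV. f i u) = (if i = j then pi_map \<alpha> x $ (j, v) else 1)"
        by (auto simp: f_def pi_map_block_sum sum.delta)
    qed
    finally show ?thesis by (simp add: prod.delta)
  qed
  then show ?thesis by (auto simp: vec_eq_iff vertex_def)
qed

text \<open>
  The mean of one increment is \<^const>\<open>F_field\<close> up to the step size.
\<close>

lemma walk_prob_drift:
  assumes "linear (L :: _ \<Rightarrow> real)"
  shows "(\<Sum>w\<in>UNIV. walk_prob \<alpha> x w * L (vertex w - x)) = L (F_field \<alpha> x)"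
proof -
  have "(\<Sum>w\<in>UNIV. walk_prob \<alpha> x w * L (vertex w - x))
      = L (\<Sum>w\<in>UNIV. walk_prob \<alpha> x w *\<^sub>R (vertex w - x))"
    by (simp add: linear_sum[OF assms] linear_scale[OF assms])
  also have "(\<Sum>w\<in>UNIV. walk_prob \<alpha> x w *\<^sub>R (vertex w - x)) = F_field \<alpha> x"
    by (simp add: scaleR_diff_right sum_subtractf walk_prob_mean scaleR_sum_left[symmetric] walk_prob_sum F_field_def)
  finally show ?thesis .
qed

lemma continuous_pi_map: "isCont (pi_map \<alpha>) x"
proof -
  have "isCont (\<lambda>x. F_field \<alpha> x + x) x"
    using has_derivative_continuous[OF F_field_has_derivative] by (intro continuous_intros) auto
  then show ?thesis by (simp add: F_field_def)
qed

lemma continuous_F_field: "continuous_on S (F_field \<alpha>)"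
  by (intro continuous_at_imp_continuous_on ballI has_derivative_continuous[OF F_field_has_derivative])

lemma tendsto_walk_prob:
  assumes "(f \<longlongrightarrow> x) G" shows "((\<lambda>u. walk_prob \<alpha> (f u) w) \<longlongrightarrow> walk_prob \<alpha> x w) G"
  unfolding walk_prob_def
  by (intro tendsto_prod tendsto_vec_nth isCont_tendsto_compose[OF continuous_pi_map assms])

text \<open>
  One step of the process is a step of an Euler scheme for \<^const>\<open>F_field\<close> plus noise of mean zero; the noise
  changes the mean of a function with quadratic remainder only at second order in the step size.
\<close>

lemma quadratic_drift:
  fixes \<alpha> :: "('m::finite, 'd::finite) params"
  assumes x: "x \<in> simplex_product" and L: "linear L" and K: "K \<ge> 0"
    and taylor: "\<And>y. y \<in> simplex_product \<Longrightarrow> g y \<le> g x + L (y - x) + K * (norm (y - x))\<^sup>2"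
  shows "(\<Sum>w\<in>UNIV. walk_prob \<alpha> x w * g (occupation_step n x w))
    \<le> g x + gain TYPE('d) n * L (F_field \<alpha> x) + K * (2 * real CARD('m))\<^sup>2 * (gain TYPE('d) n)\<^sup>2"
proof -
  define \<gamma> C where "\<gamma> = gain TYPE('d) n" and "C = K * (2 * real CARD('m))\<^sup>2"
  have each: "g (occupation_step n x w) \<le> g x + \<gamma> * L (vertex w - x) + C * \<gamma>\<^sup>2" for w
  proof -
    have "(norm (vertex w - x))\<^sup>2 \<le> (2 * real CARD('m))\<^sup>2"
      by (intro power_mono simplex_diff_norm vertex_in_simplex x) simp
    then have "K * (\<gamma>\<^sup>2 * (norm (vertex w - x))\<^sup>2) \<le> K * (\<gamma>\<^sup>2 * (2 * real CARD('m))\<^sup>2)"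
      using K by (intro mult_left_mono) auto
    then show ?thesis
      using taylor[OF occupation_step_in_simplex[OF x, of n w]]
      unfolding occupation_step_def \<gamma>_def[symmetric] add_diff_cancel_left' C_def
      by (simp add: linear_scale[OF L] power_mult_distrib mult_ac)
  qed
  have "(\<Sum>w\<in>UNIV. walk_prob \<alpha> x w * g (occupation_step n x w))
    \<le> (\<Sum>w\<in>UNIV. walk_prob \<alpha> x w * (g x + \<gamma> * L (vertex w - x) + C * \<gamma>\<^sup>2))"
    by (intro sum_mono mult_left_mono each less_imp_le[OF walk_prob_pos])
  also have "\<dots> = (\<Sum>w\<in>UNIV. walk_prob \<alpha> x w) * (g x + C * \<gamma>\<^sup>2)
      + \<gamma> * (\<Sum>w\<in>UNIV. walk_prob \<alpha> x w * L (vertex w - x))"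
    by (simp add: distrib_left sum.distrib sum_distrib_left sum_distrib_right mult_ac)
  also have "\<dots> = g x + \<gamma> * L (F_field \<alpha> x) + C * \<gamma>\<^sup>2"
    by (simp add: walk_prob_sum walk_prob_drift[OF L])
  finally show ?thesis by (simp add: \<gamma>_def C_def)
qed

lemma lyapunov_drift:
  fixes \<alpha> :: "('m::finite, 'd::finite) params"
  assumes sym: "\<And>v i j. \<alpha> v i j = \<alpha> v j i"
  obtains C where "C \<ge> 0" "\<And>n x. x \<in> simplex_product \<Longrightarrow>
     (\<Sum>w\<in>UNIV. walk_prob \<alpha> x w * lyapunov \<alpha> (occupation_step n x w))
       \<le> lyapunov \<alpha> x - gain TYPE('d) n * (norm (F_field \<alpha> x))\<^sup>2 + C * (gain TYPE('d) n)\<^sup>2"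
proof -
  have "C11_on simplex_product (lyapunov \<alpha>) (dlyapunov \<alpha>)"
    by (intro C11_lyapunov compact_imp_bounded compact_simplex sym)
  then obtain K where K: "K \<ge> 0" "\<And>x y. x \<in> simplex_product \<Longrightarrow> y \<in> simplex_product \<Longrightarrow>
      \<bar>lyapunov \<alpha> y - lyapunov \<alpha> x - dlyapunov \<alpha> x (y - x)\<bar> \<le> K * (norm (y - x))\<^sup>2"
    unfolding C11_on_def by blast
  show ?thesis
  proof (rule that[of "K * (2 * real CARD('m))\<^sup>2"])
    fix n and x :: "real ^ ('m \<times> 'd)" assume x: "x \<in> simplex_product"
    have "(\<Sum>w\<in>UNIV. walk_prob \<alpha> x w * lyapunov \<alpha> (occupation_step n x w))
       \<le> lyapunov \<alpha> x + gain TYPE('d) n * dlyapunov \<alpha> x (F_field \<alpha> x) + K * (2 * real CARD('m))\<^sup>2 * (gain TYPE('d) n)\<^sup>2"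
    proof (rule quadratic_drift[OF x linear_dlyapunov K(1)])
      show "lyapunov \<alpha> y \<le> lyapunov \<alpha> x + dlyapunov \<alpha> x (y - x) + K * (norm (y - x))\<^sup>2"
        if "y \<in> simplex_product" for y using K(2)[OF x that] by linarith
    qed
    moreover have "gain TYPE('d) n * dlyapunov \<alpha> x (F_field \<alpha> x) \<le> gain TYPE('d) n * (- (norm (F_field \<alpha> x))\<^sup>2)"
      by (intro mult_left_mono lyapunov_descent less_imp_le[OF gain_pos])
    ultimately show "(\<Sum>w\<in>UNIV. walk_prob \<alpha> x w * lyapunov \<alpha> (occupation_step n x w))
       \<le> lyapunov \<alpha> x - gain TYPE('d) n * (norm (F_field \<alpha> x))\<^sup>2 + K * (2 * real CARD('m))\<^sup>2 * (gain TYPE('d) n)\<^sup>2"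
      by simp
  qed (use K in simp)
qed

section \<open>The field near a hyperbolic equilibrium\<close>

text \<open>
  A strict inequality for the linearisation at \<open>p\<close> holds for the differences of the field at any two
  points near \<open>p\<close>, because the derivative is Lipschitz. The estimate for two points, and not only for a point and
  \<open>p\<close>, is what the comparison of two copies of the process needs.
\<close>

lemma local_monotonicity:
  fixes h :: "real ^ ('m::finite \<times> 'd::finite) \<Rightarrow> real ^ ('m \<times> 'd) \<Rightarrow> real"
  assumes h: "bounded_bilinear h" and c: "c > 0"
    and lin: "\<And>z. z \<in> tangent \<Longrightarrow> c * (norm z)\<^sup>2 \<le> h z (dF \<alpha> p z)"
  obtains r where "r > 0" "\<And>x y. x \<in> simplex_product \<Longrightarrow> y \<in> simplex_product \<Longrightarrow> dist x p < r \<Longrightarrow> dist y p < r \<Longrightarrow>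
     c / 2 * (norm (x - y))\<^sup>2 \<le> h (x - y) (F_field \<alpha> x - F_field \<alpha> y)"
proof -
  obtain K where K: "K > 0" "\<And>a b. norm (h a b) \<le> norm a * norm b * K"
    using bounded_bilinear.pos_bounded[OF h] by blast
  obtain C where C: "C \<ge> 0"
    "\<And>x y. x \<in> ball p 1 \<Longrightarrow> y \<in> ball p 1 \<Longrightarrow> norm (F_field \<alpha> y - F_field \<alpha> x - dF \<alpha> x (y - x)) \<le> C * (norm (y - x))\<^sup>2"
    "\<And>x y z. x \<in> ball p 1 \<Longrightarrow> y \<in> ball p 1 \<Longrightarrow> norm (dF \<alpha> y z - dF \<alpha> x z) \<le> C * norm (y - x) * norm z"
    using C11_vec_on_norm_bounds[OF C11_F_field[OF bounded_ball]] by metis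
  (* the nonlinear error is at most 3 * C * r * |z|, which h turns into half of c * |z|^2 *)
  define r where "r = min 1 (c / (6 * (C + 1) * K))"
  have r: "r > 0" "r \<le> 1" "6 * (C + 1) * K * r \<le> c"
  proof -
    have "6 * (C + 1) * K > 0" using K C by simp
    moreover have "r \<le> c / (6 * (C + 1) * K)" by (simp add: r_def)
    ultimately show "6 * (C + 1) * K * r \<le> c" by (simp add: field_simps)
    show "r > 0" "r \<le> 1" using c K C by (auto simp: r_def)
  qed
  show ?thesis
  proof (rule that[OF r(1)])
    fix x y :: "real ^ ('m \<times> 'd)" assume xy: "x \<in> simplex_product" "y \<in> simplex_product" "dist x p < r" "dist y p < r"
    then have b: "x \<in> ball p 1" "y \<in> ball p 1" "p \<in> ball p 1" using r(2) by (auto simp: dist_commute)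
    define z where "z = x - y"
    define e where "e = F_field \<alpha> x - F_field \<alpha> y - dF \<alpha> p z"
    have nz: "norm z \<le> 2 * r"
      using xy(3,4) norm_triangle_ineq4[of "x - p" "y - p"] by (simp add: z_def dist_norm)
    have "e = (F_field \<alpha> x - F_field \<alpha> y - dF \<alpha> y z) + (dF \<alpha> y z - dF \<alpha> p z)"
      by (simp add: e_def)
    then have "norm e \<le> norm (F_field \<alpha> x - F_field \<alpha> y - dF \<alpha> y z) + norm (dF \<alpha> y z - dF \<alpha> p z)"
      by (metis norm_triangle_ineq)
    also have "\<dots> \<le> C * (norm z)\<^sup>2 + C * norm (y - p) * norm z"
      using C(2)[OF b(2,1)] C(3)[OF b(3,2)] by (intro add_mono) (auto simp: z_def)
    also have "\<dots> \<le> C * (2 * r * norm z) + C * r * norm z"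
    proof (intro add_mono mult_left_mono mult_right_mono C)
      show "(norm z)\<^sup>2 \<le> 2 * r * norm z" using mult_right_mono[OF nz, of "norm z"] by (simp add: power2_eq_square)
      show "norm (y - p) \<le> r" using xy(4) by (simp add: dist_norm)
    qed simp
    finally have e: "norm e \<le> 3 * C * r * norm z" by (simp add: algebra_simps)
    have "\<bar>h z e\<bar> \<le> norm z * norm e * K" using K(2)[of z e] by simp
    also have "\<dots> \<le> norm z * (3 * C * r * norm z) * K"
      using e K(1) by (intro mult_right_mono mult_left_mono) auto
    also have "\<dots> = (6 * C * K * r) / 2 * (norm z)\<^sup>2" by (simp add: power2_eq_square)
    also have "\<dots> \<le> c / 2 * (norm z)\<^sup>2"
    proof (intro mult_right_mono divide_right_mono)
      have "0 \<le> 6 * K * r" using K r by simp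
      then show "6 * C * K * r \<le> c" using r(3) by (simp add: algebra_simps)
    qed auto
    finally have "- (c / 2 * (norm z)\<^sup>2) \<le> h z e" by linarith
    moreover have "c * (norm z)\<^sup>2 \<le> h z (dF \<alpha> p z)"
      using lin[OF simplex_diff_tangent[OF xy(1,2)]] by (simp add: z_def)
    moreover have "h z (F_field \<alpha> x - F_field \<alpha> y) = h z (dF \<alpha> p z) + h z e"
      by (simp add: e_def bounded_bilinear.add_right[OF h, symmetric])
    ultimately show "c / 2 * (norm (x - y))\<^sup>2 \<le> h (x - y) (F_field \<alpha> x - F_field \<alpha> y)"
      by (simp add: z_def)
  qed
qed

lemma bounded_bilinear_hess: "bounded_bilinear (\<lambda>y z. hess \<alpha> p y \<bullet> z)"
  using bounded_bilinear.comp1[OF bounded_bilinear_inner, of "hess \<alpha> p"] linear_hess[of \<alpha> p]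
  by (simp add: linear_conv_bounded_linear)

lemma bounded_bilinear_minus_hess: "bounded_bilinear (\<lambda>y z. - (hess \<alpha> p y \<bullet> z))"
  using bounded_bilinear.comp1[OF bounded_bilinear_inner, of "\<lambda>y. - hess \<alpha> p y"]
    linear_compose_neg[OF linear_hess[of \<alpha> p]]
  by (simp add: linear_conv_bounded_linear inner_minus_left[symmetric] del: inner_minus_left)

lemma hess_dissipation_bound:
  fixes p :: "real ^ ('m::finite \<times> 'd::finite)"
  assumes "hyperbolic_equilibrium \<alpha> p"
  obtains c where "c > 0" "\<And>z. z \<in> tangent \<Longrightarrow> c * (norm z)\<^sup>2 \<le> - (hess \<alpha> p z \<bullet> dF \<alpha> p z)"
proof -
  have peq: "p \<in> equilibria \<alpha>" using assms unfolding hyperbolic_equilibrium_def by blast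
  obtain k where k: "k > 0" "\<And>z. k * norm z \<le> norm (dF \<alpha> p z)"
    using hyperbolic_bounded_below[OF assms] by blast
  show ?thesis
  proof (rule that[of "k\<^sup>2"])
    fix z :: "real ^ ('m \<times> 'd)" assume z: "z \<in> tangent"
    have "(k * norm z)\<^sup>2 \<le> (norm (dF \<alpha> p z))\<^sup>2" using k by (intro power_mono) auto
    then show "k\<^sup>2 * (norm z)\<^sup>2 \<le> - (hess \<alpha> p z \<bullet> dF \<alpha> p z)"
      using hess_dissipation[OF peq z] by (simp add: power_mult_distrib)
  qed (use k in simp)
qed

text \<open>
  Near a hyperbolic equilibrium, and away from it, the field is transversal to the level sets of the Hessian
  form. In particular there is no other equilibrium near \<open>p\<close>.
\<close>

lemma local_dissipation:
  assumes "hyperbolic_equilibrium \<alpha> p"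
  obtains c r where "c > 0" "r > 0"
    "\<And>x. x \<in> simplex_product \<Longrightarrow> dist x p < r \<Longrightarrow> hess \<alpha> p (x - p) \<bullet> F_field \<alpha> x \<le> - c * (norm (x - p))\<^sup>2"
proof -
  have peq: "p \<in> equilibria \<alpha>" using assms unfolding hyperbolic_equilibrium_def by blast
  then have p: "p \<in> simplex_product" "F_field \<alpha> p = 0" by (auto simp: equilibria_def)
  obtain c where c: "c > 0" "\<And>z. z \<in> tangent \<Longrightarrow> c * (norm z)\<^sup>2 \<le> - (hess \<alpha> p z \<bullet> dF \<alpha> p z)"
    using hess_dissipation_bound[OF assms] by blast
  obtain r where r: "r > 0" "\<And>x y. x \<in> simplex_product \<Longrightarrow> y \<in> simplex_product \<Longrightarrow> dist x p < r \<Longrightarrow> dist y p < r \<Longrightarrow>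
     c / 2 * (norm (x - y))\<^sup>2 \<le> - (hess \<alpha> p (x - y) \<bullet> (F_field \<alpha> x - F_field \<alpha> y))"
    using local_monotonicity[OF bounded_bilinear_minus_hess c] by blast
  show ?thesis
  proof (rule that[of "c / 2" r])
    fix x assume "x \<in> simplex_product" "dist x p < r"
    then show "hess \<alpha> p (x - p) \<bullet> F_field \<alpha> x \<le> - (c / 2) * (norm (x - p))\<^sup>2"
      using r(2)[of x p] r(1) p by simp
  qed (use c r in auto)
qed

lemma hyperbolic_isolated:
  assumes "hyperbolic_equilibrium \<alpha> p"
  obtains r where "r > 0" "\<And>x. x \<in> equilibria \<alpha> \<Longrightarrow> dist x p < r \<Longrightarrow> x = p"
proof -
  obtain c r where cr: "c > 0" "r > 0"
    "\<And>x. x \<in> simplex_product \<Longrightarrow> dist x p < r \<Longrightarrow> hess \<alpha> p (x - p) \<bullet> F_field \<alpha> x \<le> - c * (norm (x - p))\<^sup>2"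
    using local_dissipation[OF assms] by blast
  show ?thesis
  proof (rule that[OF cr(2)])
    fix x assume x: "x \<in> equilibria \<alpha>" "dist x p < r"
    then have "c * (norm (x - p))\<^sup>2 \<le> 0" using cr(3)[of x] by (auto simp: equilibria_def)
    then show "x = p" using cr(1) by (simp add: mult_le_0_iff)
  qed
qed

lemma norm_vertex_diff:
  fixes w w' :: "'m::finite \<Rightarrow> 'd::finite"
  assumes "x \<in> simplex_product" "y \<in> simplex_product"
  shows "norm ((vertex w - vertex w') - (x - y)) \<le> 4 * real CARD('m)"
  using norm_triangle_ineq4[of "vertex w - vertex w'" "x - y"] simplex_diff_norm[OF assms]
    simplex_diff_norm[OF vertex_in_simplex[of w] vertex_in_simplex[of w']] by linarith

text \<open>
  At a stable equilibrium the Hessian form \<open>q\<close> is definite on the tangent space, so its sublevel sets in the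
  product of simplices are small neighbourhoods of \<open>p\<close>, and it decreases along the field.
\<close>

lemma stable_local_lyapunov:
  fixes \<alpha> :: "('m::finite, 'd::finite) params"
  assumes sym: "\<And>v i j. \<alpha> v i j = \<alpha> v j i" and st: "linearly_stable \<alpha> p"
    and eps: "\<epsilon> > 0"
  obtains q r C where "r > 0" "C \<ge> 0" "continuous_on UNIV q" "q p = 0"
    "\<And>x. x \<in> simplex_product \<Longrightarrow> q x < r \<Longrightarrow> dist x p < \<epsilon>"
    "\<And>n x. x \<in> simplex_product \<Longrightarrow> q x < r \<Longrightarrow>
       (\<Sum>w\<in>UNIV. walk_prob \<alpha> x w * q (occupation_step n x w)) \<le> q x + C * (gain TYPE('d) n)\<^sup>2"
    "\<And>x. x \<in> simplex_product \<Longrightarrow> 0 \<le> q x"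
proof -
  have hyp: "hyperbolic_equilibrium \<alpha> p" using st unfolding linearly_stable_def by blast
  then have p: "p \<in> simplex_product" unfolding hyperbolic_equilibrium_def equilibria_def by blast
  obtain \<kappa> where \<kappa>: "\<kappa> > 0" "\<And>z. z \<in> tangent \<Longrightarrow> \<kappa> * (norm z)\<^sup>2 \<le> hess \<alpha> p z \<bullet> z"
    using stable_hess_positive[OF sym st] by blast
  obtain c r0 where c: "c > 0" "r0 > 0"
    "\<And>x. x \<in> simplex_product \<Longrightarrow> dist x p < r0 \<Longrightarrow> hess \<alpha> p (x - p) \<bullet> F_field \<alpha> x \<le> - c * (norm (x - p))\<^sup>2"
    using local_dissipation[OF hyp] by blast
  obtain K where K: "K > 0" "\<And>a b. norm (hess \<alpha> p a \<bullet> b) \<le> norm a * norm b * K"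
    using bounded_bilinear.pos_bounded[OF bounded_bilinear_hess[of \<alpha> p]] by blast
  define q where "q = (\<lambda>x. hess \<alpha> p (x - p) \<bullet> (x - p))"
    define s where "s = min \<epsilon> r0"
    have s: "s > 0" using eps c by (simp add: s_def)
    have ball: "dist x p < s" if x: "x \<in> simplex_product" "q x < \<kappa> * s\<^sup>2" for x
    proof -
      have "\<kappa> * (norm (x - p))\<^sup>2 \<le> q x"
        unfolding q_def by (rule \<kappa>(2)[OF simplex_diff_tangent[OF x(1) p]])
      then have "\<kappa> * (norm (x - p))\<^sup>2 < \<kappa> * s\<^sup>2" using x(2) by linarith
      then have "(norm (x - p))\<^sup>2 < s\<^sup>2" using \<kappa>(1) by simp
      then show ?thesis using s by (simp add: dist_norm power2_less_imp_less)
    qed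
    show ?thesis
    proof (rule that[of "\<kappa> * s\<^sup>2" "K * (2 * real CARD('m))\<^sup>2" q])
      show "continuous_on UNIV q" unfolding q_def
        by (intro bounded_bilinear.continuous_on[OF bounded_bilinear_inner] continuous_intros
           linear_continuous_on_compose[OF _ linear_hess])
      fix n and x :: "real ^ ('m \<times> 'd)" assume x: "x \<in> simplex_product" "q x < \<kappa> * s\<^sup>2"
      define z where "z = x - p"
      have "(\<Sum>w\<in>UNIV. walk_prob \<alpha> x w * q (occupation_step n x w))
        \<le> q x + gain TYPE('d) n * (2 * (hess \<alpha> p z \<bullet> F_field \<alpha> x)) + K * (2 * real CARD('m))\<^sup>2 * (gain TYPE('d) n)\<^sup>2"
      proof (rule quadratic_drift[OF x(1)])
        show "linear (\<lambda>y. 2 * (hess \<alpha> p z \<bullet> y))" by (auto intro!: linearI simp: inner_add_right)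
        show "q y \<le> q x + 2 * (hess \<alpha> p z \<bullet> (y - x)) + K * (norm (y - x))\<^sup>2" for y
        proof -
          define \<delta> where "\<delta> = y - x"
          have "y - p = z + \<delta>" by (simp add: z_def \<delta>_def)
          then have "q y = q x + 2 * (hess \<alpha> p z \<bullet> \<delta>) + hess \<alpha> p \<delta> \<bullet> \<delta>"
            unfolding q_def using hess_symmetric[OF sym, where p = p and y = z and z = \<delta>]
            by (simp add: z_def[symmetric] linear_add[OF linear_hess] inner_add_left inner_add_right inner_commute)
          moreover have "hess \<alpha> p \<delta> \<bullet> \<delta> \<le> K * (norm \<delta>)\<^sup>2"
            using K(2)[of \<delta> \<delta>] by (simp add: power2_eq_square mult_ac)
          ultimately show ?thesis by (simp add: \<delta>_def)
        qed
      qed (use K in simp)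
      moreover have "gain TYPE('d) n * (2 * (hess \<alpha> p z \<bullet> F_field \<alpha> x)) \<le> 0"
      proof -
        have "hess \<alpha> p z \<bullet> F_field \<alpha> x \<le> - c * (norm z)\<^sup>2"
          unfolding z_def using c(3)[OF x(1)] ball[OF x] by (simp add: s_def)
        moreover have "0 \<le> c * (norm z)\<^sup>2" using c(1) by simp
        ultimately have "2 * (hess \<alpha> p z \<bullet> F_field \<alpha> x) \<le> 0" by linarith
        then show ?thesis by (rule mult_nonneg_nonpos[OF less_imp_le[OF gain_pos]])
      qed
      ultimately show "(\<Sum>w\<in>UNIV. walk_prob \<alpha> x w * q (occupation_step n x w))
        \<le> q x + K * (2 * real CARD('m))\<^sup>2 * (gain TYPE('d) n)\<^sup>2" by linarith
    next
      fix x :: "real ^ ('m \<times> 'd)" assume "x \<in> simplex_product"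
      then have "\<kappa> * (norm (x - p))\<^sup>2 \<le> q x"
        unfolding q_def by (intro \<kappa>(2) simplex_diff_tangent p)
      then show "0 \<le> q x" using \<kappa>(1) by (smt (verit) zero_le_mult_iff zero_le_power2)
    qed (use \<kappa> s K ball in \<open>auto simp: q_def s_def\<close>)
qed

text \<open>
  Let \<open>u\<close> be a tangent eigenvector for the eigenvalue \<open>\<rho> > 0\<close>. Then \<open>l = hess \<alpha> p u\<close> is a left eigenvector of
  the Jacobian on the tangent space. Both \<open>(l \<bullet> z)\<^sup>2\<close> and \<open>- hess \<alpha> p z \<bullet> z\<close> increase along the linearised
  flow, and their sum with a large weight \<open>K\<close> on the first one is moreover positive in the mean on the
  difference of two independent vertices: \<open>l\<close> is not constant on all blocks, as otherwise the
  covariance matrix would map it to \<open>0\<close>, so the first term has a positive mean.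
\<close>

lemma unstable_form:
  fixes \<alpha> :: "('m::finite, 'd::finite) params"
  assumes sym: "\<And>v i j. \<alpha> v i j = \<alpha> v j i" and unst: "linearly_unstable \<alpha> p"
  obtains h c where "bounded_bilinear h" "\<And>y z. h y z = h z y" "c > 0"
    "\<And>z. z \<in> tangent \<Longrightarrow> c * (norm z)\<^sup>2 \<le> h z (dF \<alpha> p z)"
    "0 < (\<Sum>w\<in>UNIV. \<Sum>w'\<in>UNIV. walk_prob \<alpha> p w * walk_prob \<alpha> p w' *
           (h (vertex w - vertex w') (vertex w - vertex w') :: real))"
proof -
  have hyp: "hyperbolic_equilibrium \<alpha> p" using unst unfolding linearly_unstable_def by blast
  then have peq: "p \<in> equilibria \<alpha>" unfolding hyperbolic_equilibrium_def by blast
  note p = equilibriumD[OF peq]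
  obtain u \<rho> where u: "u \<in> tangent" "u \<noteq> 0" "\<rho> > 0" "dF \<alpha> p u = \<rho> *\<^sub>R u"
    using unstable_real_eigenvector[OF sym unst] by blast
  obtain c where c: "c > 0" "\<And>z. z \<in> tangent \<Longrightarrow> c * (norm z)\<^sup>2 \<le> - (hess \<alpha> p z \<bullet> dF \<alpha> p z)"
    using hess_dissipation_bound[OF hyp] by blast
  define l where "l = hess \<alpha> p u"
  have left: "l \<bullet> dF \<alpha> p z = \<rho> * (l \<bullet> z)" if z: "z \<in> tangent" for z
  proof -
    have "l \<bullet> dF \<alpha> p z = dF \<alpha> p u \<bullet> hess \<alpha> p z"
      unfolding l_def dF_eq_cov_hess[OF peq z] dF_eq_cov_hess[OF peq u(1)]
      using cov_symmetric[of p "hess \<alpha> p u" "hess \<alpha> p z"] by simp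
    also have "\<dots> = \<rho> * (l \<bullet> z)"
      unfolding u(4) l_def using hess_symmetric[OF sym, where p = p and y = u and z = z] by simp
    finally show ?thesis .
  qed
  define D where "D = (\<lambda>w w' :: 'm \<Rightarrow> 'd. vertex w - vertex w')"
  define P where "P = (\<lambda>w w'. walk_prob \<alpha> p w * walk_prob \<alpha> p w')"
  have P: "P w w' > 0" for w w' by (simp add: P_def walk_prob_pos)
  define S where "S = (\<Sum>w\<in>UNIV. \<Sum>w'\<in>UNIV. P w w' * (l \<bullet> D w w')\<^sup>2)"
  define E where "E = (\<Sum>w\<in>UNIV. \<Sum>w'\<in>UNIV. P w w' * (hess \<alpha> p (D w w') \<bullet> D w w'))"
  have "\<exists>w w'. l \<bullet> D w w' \<noteq> 0"
  proof (rule ccontr)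
    assume "\<not> ?thesis"
    then have orth: "l \<bullet> D w w' = 0" for w w' by blast
    have vert: "l \<bullet> vertex w = (\<Sum>i\<in>UNIV. l $ (i, w i))" for w
      by (simp add: inner_blocks vertex_def of_bool_def if_distrib sum.delta cong: if_cong)
    have const: "l $ (i, v) = l $ (i, v')" for i v v'
    proof -
      (* two joint positions that differ in the walk i only *)
      have "0 = l \<bullet> D ((\<lambda>_. v)(i := v)) ((\<lambda>_. v)(i := v'))" using orth by simp
      also have "\<dots> = l $ (i, v) - l $ (i, v')"
        unfolding D_def inner_diff_right vert by (simp add: sum_subtractf[symmetric] sum.remove[of UNIV i])
      finally show ?thesis by simp
    qed
    have "cov p l $ (i, v) = 0" for i v
    proof -
      have "(\<Sum>u\<in>UNIV. p $ (i, u) * l $ (i, u)) = (\<Sum>u\<in>UNIV. p $ (i, u) * l $ (i, v))"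
        by (intro sum.cong refl arg_cong2[where f = "(*)"] const)
      then show ?thesis by (simp add: cov_nth sum_distrib_right[symmetric] simplex_block_sum[OF p(1)])
    qed
    then have "cov p l = 0" by (auto simp: vec_eq_iff)
    then show False using dF_eq_cov_hess[OF peq u(1)] u by (simp add: l_def)
  qed
  then obtain w0 w1 where w: "l \<bullet> D w0 w1 \<noteq> 0" by blast
  have S: "S > 0"
  proof -
    have nn: "0 \<le> P w w' * (l \<bullet> D w w')\<^sup>2" for w w' using P[of w w'] by simp
    have "0 < P w0 w1 * (l \<bullet> D w0 w1)\<^sup>2" using w P[of w0 w1] by simp
    also have "\<dots> \<le> (\<Sum>w'\<in>UNIV. P w0 w' * (l \<bullet> D w0 w')\<^sup>2)"
      by (rule member_le_sum) (auto simp: nn)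
    also have "\<dots> \<le> S" unfolding S_def
      by (rule member_le_sum[where f = "\<lambda>w. \<Sum>w'\<in>UNIV. P w w' * (l \<bullet> D w w')\<^sup>2"]) (auto intro!: sum_nonneg nn)
    finally show ?thesis .
  qed
  (* large enough for K * S to exceed the mean E of the Hessian form *)
  define K where "K = (\<bar>E\<bar> + 1) / S"
  have K: "K > 0" "K * S > E" using S by (auto simp: K_def)
  define h where "h = (\<lambda>y z. K * ((l \<bullet> y) * (l \<bullet> z)) - hess \<alpha> p y \<bullet> z)"
  show ?thesis
  proof (rule that[of h c])
    have "bilinear h" unfolding bilinear_def h_def
      by (auto intro!: linearI simp: linear_add[OF linear_hess] linear_scale[OF linear_hess] inner_add_left inner_add_right algebra_simps)
    then show "bounded_bilinear h" by (simp add: bilinear_conv_bounded_bilinear)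
    show "h y z = h z y" for y z
      using hess_symmetric[OF sym, where p = p and y = y and z = z] by (simp add: h_def inner_commute)
    show "c > 0" by fact
    show "c * (norm z)\<^sup>2 \<le> h z (dF \<alpha> p z)" if z: "z \<in> tangent" for z
    proof -
      have "0 \<le> K * (\<rho> * (l \<bullet> z)\<^sup>2)" using K u by simp
      then show ?thesis using c(2)[OF z] by (simp add: h_def left[OF z] power2_eq_square mult_ac)
    qed
    have "(\<Sum>w\<in>UNIV. \<Sum>w'\<in>UNIV. P w w' * h (D w w') (D w w')) = K * S - E"
      unfolding S_def E_def h_def
      by (simp add: right_diff_distrib sum_subtractf sum_distrib_left power2_eq_square mult_ac)
    then show "0 < (\<Sum>w\<in>UNIV. \<Sum>w'\<in>UNIV. walk_prob \<alpha> p w * walk_prob \<alpha> p w' * h (vertex w - vertex w') (vertex w - vertex w'))"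
      using K(2) by (simp add: P_def D_def)
  qed
qed

lemma exp_le_quadratic:
  assumes "\<bar>x :: real\<bar> \<le> 1"
  shows "exp x \<le> 1 + x + x\<^sup>2"
proof (cases "x \<ge> 0")
  case True
  then show ?thesis using exp_bound[of x] assms by simp
next
  case False
  define y where "y = - x"
  have y: "y > 0" "y \<le> 1" using False assms by (auto simp: y_def)
  have "0 \<le> y\<^sup>2 / 2 + y ^ 3 / 2 + y ^ 4 / 2" using y by simp
  moreover have "(1 - y + y\<^sup>2) * (1 + y + y\<^sup>2 / 2) = 1 + (y\<^sup>2 / 2 + y ^ 3 / 2 + y ^ 4 / 2)"
    by (simp add: field_simps power2_eq_square power3_eq_cube power4_eq_xxxx)
  ultimately have "1 \<le> (1 - y + y\<^sup>2) * (1 + y + y\<^sup>2 / 2)" by linarith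
  also have "\<dots> \<le> (1 - y + y\<^sup>2) * exp y"
    using y exp_lower_Taylor_quadratic[of y] by (intro mult_left_mono) auto
  finally have "exp (- y) \<le> 1 - y + y\<^sup>2" by (simp add: exp_minus divide_simps)
  then show ?thesis by (simp add: y_def)
qed

text \<open>
  The mean of \<open>exp (s * \<phi>)\<close> of the difference of two independent copies of the process, both in \<open>N\<close>,
  decreases by a definite factor in each step. The parameter \<open>s\<close> will be the starting time; up to that scale
  the increments of the exponent stay bounded. The loss is of the order of the step size squared even if both
  copies are at the same point, because the noise alone drives them apart.
\<close>

definition repels_pairs ::
  "('m::finite, 'd::finite) params \<Rightarrow> (real ^ ('m \<times> 'd)) set \<Rightarrow> (real ^ ('m \<times> 'd) \<Rightarrow> real) \<Rightarrow> real \<Rightarrow> bool" where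
  "repels_pairs \<alpha> N \<phi> c \<longleftrightarrow>
     (\<forall>x \<in> simplex_product \<inter> N. \<forall>y \<in> simplex_product \<inter> N. \<forall>s n. 0 \<le> s \<longrightarrow> s * gain TYPE('d) n \<le> 1 \<longrightarrow>
       (\<Sum>w\<in>UNIV. \<Sum>w'\<in>UNIV. walk_prob \<alpha> x w * walk_prob \<alpha> y w' *
          exp (s * \<phi> (occupation_step n x w - occupation_step n y w')))
       \<le> exp (s * \<phi> (x - y)) * (1 - c * s * (gain TYPE('d) n)\<^sup>2))"

text \<open>
  Take \<open>\<phi> = - \<theta> * h\<close> with the form \<open>h\<close> of lemma \<open>unstable_form\<close> and a small \<open>\<theta>\<close>, and expand the exponential to
  second order. The first-order term is negative: it contains \<open>- c * |z|\<^sup>2\<close> for the drift of the difference \<open>z\<close> of the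
  two points and \<open>- 2 * c0 * \<gamma>\<close> for the noise. Relative to it, the second-order term has the form
  \<open>|z|\<^sup>2 + \<gamma>\<^sup>2\<close> with coefficients proportional to \<open>\<theta>\<close>, so it is absorbed.
\<close>

lemma unstable_pair_step:
  fixes \<alpha> :: "('m::finite, 'd::finite) params"
  assumes sym: "\<And>v i j. \<alpha> v i j = \<alpha> v j i" and unst: "linearly_unstable \<alpha> p"
  obtains \<phi> r c where "r > 0" "c > 0" "continuous_on UNIV \<phi>" "\<phi> 0 = 0" "repels_pairs \<alpha> (ball p r) \<phi> c"
proof -
  obtain h c where h: "bounded_bilinear h" "\<And>y z. h y z = h z y" "c > 0"
    "\<And>z. z \<in> tangent \<Longrightarrow> c * (norm z)\<^sup>2 \<le> h z (dF \<alpha> p z)"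
    "0 < (\<Sum>w\<in>UNIV. \<Sum>w'\<in>UNIV. walk_prob \<alpha> p w * walk_prob \<alpha> p w' *
           (h (vertex w - vertex w') (vertex w - vertex w') :: real))"
    using unstable_form[OF sym unst] by blast
  obtain K where K: "K > 0" "\<And>a b. norm (h a b) \<le> norm a * norm b * K"
    using bounded_bilinear.pos_bounded[OF h(1)] by blast
  obtain r1 where r1: "r1 > 0" "\<And>x y. x \<in> simplex_product \<Longrightarrow> y \<in> simplex_product \<Longrightarrow> dist x p < r1 \<Longrightarrow> dist y p < r1 \<Longrightarrow>
     c / 2 * (norm (x - y))\<^sup>2 \<le> h (x - y) (F_field \<alpha> x - F_field \<alpha> y)"
    using local_monotonicity[OF h(1,3,4)] by blast
  define \<delta> where "\<delta> = (\<lambda>x y (w :: 'm \<Rightarrow> 'd) w'. vertex w - vertex w' - (x - y))"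
  define V where "V = (\<lambda>x y. \<Sum>w\<in>UNIV. \<Sum>w'\<in>UNIV. walk_prob \<alpha> x w * walk_prob \<alpha> y w' * h (\<delta> x y w w') (\<delta> x y w w'))"
  (* V x y is the mean of the form on the difference of two increments, from x and from y;
  near (p, p) it stays above half its value at (p, p) *)
  define c0 where "c0 = V p p / 4"
  have c0: "c0 > 0" using h(5) by (simp add: c0_def V_def \<delta>_def)
  obtain r2 where r2: "r2 > 0" "\<And>x y. dist x p < r2 \<Longrightarrow> dist y p < r2 \<Longrightarrow> 2 * c0 \<le> V x y"
  proof -
    have "((\<lambda>u. V (fst u) (snd u)) \<longlongrightarrow> V (fst (p, p)) (snd (p, p))) (at (p, p))"
      unfolding V_def \<delta>_def
      by (intro tendsto_sum tendsto_mult tendsto_walk_prob bounded_bilinear.tendsto[OF h(1)] tendsto_intros)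
    then have "((\<lambda>u. V (fst u) (snd u)) \<longlongrightarrow> V p p) (nhds (p, p))"
      using tendsto_at_iff_tendsto_nhds[of "\<lambda>u. V (fst u) (snd u)" "(p, p)"] by simp
    then have "eventually (\<lambda>u. V (fst u) (snd u) > 2 * c0) (nhds (p, p))"
      using c0 by (intro order_tendstoD(1)) (auto simp: c0_def)
    then obtain d where d: "d > 0" "\<And>u. dist u (p, p) < d \<Longrightarrow> V (fst u) (snd u) > 2 * c0"
      unfolding eventually_nhds_metric by blast
    show ?thesis
    proof (rule that[of "d / 2"])
      fix x y assume "dist x p < d / 2" "dist y p < d / 2"
      then have "dist (x, y) (p, p) < d"
        using sqrt_sum_squares_le_sum[of "dist x p" "dist y p"] by (simp add: dist_Pair_Pair)
      then show "2 * c0 \<le> V x y" using d(2)[of "(x, y)"] by simp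
    qed (use d in simp)
  qed
  define R where "R = 4 * real CARD('m)"
  have R: "R > 0" by (simp add: R_def)
  (* the first bound keeps the exponent D below within [-1, 1], the other two absorb
  the two parts of its square *)
  define \<theta> where "\<theta> = min (1 / (3 * K * R\<^sup>2)) (min (c / (8 * K\<^sup>2 * R\<^sup>2)) (c0 / (2 * K\<^sup>2 * R ^ 4)))"
  have \<theta>: "\<theta> > 0" "\<theta> * (3 * K * R\<^sup>2) \<le> 1" "\<theta> * (8 * K\<^sup>2 * R\<^sup>2) \<le> c" "\<theta> * (2 * K\<^sup>2 * R ^ 4) \<le> c0"
  proof -
    show "\<theta> > 0" using K R c0 h(3) by (simp add: \<theta>_def)
    have "\<theta> \<le> 1 / (3 * K * R\<^sup>2)" "\<theta> \<le> c / (8 * K\<^sup>2 * R\<^sup>2)" "\<theta> \<le> c0 / (2 * K\<^sup>2 * R ^ 4)" by (auto simp: \<theta>_def)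
    then show "\<theta> * (3 * K * R\<^sup>2) \<le> 1" "\<theta> * (8 * K\<^sup>2 * R\<^sup>2) \<le> c" "\<theta> * (2 * K\<^sup>2 * R ^ 4) \<le> c0"
      using K R by (auto simp: pos_le_divide_eq)
  qed
  define \<phi> where "\<phi> = (\<lambda>z. - \<theta> * h z z)"
  show ?thesis
  proof (rule that[of "min r1 r2" "\<theta> * c0" \<phi>])
    show "min r1 r2 > 0" "\<theta> * c0 > 0" using r1 r2 \<theta> c0 by auto
    show "continuous_on UNIV \<phi>" unfolding \<phi>_def
      by (intro continuous_intros bounded_bilinear.continuous_on[OF h(1)])
    show "\<phi> 0 = 0" by (simp add: \<phi>_def bounded_bilinear.zero_left[OF h(1)])
    show "repels_pairs \<alpha> (ball p (min r1 r2)) \<phi> (\<theta> * c0)"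
      unfolding repels_pairs_def
    proof (intro ballI allI impI)
      fix x y :: "real ^ ('m \<times> 'd)" and s n
      assume "x \<in> simplex_product \<inter> ball p (min r1 r2)" "y \<in> simplex_product \<inter> ball p (min r1 r2)"
      then have xy: "x \<in> simplex_product" "y \<in> simplex_product" "dist x p < min r1 r2" "dist y p < min r1 r2"
        by (auto simp: dist_commute)
      assume s: "0 \<le> s" "s * gain TYPE('d) n \<le> 1"
      define \<gamma> z G where "\<gamma> = gain TYPE('d) n" and "z = x - y" and "G = s * \<gamma>"
      have \<gamma>: "\<gamma> > 0" "\<gamma> \<le> 1" by (auto simp: \<gamma>_def gain_pos gain_le_1)
      have G: "0 \<le> G" "G \<le> 1" using s \<gamma> by (auto simp: G_def \<gamma>_def)
      define P where "P = (\<lambda>w w'. walk_prob \<alpha> x w * walk_prob \<alpha> y w')"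
      have P: "P w w' > 0" for w w' by (simp add: P_def walk_prob_pos)
      have Psum: "(\<Sum>w\<in>UNIV. \<Sum>w'\<in>UNIV. P w w') = 1"
        by (simp add: P_def sum_distrib_left[symmetric] walk_prob_sum)
      have nd: "norm (\<delta> x y w w') \<le> R" for w w' unfolding \<delta>_def R_def by (rule norm_vertex_diff[OF xy(1,2)])
      have nz: "norm z \<le> R"
        using simplex_diff_norm[OF xy(1,2)] by (simp add: R_def z_def)
      define A B where "A = (\<lambda>w w'. h z (\<delta> x y w w'))" and "B = (\<lambda>w w'. h (\<delta> x y w w') (\<delta> x y w w'))"
      have A: "\<bar>A w w'\<bar> \<le> norm z * R * K" for w w'
      proof -
        have "\<bar>A w w'\<bar> \<le> norm z * norm (\<delta> x y w w') * K" using K(2)[of z "\<delta> x y w w'"] by (simp add: A_def)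
        also have "\<dots> \<le> norm z * R * K" using nd[of w w'] K by (intro mult_right_mono mult_left_mono) auto
        finally show ?thesis .
      qed
      have B: "\<bar>B w w'\<bar> \<le> R\<^sup>2 * K" for w w'
      proof -
        have "\<bar>B w w'\<bar> \<le> norm (\<delta> x y w w') * norm (\<delta> x y w w') * K" using K(2)[of "\<delta> x y w w'" "\<delta> x y w w'"] by (simp add: B_def)
        also have "\<dots> \<le> R * R * K" using nd[of w w'] K R by (intro mult_right_mono mult_mono) auto
        finally show ?thesis by (simp add: power2_eq_square)
      qed
      define D where "D = (\<lambda>w w'. \<theta> * G * (2 * A w w' + \<gamma> * B w w'))"
      have step: "s * \<phi> (occupation_step n x w - occupation_step n y w') = s * \<phi> z - D w w'" for w w'
      proof -
        have st: "occupation_step n x w - occupation_step n y w' = z + \<gamma> *\<^sub>R \<delta> x y w w'"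
          by (simp add: occupation_step_def z_def \<gamma>_def \<delta>_def algebra_simps)
        have "h (z + \<gamma> *\<^sub>R \<delta> x y w w') (z + \<gamma> *\<^sub>R \<delta> x y w w') = h z z + 2 * \<gamma> * A w w' + \<gamma>\<^sup>2 * B w w'"
          using h(2)[of "\<delta> x y w w'" z]
          by (simp add: bounded_bilinear.add_left[OF h(1)] bounded_bilinear.add_right[OF h(1)]
              bounded_bilinear.scaleR_left[OF h(1)] bounded_bilinear.scaleR_right[OF h(1)] A_def B_def power2_eq_square algebra_simps)
        then show ?thesis unfolding st by (simp add: \<phi>_def D_def G_def power2_eq_square algebra_simps)
      qed
      have bound: "exp (- D w w') \<le> 1 - D w w' + \<theta> * G * (c * (norm z)\<^sup>2 + c0 * \<gamma>)" for w w'
      proof -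
        define a b where "a = 2 * A w w'" and "b = \<gamma> * B w w'"
        have ab: "\<bar>a\<bar> \<le> 2 * (norm z * R * K)" "\<bar>b\<bar> \<le> \<gamma> * (R\<^sup>2 * K)"
          using A[of w w'] mult_left_mono[OF B[of w w'], of \<gamma>] \<gamma> by (auto simp: a_def b_def abs_mult)
        have "\<bar>a + b\<bar> \<le> 3 * K * R\<^sup>2"
        proof -
          have "norm z * R * K \<le> R * R * K" using nz R K by (intro mult_right_mono) auto
          moreover have "\<gamma> * (R\<^sup>2 * K) \<le> 1 * (R\<^sup>2 * K)" using \<gamma> K by (intro mult_right_mono) auto
          ultimately show ?thesis using ab by (simp add: power2_eq_square mult_ac)
        qed
        then have "\<theta> * G * \<bar>a + b\<bar> \<le> \<theta> * G * (3 * K * R\<^sup>2)" using \<theta> G by (intro mult_left_mono) auto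
        also have "\<dots> \<le> 1 * G" using mult_right_mono[OF \<theta>(2) G(1)] by (simp add: mult_ac)
        finally have "\<bar>- D w w'\<bar> \<le> 1" using \<theta> G by (simp add: D_def a_def b_def abs_mult)
        then have "exp (- D w w') \<le> 1 - D w w' + (D w w')\<^sup>2" using exp_le_quadratic[of "- D w w'"] by simp
        moreover have "(D w w')\<^sup>2 \<le> \<theta> * G * (c * (norm z)\<^sup>2 + c0 * \<gamma>)"
        proof -
          have "(a + b)\<^sup>2 \<le> 2 * a\<^sup>2 + 2 * b\<^sup>2" using sum_squares_bound[of a b] by (simp add: power2_sum)
          also have "\<dots> \<le> 2 * (2 * (norm z * R * K))\<^sup>2 + 2 * (\<gamma> * (R\<^sup>2 * K))\<^sup>2"
            using power_mono[OF ab(1), of 2] power_mono[OF ab(2), of 2] by simp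
          also have "\<dots> = (8 * K\<^sup>2 * R\<^sup>2) * (norm z)\<^sup>2 + (2 * K\<^sup>2 * R ^ 4) * (\<gamma> * \<gamma>)"
            by (simp add: power_mult_distrib power2_eq_square power4_eq_xxxx)
          also have "\<dots> \<le> (8 * K\<^sup>2 * R\<^sup>2) * (norm z)\<^sup>2 + (2 * K\<^sup>2 * R ^ 4) * (\<gamma> * 1)"
            using \<gamma> by (intro add_left_mono mult_left_mono) auto
          finally have 1: "\<theta> * (a + b)\<^sup>2 \<le> \<theta> * ((8 * K\<^sup>2 * R\<^sup>2) * (norm z)\<^sup>2 + (2 * K\<^sup>2 * R ^ 4) * \<gamma>)"
            using \<theta> by (intro mult_left_mono) auto
          also have "\<dots> = (\<theta> * (8 * K\<^sup>2 * R\<^sup>2)) * (norm z)\<^sup>2 + (\<theta> * (2 * K\<^sup>2 * R ^ 4)) * \<gamma>"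
            by (simp add: algebra_simps)
          also have "\<dots> \<le> c * (norm z)\<^sup>2 + c0 * \<gamma>"
            using \<theta> \<gamma> by (intro add_mono mult_right_mono) auto
          finally have "\<theta> * (a + b)\<^sup>2 \<le> c * (norm z)\<^sup>2 + c0 * \<gamma>" .
          moreover have "G * (\<theta> * (a + b)\<^sup>2) \<le> 1 * (\<theta> * (a + b)\<^sup>2)"
            using G \<theta> by (intro mult_right_mono) auto
          ultimately have "G * (\<theta> * (a + b)\<^sup>2) \<le> c * (norm z)\<^sup>2 + c0 * \<gamma>" by linarith
          then have "\<theta> * G * (G * (\<theta> * (a + b)\<^sup>2)) \<le> \<theta> * G * (c * (norm z)\<^sup>2 + c0 * \<gamma>)"
            using \<theta> G by (intro mult_left_mono) auto
          then show ?thesis by (simp add: D_def a_def b_def power_mult_distrib power2_eq_square mult_ac)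
        qed
        ultimately show ?thesis by linarith
      qed
      have sumA: "(\<Sum>w\<in>UNIV. \<Sum>w'\<in>UNIV. P w w' * A w w') \<ge> c / 2 * (norm z)\<^sup>2"
      proof -
        have lin: "linear (h z)" by (simp add: bounded_bilinear.bounded_linear_right[OF h(1)] bounded_linear.linear)
        have split: "A w w' = h z (vertex w - x) - h z (vertex w' - y)" for w w'
          by (simp add: A_def \<delta>_def linear_diff[OF lin])
        have "(\<Sum>w\<in>UNIV. \<Sum>w'\<in>UNIV. P w w' * A w w')
            = (\<Sum>w\<in>UNIV. walk_prob \<alpha> x w * h z (vertex w - x)) * (\<Sum>w'\<in>UNIV. walk_prob \<alpha> y w')
            - (\<Sum>w\<in>UNIV. walk_prob \<alpha> x w) * (\<Sum>w'\<in>UNIV. walk_prob \<alpha> y w' * h z (vertex w' - y))"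
          unfolding sum_product split P_def by (simp add: sum_subtractf[symmetric] algebra_simps)
        also have "\<dots> = h z (F_field \<alpha> x - F_field \<alpha> y)"
          by (simp add: walk_prob_sum walk_prob_drift[OF lin] linear_diff[OF lin, of "F_field \<alpha> x" "F_field \<alpha> y"])
        finally show ?thesis using r1(2)[of x y] xy by (simp add: z_def)
      qed
      have sumB: "(\<Sum>w\<in>UNIV. \<Sum>w'\<in>UNIV. P w w' * B w w') \<ge> 2 * c0"
        using r2(2)[of x y] xy by (simp add: V_def P_def B_def)
      have "(\<Sum>w\<in>UNIV. \<Sum>w'\<in>UNIV. P w w' * exp (- D w w'))
        \<le> (\<Sum>w\<in>UNIV. \<Sum>w'\<in>UNIV. P w w' * (1 - D w w' + \<theta> * G * (c * (norm z)\<^sup>2 + c0 * \<gamma>)))"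
        by (intro sum_mono mult_left_mono bound less_imp_le[OF P])
      also have "\<dots> = (\<Sum>w\<in>UNIV. \<Sum>w'\<in>UNIV. P w w') * (1 + \<theta> * G * (c * (norm z)\<^sup>2 + c0 * \<gamma>))
          - \<theta> * G * (2 * (\<Sum>w\<in>UNIV. \<Sum>w'\<in>UNIV. P w w' * A w w') + \<gamma> * (\<Sum>w\<in>UNIV. \<Sum>w'\<in>UNIV. P w w' * B w w'))"
        by (simp add: D_def sum_distrib_left sum_distrib_right algebra_simps sum.distrib sum_subtractf)
      also have "\<dots> \<le> 1 + \<theta> * G * (c * (norm z)\<^sup>2 + c0 * \<gamma>) - \<theta> * G * (2 * (c / 2 * (norm z)\<^sup>2) + \<gamma> * (2 * c0))"
        unfolding Psum mult_1_left using sumA sumB \<theta> G \<gamma>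
        by (intro diff_left_mono mult_left_mono add_mono) auto
      also have "\<dots> = 1 - \<theta> * c0 * s * \<gamma>\<^sup>2" by (simp add: G_def power2_eq_square algebra_simps)
      finally have main: "(\<Sum>w\<in>UNIV. \<Sum>w'\<in>UNIV. P w w' * exp (- D w w')) \<le> 1 - \<theta> * c0 * s * \<gamma>\<^sup>2" .
      have "(\<Sum>w\<in>UNIV. \<Sum>w'\<in>UNIV. walk_prob \<alpha> x w * walk_prob \<alpha> y w' *
            exp (s * \<phi> (occupation_step n x w - occupation_step n y w')))
        = exp (s * \<phi> z) * (\<Sum>w\<in>UNIV. \<Sum>w'\<in>UNIV. P w w' * exp (- D w w'))"
        unfolding step by (simp add: P_def exp_diff exp_minus sum_distrib_left divide_inverse mult_ac)
      also have "\<dots> \<le> exp (s * \<phi> z) * (1 - \<theta> * c0 * s * \<gamma>\<^sup>2)" using main by (intro mult_left_mono) auto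
      finally show "(\<Sum>w\<in>UNIV. \<Sum>w'\<in>UNIV. walk_prob \<alpha> x w * walk_prob \<alpha> y w' *
            exp (s * \<phi> (occupation_step n x w - occupation_step n y w')))
         \<le> exp (s * \<phi> (x - y)) * (1 - \<theta> * c0 * s * (gain TYPE('d) n)\<^sup>2)" by (simp add: z_def \<gamma>_def)
    qed
  qed
qed

section \<open>Step sizes and slowly varying sequences\<close>

lemma gain_square_le: "(gain TYPE('d::finite) n)\<^sup>2 \<le> 1 / (real CARD('d) + real n) - 1 / (real CARD('d) + real (Suc n))"
proof -
  define t where "t = real CARD('d) + real n"
  have t: "t > 0" by (simp add: t_def add_pos_nonneg)
  have "(1 / (t + 1))\<^sup>2 \<le> 1 / (t * (t + 1))"
    using t by (simp add: power2_eq_square divide_simps)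
  also have "\<dots> = 1 / t - 1 / (t + 1)" using t by (simp add: divide_simps)
  finally show ?thesis by (simp add: gain_def t_def add_ac)
qed

lemma gain_square_ge:
  "1 / (real CARD('d) + real n + 1) - 1 / (real CARD('d) + real (Suc n) + 1) \<le> (gain TYPE('d::finite) n)\<^sup>2"
proof -
  define t where "t = real CARD('d) + real n + 1"
  have t: "t > 0" by (simp add: t_def add_pos_nonneg)
  have "1 / t - 1 / (t + 1) = 1 / (t * (t + 1))" using t by (simp add: divide_simps)
  also have "\<dots> \<le> (1 / t)\<^sup>2" using t by (simp add: power2_eq_square divide_simps)
  finally show ?thesis by (simp add: gain_def t_def add_ac)
qed

lemma sum_gain_square_le: "(\<Sum>k = n..<l. (gain TYPE('d::finite) k)\<^sup>2) \<le> 1 / (real CARD('d) + real n)"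
proof (cases "n \<le> l")
  case True
  have "(\<Sum>k = n..<l. (gain TYPE('d) k)\<^sup>2) \<le> (\<Sum>k = n..<l. 1 / (real CARD('d) + real k) - 1 / (real CARD('d) + real (Suc k)))"
    by (intro sum_mono gain_square_le)
  also have "\<dots> = 1 / (real CARD('d) + real n) - 1 / (real CARD('d) + real l)"
    using sum_Suc_diff'[OF True, of "\<lambda>k. - (1 / (real CARD('d) + real k))"] by simp
  also have "\<dots> \<le> 1 / (real CARD('d) + real n)" by simp
  finally show ?thesis .
qed simp

lemma sum_gain_square_ge:
  assumes "n \<le> l"
  shows "1 / (real CARD('d) + real n + 1) - 1 / (real CARD('d) + real l + 1) \<le> (\<Sum>k = n..<l. (gain TYPE('d::finite) k)\<^sup>2)"
proof -
  have "1 / (real CARD('d) + real n + 1) - 1 / (real CARD('d) + real l + 1)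
    = (\<Sum>k = n..<l. 1 / (real CARD('d) + real k + 1) - 1 / (real CARD('d) + real (Suc k) + 1))"
    using sum_Suc_diff'[OF assms, of "\<lambda>k. - (1 / (real CARD('d) + real k + 1))"] by simp
  also have "\<dots> \<le> (\<Sum>k = n..<l. (gain TYPE('d) k)\<^sup>2)" by (intro sum_mono gain_square_ge)
  finally show ?thesis .
qed

lemma not_summable_gain: "\<not> summable (\<lambda>n. gain TYPE('d::finite) n)"
proof
  assume "summable (\<lambda>n. gain TYPE('d) n)"
  moreover have "gain TYPE('d) n = inverse (of_nat (n + Suc CARD('d)))" for n
    by (simp add: gain_def divide_inverse add_ac)
  ultimately have "summable (\<lambda>n. inverse (of_nat (n + Suc CARD('d)) :: real))" by simp
  then have "summable (\<lambda>n. inverse (of_nat n :: real))"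
    using summable_iff_shift[of "\<lambda>n. inverse (of_nat n :: real)" "Suc CARD('d)"] by blast
  then show False using not_summable_harmonic[where 'a = real] by simp
qed

lemma summable_gain_square: "summable (\<lambda>n. (gain TYPE('d::finite) n)\<^sup>2)"
proof (rule summableI_nonneg_bounded[where x = "1 / real CARD('d)"])
  show "(\<Sum>k<n. (gain TYPE('d) k)\<^sup>2) \<le> 1 / real CARD('d)" for n
    using sum_gain_square_le[of 0 n, where 'd = 'd] by (simp add: atLeast0LessThan)
qed simp

text \<open>
  The sequence of the squares has summable increments: a difference of squares is at most \<open>C * g n\<close> times
  \<open>2 * a n + C * g n\<close>. So \<open>a\<close> converges, and a positive limit is incompatible with the divergence of the sum of \<open>g\<close>.
\<close>

lemma slow_summable_tendsto_zero:
  fixes a g :: "nat \<Rightarrow> real"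
  assumes a: "\<And>n. a n \<ge> 0" and g: "\<And>n. g n \<ge> 0" "\<not> summable g" "summable (\<lambda>n. (g n)\<^sup>2)"
    and slow: "\<And>n. \<bar>a (Suc n) - a n\<bar> \<le> C * g n" and C: "C \<ge> 0"
    and sum: "summable (\<lambda>n. g n * a n)"
  shows "a \<longlonglongrightarrow> 0"
proof -
  have key: "\<bar>(a (Suc n))\<^sup>2 - (a n)\<^sup>2\<bar> \<le> 2 * C * (g n * a n) + C\<^sup>2 * (g n)\<^sup>2" for n
  proof -
    have "(a (Suc n))\<^sup>2 - (a n)\<^sup>2 = (a (Suc n) - a n) * (2 * a n + (a (Suc n) - a n))"
      by (simp add: algebra_simps power2_eq_square)
    also have "\<bar>\<dots>\<bar> \<le> (C * g n) * (2 * a n + C * g n)"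
      unfolding abs_mult using slow[of n] a[of n] C g(1)[of n] by (intro mult_mono) auto
    finally show ?thesis by (simp add: algebra_simps power2_eq_square)
  qed
  have "summable (\<lambda>n. 2 * C * (g n * a n) + C\<^sup>2 * (g n)\<^sup>2)"
    by (intro summable_add summable_mult sum g)
  then have "summable (\<lambda>n. (a (Suc n))\<^sup>2 - (a n)\<^sup>2)"
    by (rule summable_comparison_test') (simp only: real_norm_def key)
  then have "convergent (\<lambda>n. \<Sum>k<n. (a (Suc k))\<^sup>2 - (a k)\<^sup>2)"
    by (simp add: summable_iff_convergent)
  then have "convergent (\<lambda>n. (a n)\<^sup>2 - (a 0)\<^sup>2)" unfolding sum_lessThan_telescope[of "\<lambda>n. (a n)\<^sup>2"] .
  then obtain L where L: "(\<lambda>n. (a n)\<^sup>2 - (a 0)\<^sup>2) \<longlonglongrightarrow> L" unfolding convergent_def by blast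
  have "(\<lambda>n. ((a n)\<^sup>2 - (a 0)\<^sup>2) + (a 0)\<^sup>2) \<longlonglongrightarrow> L + (a 0)\<^sup>2" by (intro tendsto_intros L)
  then have "(\<lambda>n. sqrt ((a n)\<^sup>2)) \<longlonglongrightarrow> sqrt (L + (a 0)\<^sup>2)" by (intro tendsto_real_sqrt) simp
  then have lim: "a \<longlonglongrightarrow> sqrt (L + (a 0)\<^sup>2)" using a by simp
  define l where "l = sqrt (L + (a 0)\<^sup>2)"
  have "l \<ge> 0" unfolding l_def by (rule LIMSEQ_le_const[OF lim]) (use a in blast)
  moreover have "\<not> l > 0"
  proof
    assume l: "l > 0"
    then have "eventually (\<lambda>n. l / 2 < a n) sequentially"
      using order_tendstoD(1)[OF lim, of "l / 2"] by (simp add: l_def)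
    then have "eventually (\<lambda>n. norm (g n) \<le> 2 / l * (g n * a n)) sequentially"
    proof eventually_elim
      case (elim n)
      have "g n * (l / 2) \<le> g n * a n" using elim g(1)[of n] by (intro mult_left_mono) auto
      then show ?case using l g(1)[of n] by (simp add: field_simps)
    qed
    then have "summable g"
      by (rule summable_comparison_test_ev) (intro summable_mult sum)
    then show False using g(2) by simp
  qed
  ultimately show ?thesis using lim by (simp add: l_def)
qed

lemma zero_set_attracts:
  fixes f :: "'a::t2_space \<Rightarrow> 'b::real_normed_vector"
  assumes K: "compact K" and f: "continuous_on K f" and x: "eventually (\<lambda>n. x n \<in> K) G"
    and lim: "((\<lambda>n. f (x n)) \<longlongrightarrow> 0) G" and U: "open U" "{y \<in> K. f y = 0} \<subseteq> U"
  shows "eventually (\<lambda>n. x n \<in> U) G"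
proof (cases "K - U = {}")
  case True
  then show ?thesis using x by (auto elim: eventually_mono)
next
  case False
  have "compact (K - U)" using K U(1) by (rule compact_diff)
  moreover have "continuous_on (K - U) (\<lambda>y. norm (f y))"
    by (intro continuous_intros continuous_on_subset[OF f]) auto
  ultimately obtain y where y: "y \<in> K - U" "\<And>z. z \<in> K - U \<Longrightarrow> norm (f y) \<le> norm (f z)"
    using continuous_attains_inf[OF _ False] by blast
  have "norm (f y) > 0" using y(1) U(2) by auto
  then have "eventually (\<lambda>n. norm (f (x n)) < norm (f y)) G"
    using order_tendstoD(2)[OF tendsto_norm_zero[OF lim]] by blast
  with x show ?thesis by eventually_elim (use y(2) in force)
qed

text \<open>
  A sequence that eventually stays near a finite set and moves by steps that tend to zero cannot jump from one
  point of the set to another.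
\<close>

lemma tendsto_finite_zero_set:
  fixes f :: "'a::euclidean_space \<Rightarrow> 'b::real_normed_vector"
  assumes K: "compact K" and f: "continuous_on K f" and x: "eventually (\<lambda>n. x n \<in> K) sequentially"
    and lim: "(\<lambda>n. f (x n)) \<longlonglongrightarrow> 0" and fin: "finite {y \<in> K. f y = 0}"
    and slow: "(\<lambda>n. dist (x (Suc n)) (x n)) \<longlonglongrightarrow> 0"
  shows "\<exists>p\<in>K. f p = 0 \<and> x \<longlonglongrightarrow> p"
proof -
  define Z where "Z = {y \<in> K. f y = 0}"
  have near: "eventually (\<lambda>n. \<exists>p\<in>Z. dist (x n) p < e) sequentially" if "e > 0" for e
  proof -
    have "eventually (\<lambda>n. x n \<in> (\<Union>p\<in>Z. ball p e)) sequentially"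
      by (rule zero_set_attracts[OF K f x lim]) (use that in \<open>auto simp: Z_def\<close>)
    then show ?thesis by eventually_elim (auto simp: dist_commute)
  qed
  obtain d where d: "d > 0" "\<And>p q. p \<in> Z \<Longrightarrow> q \<in> Z \<Longrightarrow> p \<noteq> q \<Longrightarrow> d \<le> dist p q"
  proof -
    have "uniform_discrete Z" using fin by (simp add: Z_def uniform_discrete_finite_iff[symmetric])
    then show ?thesis using that unfolding uniform_discrete_def by (metis not_le)
  qed
  (* a step below d / 4 between points within d / 4 of p and q gives dist p q < d *)
  define e where "e = d / 4"
  have e: "e > 0" using d by (simp add: e_def)
  have "eventually (\<lambda>n. (\<exists>p\<in>Z. dist (x n) p < e) \<and> dist (x (Suc n)) (x n) < e) sequentially"
    using near[OF e] order_tendstoD(2)[OF slow e] by (rule eventually_conj)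
  then obtain N where N: "\<And>n. n \<ge> N \<Longrightarrow> \<exists>p\<in>Z. dist (x n) p < e" "\<And>n. n \<ge> N \<Longrightarrow> dist (x (Suc n)) (x n) < e"
    unfolding eventually_sequentially by blast
  obtain p where p: "p \<in> Z" "dist (x N) p < e" using N(1)[of N] by blast
  have stay: "dist (x n) p < e" if "n \<ge> N" for n
    using that
  proof (induction n rule: dec_induct)
    case base then show ?case by (rule p)
  next
    case (step n)
    obtain q where q: "q \<in> Z" "dist (x (Suc n)) q < e" using N(1)[of "Suc n"] step by auto
    have "dist p q < d"
      using dist_triangle[of p q "x n"] dist_triangle[of "x n" q "x (Suc n)"] step.IH q(2) N(2)[OF step.hyps(1)] e
      by (simp add: e_def dist_commute)
    then have "q = p" using d(2)[OF p(1) q(1)] by fastforce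
    then show ?case using q by simp
  qed
  have "x \<longlonglongrightarrow> p"
    unfolding tendsto_iff
  proof (intro allI impI)
    fix \<epsilon> :: real assume eps: "\<epsilon> > 0"
    have "eventually (\<lambda>n. \<exists>q\<in>Z. dist (x n) q < min \<epsilon> e) sequentially" using near[of "min \<epsilon> e"] eps e by simp
    with eventually_ge_at_top[of N] show "eventually (\<lambda>n. dist (x n) p < \<epsilon>) sequentially"
    proof eventually_elim
      case (elim n)
      then obtain q where q: "q \<in> Z" "dist (x n) q < min \<epsilon> e" by blast
      have "dist p q < d" using dist_triangle[of p q "x n"] stay[OF elim(1)] q(2) e by (simp add: e_def dist_commute)
      then have "q = p" using d(2)[OF p(1) q(1)] by fastforce
      then show ?case using q by simp
    qed
  qed
  then show ?thesis using p(1) by (auto simp: Z_def)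
qed

section \<open>The occupation vector as a random variable\<close>

lemma occupation_Suc:
  fixes W :: "nat \<Rightarrow> 'w \<Rightarrow> 'm::finite \<Rightarrow> 'd::finite"
  assumes "n \<ge> 1"
  shows "occupation W (Suc n) \<omega> = occupation_step n (occupation W n \<omega>) (W (Suc n) \<omega>)"
proof -
  have "occupation W (Suc n) \<omega> $ (i, v) = occupation_step n (occupation W n \<omega>) (W (Suc n) \<omega>) $ (i, v)" for i v
  proof -
    define t S b where "t = real CARD('d) + real n" and "S = 1 + (\<Sum>k = 1..n. of_bool (W k \<omega> i = v) :: real)"
      and "b = (of_bool (W (Suc n) \<omega> i = v) :: real)"
    have t: "t > 0" by (simp add: t_def add_pos_nonneg)
    have "(S + b) / (t + 1) = S / t + (b - S / t) / (t + 1)"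
      using t by (simp add: divide_simps) (simp add: algebra_simps)
    then show ?thesis using assms
      by (simp add: occupation_def occupation_step_def vertex_def gain_def t_def S_def b_def add_ac)
  qed
  then show ?thesis by (auto simp: vec_eq_iff)
qed

lemma occupation_in_simplex:
  fixes W :: "nat \<Rightarrow> 'w \<Rightarrow> 'm::finite \<Rightarrow> 'd::finite"
  assumes "n \<ge> 1"
  shows "occupation W n \<omega> \<in> simplex_product"
proof -
  have "(\<Sum>v\<in>UNIV. 1 + (\<Sum>k = 1..n. of_bool (W k \<omega> i = v) :: real)) = real CARD('d) + real n" for i
    by (simp add: sum.distrib sum.swap[of _ _ UNIV] of_bool_def sum.delta)
  then show ?thesis using assms
    by (auto simp: simplex_product_def occupation_def sum_divide_distrib[symmetric] intro!: divide_nonneg_nonneg add_nonneg_nonneg sum_nonneg)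
qed

lemma occupation_increment:
  fixes W :: "nat \<Rightarrow> 'w \<Rightarrow> 'm::finite \<Rightarrow> 'd::finite"
  assumes "n \<ge> 1"
  shows "norm (occupation W (Suc n) \<omega> - occupation W n \<omega>) \<le> 2 * real CARD('m) * gain TYPE('d) n"
proof -
  let ?x = "occupation W n \<omega>" and ?e = "vertex (W (Suc n) \<omega>)"
  have "norm (?e - ?x) \<le> 2 * real CARD('m)"
    by (intro simplex_diff_norm vertex_in_simplex occupation_in_simplex assms)
  then have "gain TYPE('d) n * norm (?e - ?x) \<le> gain TYPE('d) n * (2 * real CARD('m))"
    using gain_pos[of n, where 'd = 'd] by (intro mult_left_mono) auto
  then show ?thesis
    using gain_pos[of n, where 'd = 'd] by (simp add: occupation_Suc[OF assms] occupation_step_def mult.commute)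
qed

text \<open>
  The occupation vector takes finitely many values, so that every function of it is measurable and
  integrable. The measure space is arbitrary here, to have the claim both for the \<open>\<sigma>\<close>-algebra of the history and for
  the full one.
\<close>

lemma simple_function_occupation:
  fixes W :: "nat \<Rightarrow> 'w \<Rightarrow> 'm::finite \<Rightarrow> 'd::finite"
  assumes "\<And>k. k \<in> {1..n} \<Longrightarrow> W k \<in> N \<rightarrow>\<^sub>M count_space UNIV"
  shows "simple_function N (occupation W n)"
  using assms
proof (induction n)
  case 0
  have "occupation W 0 = (\<lambda>_. \<chi> k. 1)" by (auto simp: occupation_def fun_eq_iff vec_eq_iff)
  then show ?case by simp
next
  case (Suc n)
  have sW: "simple_function N (W (Suc n))"
    using Suc.prems[of "Suc n"] unfolding simple_function_def by (auto intro: measurable_sets)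
  show ?case
  proof (cases "n = 0")
    case True
    have "occupation W (Suc n) = (\<lambda>w. \<chi> k. (1 + of_bool (w (fst k) = snd k)) / (real CARD('d) + 1)) \<circ> W (Suc n)"
      by (auto simp: True occupation_def fun_eq_iff vec_eq_iff)
    then show ?thesis by (simp only: simple_function_compose[OF sW])
  next
    case False
    have "simple_function N (occupation W n)" using Suc by auto
    then have "simple_function N (\<lambda>\<omega>. (occupation W n \<omega>, W (Suc n) \<omega>))"
      using sW by (rule simple_function_Pair)
    then have "simple_function N ((\<lambda>(x, w). occupation_step n x w) \<circ> (\<lambda>\<omega>. (occupation W n \<omega>, W (Suc n) \<omega>)))"
      by (rule simple_function_compose)
    moreover have "(\<lambda>(x, w). occupation_step n x w) \<circ> (\<lambda>\<omega>. (occupation W n \<omega>, W (Suc n) \<omega>)) = occupation W (Suc n)"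
      using False by (auto simp: fun_eq_iff occupation_Suc)
    ultimately show ?thesis by simp
  qed
qed

lemma (in finite_measure) integrable_simple:
  fixes f :: "'a \<Rightarrow> real"
  assumes "simple_function M f" shows "integrable M f"
proof (rule integrable_const_bound[where B = "Max ((\<lambda>x. norm (f x)) ` space M)"])
  show "AE x in M. norm (f x) \<le> Max ((\<lambda>x. norm (f x)) ` space M)"
    using simple_functionD(1)[OF assms]
    using finite_imageI[of "f ` space M" norm] by (intro AE_I2 Max_ge) (auto simp: image_image)
  show "f \<in> borel_measurable M" using assms by (rule borel_measurable_simple_function)
qed

context interacting_walks
begin

abbreviation X :: "nat \<Rightarrow> 'w \<Rightarrow> real ^ ('m \<times> 'd)" where "X \<equiv> occupation W"
abbreviation H :: "nat \<Rightarrow> 'w measure" where "H \<equiv> history M W"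

lemma history_generators: "{W k -` A \<inter> space M | k A. k \<in> {1..n}} \<subseteq> Pow (space M)"
  by auto

lemma space_history [simp]: "space (H n) = space M"
  unfolding history_def by (rule space_measure_of[OF history_generators])

lemma sets_history: "sets (H n) = sigma_sets (space M) {W k -` A \<inter> space M | k A. k \<in> {1..n}}"
  unfolding history_def by (rule sets_measure_of[OF history_generators])

lemma W_history: "k \<in> {1..n} \<Longrightarrow> W k \<in> H n \<rightarrow>\<^sub>M count_space UNIV"
  by (auto simp: measurable_def sets_history)

lemma subalgebra_history: "subalgebra M (H n)"
proof -
  have "sigma_sets (space M) {W k -` A \<inter> space M | k A. k \<in> {1..n}} \<subseteq> sets M"
    using measurable_W by (intro sets.sigma_sets_subset) (auto intro: measurable_sets)
  then show ?thesis by (simp add: subalgebra_def sets_history)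
qed

lemma sets_history_M: "A \<in> sets (H n) \<Longrightarrow> A \<in> sets M"
  using subalgebra_history[of n] by (auto simp: subalgebra_def)

lemma simple_X_history: "k \<le> n \<Longrightarrow> simple_function (H n) (X k)"
  by (rule simple_function_occupation) (auto intro: W_history)

lemma simple_X: "simple_function M (X k)"
  by (rule simple_function_occupation) (auto intro: measurable_W)

lemma X_event_history: "k \<le> n \<Longrightarrow> {\<omega> \<in> space M. X k \<omega> \<in> S} \<in> sets (H n)"
  using simple_functionD(2)[OF simple_X_history[of k n], of S] by (simp add: vimage_def Int_def conj_commute)

lemma sigma_finite_subalgebra_history: "sigma_finite_subalgebra M (H n)"
proof -
  interpret finite_measure_subalgebra M "H n"
    by unfold_locales (use subalgebra_history emeasure_finite in auto)
  show ?thesis by unfold_locales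
qed

lemma integrable_X: "A \<in> sets M \<Longrightarrow> integrable M (\<lambda>\<omega>. indicator A \<omega> * (g (X n \<omega>) :: real))"
proof -
  assume "A \<in> sets M"
  then have "simple_function M (\<lambda>\<omega>. indicator A \<omega> * g (X n \<omega>))"
    using simple_function_compose[OF simple_X, of g] by (intro simple_function_mult) (auto simp: o_def)
  then show ?thesis by (rule integrable_simple)
qed

text \<open>
  Conditional independence turns the conditional laws of the single walks into the law of their joint position.
\<close>

lemma joint_transition:
  "AE \<omega> in M. cond_probability M (H n) {\<omega> \<in> space M. W (Suc n) \<omega> = w} \<omega> = walk_prob \<alpha> (X n \<omega>) w"
proof -
  let ?E = "\<lambda>i. (\<lambda>\<omega>. W (Suc n) \<omega> i) -` {w i} \<inter> space M"
  have E: "?E i = {\<omega> \<in> space M. W (n + 1) \<omega> i = w i}" for i by auto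
  have "AE \<omega> in M. cond_probability M (H n) (\<Inter>i\<in>UNIV. ?E i) \<omega> = (\<Prod>i\<in>UNIV. cond_probability M (H n) (?E i) \<omega>)"
    using cond_indep[of n] unfolding cond_indep_vars_def
    by (elim conjE allE[of _ UNIV]) (auto dest!: bspec[where x = "\<lambda>i. {w i}"])
  moreover have "(\<Inter>i\<in>UNIV. ?E i) = {\<omega> \<in> space M. W (Suc n) \<omega> = w}" by (auto simp: fun_eq_iff)
  moreover have "AE \<omega> in M. \<forall>i\<in>UNIV. cond_probability M (H n) (?E i) \<omega> = pi_map \<alpha> (X n \<omega>) $ (i, w i)"
    unfolding E using transition[of n] by (intro AE_finite_allI) auto
  ultimately show ?thesis by (auto simp: walk_prob_def)
qed

lemma X_event: "{\<omega> \<in> space M. X n \<omega> \<in> S} \<in> sets M"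
  by (rule sets_history_M[OF X_event_history[OF order_refl]])

lemma W_event: "{\<omega> \<in> space M. W (Suc n) \<omega> = w} \<in> sets M"
  using measurable_sets[OF measurable_W[of "Suc n"], of "{w}"] by (simp add: vimage_def Int_def conj_commute)

lemma transition_integral:
  assumes A: "A \<in> sets (H n)"
  shows "(\<integral>\<omega>. indicator A \<omega> * g (X n \<omega>) * indicator {\<omega> \<in> space M. W (Suc n) \<omega> = w} \<omega> \<partial>M)
    = (\<integral>\<omega>. indicator A \<omega> * (walk_prob \<alpha> (X n \<omega>) w * g (X n \<omega>)) \<partial>M)"
proof -
  interpret S: sigma_finite_subalgebra M "H n" by (rule sigma_finite_subalgebra_history)
  let ?B = "{\<omega> \<in> space M. W (Suc n) \<omega> = w}"
  have B: "?B \<in> sets M" by (rule W_event)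
  have f: "(\<lambda>\<omega>. indicator A \<omega> * g (X n \<omega>) :: real) \<in> borel_measurable (H n)"
    using A borel_measurable_simple_function[OF simple_function_compose[OF simple_X_history[OF order_refl], of n g]]
    by (intro borel_measurable_times borel_measurable_indicator) (auto simp: o_def)
  have "integrable M (\<lambda>\<omega>. indicator (A \<inter> ?B) \<omega> * g (X n \<omega>))"
    using B sets_history_M[OF A] by (intro integrable_X) auto
  then have int: "integrable M (\<lambda>\<omega>. (indicator A \<omega> * g (X n \<omega>)) * indicator ?B \<omega>)"
    by (simp add: indicator_inter_arith mult_ac)
  have "(\<integral>\<omega>. (indicator A \<omega> * g (X n \<omega>)) * indicator ?B \<omega> \<partial>M)
      = (\<integral>\<omega>. (indicator A \<omega> * g (X n \<omega>)) * real_cond_exp M (H n) (indicator ?B) \<omega> \<partial>M)"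
    by (rule S.real_cond_exp_intg(2)[symmetric, OF int f]) (use B in simp)
  also have "\<dots> = (\<integral>\<omega>. indicator A \<omega> * (walk_prob \<alpha> (X n \<omega>) w * g (X n \<omega>)) \<partial>M)"
  proof (rule integral_cong_AE)
    show "(\<lambda>\<omega>. (indicator A \<omega> * g (X n \<omega>)) * real_cond_exp M (H n) (indicator ?B) \<omega>) \<in> borel_measurable M"
      using measurable_from_subalg[OF subalgebra_history f] by measurable
    show "(\<lambda>\<omega>. indicator A \<omega> * (walk_prob \<alpha> (X n \<omega>) w * g (X n \<omega>))) \<in> borel_measurable M"
      by (rule borel_measurable_integrable[OF integrable_X[OF sets_history_M[OF A], where g = "\<lambda>x. walk_prob \<alpha> x w * g x"]])
    show "AE \<omega> in M. (indicator A \<omega> * g (X n \<omega>)) * real_cond_exp M (H n) (indicator ?B) \<omega>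
        = indicator A \<omega> * (walk_prob \<alpha> (X n \<omega>) w * g (X n \<omega>))"
      using joint_transition[of n w] by eventually_elim (simp add: cond_probability_def)
  qed
  finally show ?thesis .
qed

text \<open>
  The Markov property in integrated form. All further statements about the process rest on this identity.
\<close>

lemma tower:
  assumes n: "n \<ge> 1" and A: "A \<in> sets (H n)"
  shows "(\<integral>\<omega>. indicator A \<omega> * (g (X (Suc n) \<omega>) :: real) \<partial>M)
    = (\<integral>\<omega>. indicator A \<omega> * (\<Sum>w\<in>UNIV. walk_prob \<alpha> (X n \<omega>) w * g (occupation_step n (X n \<omega>) w)) \<partial>M)"
proof -
  let ?B = "\<lambda>w. {\<omega> \<in> space M. W (Suc n) \<omega> = w}"
  have B: "?B w \<in> sets M" for w by (rule W_event)
  have int: "integrable M (\<lambda>\<omega>. indicator A \<omega> * g (occupation_step n (X n \<omega>) w) * indicator (?B w) \<omega>)" for w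
  proof -
    have "integrable M (\<lambda>\<omega>. indicator (A \<inter> ?B w) \<omega> * g (occupation_step n (X n \<omega>) w))"
      using B sets_history_M[OF A] by (intro integrable_X[where g = "\<lambda>x. g (occupation_step n x w)"]) auto
    then show ?thesis by (simp add: indicator_inter_arith mult_ac)
  qed
  have "(\<integral>\<omega>. indicator A \<omega> * g (X (Suc n) \<omega>) \<partial>M)
      = (\<integral>\<omega>. (\<Sum>w\<in>UNIV. indicator A \<omega> * g (occupation_step n (X n \<omega>) w) * indicator (?B w) \<omega>) \<partial>M)"
  proof (rule Bochner_Integration.integral_cong[OF refl])
    fix \<omega> assume w: "\<omega> \<in> space M"
    have "(\<Sum>w\<in>UNIV. indicator A \<omega> * g (occupation_step n (X n \<omega>) w) * indicator (?B w) \<omega>)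
       = (\<Sum>w\<in>UNIV. if w = W (Suc n) \<omega> then indicator A \<omega> * g (occupation_step n (X n \<omega>) w) else 0)"
      using w by (intro sum.cong) (auto simp: indicator_def)
    then show "indicator A \<omega> * g (X (Suc n) \<omega>)
      = (\<Sum>w\<in>UNIV. indicator A \<omega> * g (occupation_step n (X n \<omega>) w) * indicator (?B w) \<omega>)"
      by (simp add: sum.delta occupation_Suc[OF n])
  qed
  also have "\<dots> = (\<Sum>w\<in>UNIV. \<integral>\<omega>. indicator A \<omega> * g (occupation_step n (X n \<omega>) w) * indicator (?B w) \<omega> \<partial>M)"
    by (rule Bochner_Integration.integral_sum) (rule int)
  also have "\<dots> = (\<Sum>w\<in>UNIV. \<integral>\<omega>. indicator A \<omega> * (walk_prob \<alpha> (X n \<omega>) w * g (occupation_step n (X n \<omega>) w)) \<partial>M)"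
    by (intro sum.cong refl transition_integral[OF A, where g = "\<lambda>x. g (occupation_step n x _)"])
  also have "\<dots> = (\<integral>\<omega>. (\<Sum>w\<in>UNIV. indicator A \<omega> * (walk_prob \<alpha> (X n \<omega>) w * g (occupation_step n (X n \<omega>) w))) \<partial>M)"
    by (rule Bochner_Integration.integral_sum[symmetric])
      (rule integrable_X[OF sets_history_M[OF A], where g = "\<lambda>x. walk_prob \<alpha> x _ * g (occupation_step n x _)"])
  finally show ?thesis by (simp add: sum_distrib_left)
qed

end

lemma gain_tendsto_zero: "(\<lambda>n. gain TYPE('d::finite) n) \<longlonglongrightarrow> 0"
proof (rule tendsto_sandwich[OF _ _ tendsto_const LIMSEQ_inverse_real_of_nat])
  show "eventually (\<lambda>n. 0 \<le> gain TYPE('d) n) sequentially"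
    by (intro always_eventually allI less_imp_le gain_pos)
  show "eventually (\<lambda>n. gain TYPE('d) n \<le> inverse (real (Suc n))) sequentially"
    by (intro always_eventually allI) (auto simp: gain_def divide_inverse intro!: le_imp_inverse_le)
qed

lemma tendsto_iff_inverse_Suc:
  "x \<longlonglongrightarrow> p \<longleftrightarrow> (\<forall>k. \<exists>N. \<forall>n. n \<ge> N \<longrightarrow> dist (x n) p < inverse (real (Suc k)))"
proof
  assume R: "\<forall>k. \<exists>N. \<forall>n. n \<ge> N \<longrightarrow> dist (x n) p < inverse (real (Suc k))"
  show "x \<longlonglongrightarrow> p" unfolding lim_sequentially
  proof (intro allI impI)
    fix r :: real assume "r > 0"
    then obtain k where k: "inverse (real (Suc k)) < r" using reals_Archimedean by blast
    obtain N where "\<forall>n. n \<ge> N \<longrightarrow> dist (x n) p < inverse (real (Suc k))" using R by blast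
    then show "\<exists>no. \<forall>n\<ge>no. dist (x n) p < r" using k by (intro exI[of _ N]) force
  qed
qed (auto simp: lim_sequentially)

lemma compact_equilibria: "compact (equilibria \<alpha>)"
proof -
  have "equilibria \<alpha> = simplex_product \<inter> (F_field \<alpha> -` {0})" by (auto simp: equilibria_def)
  also have "compact \<dots>"
    by (intro compact_Int_closed compact_simplex closed_vimage continuous_F_field) simp
  finally show ?thesis .
qed

lemma finite_equilibria:
  assumes "\<forall>x \<in> equilibria \<alpha>. x isolated_in equilibria \<alpha>"
  shows "finite (equilibria \<alpha>)"
proof (rule ccontr)
  assume "infinite (equilibria \<alpha>)"
  then obtain x where "x \<in> equilibria \<alpha>" "x islimpt equilibria \<alpha>"
    using Heine_Borel_imp_Bolzano_Weierstrass[OF compact_equilibria, of "equilibria \<alpha>"] by blast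
  then show False using assms isolated_in_islimpt_iff by blast
qed

context interacting_walks
begin

definition conv :: "real ^ ('m \<times> 'd) \<Rightarrow> 'w set" where
  "conv p = {\<omega> \<in> space M. (\<lambda>n. X n \<omega>) \<longlonglongrightarrow> p}"

definition stay :: "(real ^ ('m \<times> 'd)) set \<Rightarrow> nat \<Rightarrow> nat \<Rightarrow> 'w set" where
  "stay N n l = {\<omega> \<in> space M. \<forall>k\<in>{n..l}. X k \<omega> \<in> N}"

definition stay_forever :: "(real ^ ('m \<times> 'd)) set \<Rightarrow> nat \<Rightarrow> 'w set" where
  "stay_forever N n = {\<omega> \<in> space M. \<forall>k\<ge>n. X k \<omega> \<in> N}"

lemma conv_sets [measurable]: "conv p \<in> sets M"
proof -
  have [measurable]: "X n \<in> borel_measurable M" for n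
    by (rule borel_measurable_simple_function[OF simple_X])
  show ?thesis unfolding conv_def tendsto_iff_inverse_Suc by measurable
qed

lemma stay_history: "stay N n l \<in> sets (H l)"
proof -
  have "stay N n l = {\<omega> \<in> space (H l). \<forall>k\<in>{n..l}. X k \<omega> \<in> N}" by (simp add: stay_def)
  also have "\<dots> \<in> sets (H l)"
    by (rule sets.sets_Collect_finite_All) (auto intro: X_event_history)
  finally show ?thesis .
qed

lemma stay_sets: "stay N n l \<in> sets M"
  by (rule sets_history_M[OF stay_history])

lemma stay_forever_eq: "stay_forever N n = (\<Inter>l. stay N n l)"
  by (auto simp: stay_forever_def stay_def) (metis atLeastAtMost_iff order_refl)

lemma stay_forever_sets: "stay_forever N n \<in> sets M"
  unfolding stay_forever_eq using stay_sets by (intro sets.countable_INT) auto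

lemma tower_le:
  assumes n: "n \<ge> 1" and A: "A \<in> sets (H n)" "\<And>\<omega>. \<omega> \<in> A \<Longrightarrow> X n \<omega> \<in> S"
    and le: "\<And>x. x \<in> simplex_product \<Longrightarrow> x \<in> S \<Longrightarrow>
      (\<Sum>w\<in>UNIV. walk_prob \<alpha> x w * g (occupation_step n x w)) \<le> k x"
  shows "(\<integral>\<omega>. indicator A \<omega> * (g (X (Suc n) \<omega>) :: real) \<partial>M) \<le> (\<integral>\<omega>. indicator A \<omega> * k (X n \<omega>) \<partial>M)"
  unfolding tower[OF n A(1), of g]
proof (rule integral_mono)
  show "integrable M (\<lambda>\<omega>. indicator A \<omega> * k (X n \<omega>))"
    by (rule integrable_X[OF sets_history_M[OF A(1)]])
  show "integrable M (\<lambda>\<omega>. indicator A \<omega> * (\<Sum>w\<in>UNIV. walk_prob \<alpha> (X n \<omega>) w * g (occupation_step n (X n \<omega>) w)))"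
    by (rule integrable_X[OF sets_history_M[OF A(1)], where g = "\<lambda>x. \<Sum>w\<in>UNIV. walk_prob \<alpha> x w * g (occupation_step n x w)"])
  show "indicator A \<omega> * (\<Sum>w\<in>UNIV. walk_prob \<alpha> (X n \<omega>) w * g (occupation_step n (X n \<omega>) w))
      \<le> indicator A \<omega> * k (X n \<omega>)" for \<omega>
    using le[OF occupation_in_simplex[OF n, of W \<omega>] A(2)[of \<omega>]] by (cases "\<omega> \<in> A") auto
qed

section \<open>Convergence to equilibria\<close>

text \<open>
  The mean of the Lyapunov function is bounded and decreases in each step by \<open>gain n\<close> times the mean of
  \<open>|F|\<^sup>2\<close>, up to a summable error. Hence the sum of \<open>gain n * |F (X n)|\<^sup>2\<close> has a finite mean and is finite almost
  surely. The values \<open>|F (X n)|\<^sup>2\<close> change slowly, so they tend to zero.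
\<close>

lemma AE_F_tendsto_zero:
  assumes sym: "\<And>v i j. \<alpha> v i j = \<alpha> v j i"
  shows "AE \<omega> in M. (\<lambda>n. F_field \<alpha> (X n \<omega>)) \<longlonglongrightarrow> 0"
proof -
  obtain C where C: "C \<ge> 0" "\<And>n x. x \<in> simplex_product \<Longrightarrow>
     (\<Sum>w\<in>UNIV. walk_prob \<alpha> x w * lyapunov \<alpha> (occupation_step n x w))
       \<le> lyapunov \<alpha> x - gain TYPE('d) n * (norm (F_field \<alpha> x))\<^sup>2 + C * (gain TYPE('d) n)\<^sup>2"
    using lyapunov_drift[of \<alpha>, OF sym] by blast
  have "C11_on simplex_product (lyapunov \<alpha>) (dlyapunov \<alpha>)"
    by (intro C11_lyapunov compact_imp_bounded compact_simplex sym)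
  then obtain B where B: "B \<ge> 0" "\<And>x. x \<in> simplex_product \<Longrightarrow> \<bar>lyapunov \<alpha> x\<bar> \<le> B"
    using C11_on_bounded by blast
  define e where "e n = (\<integral>\<omega>. indicator (space M) \<omega> * lyapunov \<alpha> (X n \<omega>) \<partial>M)" for n
  define f where "f n = (\<integral>\<omega>. indicator (space M) \<omega> * (norm (F_field \<alpha> (X n \<omega>)))\<^sup>2 \<partial>M)" for n
  have int: "integrable M (\<lambda>\<omega>. indicator (space M) \<omega> * g (X n \<omega>))" for g :: "_ \<Rightarrow> real" and n
    by (rule integrable_X) simp
  have f_nonneg: "f n \<ge> 0" for n unfolding f_def by (intro Bochner_Integration.integral_nonneg) auto
  have step: "e (Suc n) \<le> e n - gain TYPE('d) n * f n + C * (gain TYPE('d) n)\<^sup>2" if n: "n \<ge> 1" for n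
  proof -
    have "e (Suc n) \<le> (\<integral>\<omega>. indicator (space M) \<omega> * (lyapunov \<alpha> (X n \<omega>) -
        gain TYPE('d) n * (norm (F_field \<alpha> (X n \<omega>)))\<^sup>2 + C * (gain TYPE('d) n)\<^sup>2) \<partial>M)"
      unfolding e_def by (rule tower_le[OF n, where S = UNIV]) (use C sets.top[of "H n"] in auto)
    also have "\<dots> = (\<integral>\<omega>. indicator (space M) \<omega> * lyapunov \<alpha> (X n \<omega>) -
        gain TYPE('d) n * (indicator (space M) \<omega> * (norm (F_field \<alpha> (X n \<omega>)))\<^sup>2) + C * (gain TYPE('d) n)\<^sup>2 \<partial>M)"
      by (intro Bochner_Integration.integral_cong refl) (simp add: algebra_simps)
    also have "\<dots> = e n - gain TYPE('d) n * f n + C * (gain TYPE('d) n)\<^sup>2"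
      unfolding e_def f_def using int[of "lyapunov \<alpha>" n] int[of "\<lambda>x. (norm (F_field \<alpha> x))\<^sup>2" n]
      by (simp add: prob_space)
    finally show ?thesis .
  qed
  have e_bound: "\<bar>e n\<bar> \<le> B" if n: "n \<ge> 1" for n
  proof -
    have "\<bar>e n\<bar> \<le> (\<integral>\<omega>. norm (indicator (space M) \<omega> * lyapunov \<alpha> (X n \<omega>)) \<partial>M)"
      unfolding e_def using integral_norm_bound[of M "\<lambda>\<omega>. indicator (space M) \<omega> * lyapunov \<alpha> (X n \<omega>)"] by simp
    also have "\<dots> \<le> (\<integral>\<omega>. B \<partial>M)"
      by (intro integral_mono integrable_norm int) (use B occupation_in_simplex[OF n, of W] in \<open>auto simp: abs_mult indicator_def\<close>)
    finally show ?thesis by (simp add: prob_space)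
  qed
  have partial: "(\<Sum>k<l. gain TYPE('d) (Suc k) * f (Suc k)) \<le> 2 * B + C" for l
  proof -
    have "(\<Sum>k<l. gain TYPE('d) (Suc k) * f (Suc k)) \<le> (\<Sum>k<l. (e (Suc k) - e (Suc (Suc k))) + C * (gain TYPE('d) (Suc k))\<^sup>2)"
    proof (intro sum_mono)
      show "gain TYPE('d) (Suc k) * f (Suc k) \<le> (e (Suc k) - e (Suc (Suc k))) + C * (gain TYPE('d) (Suc k))\<^sup>2" for k
        using step[of "Suc k"] by simp
    qed
    also have "\<dots> = (e (Suc 0) - e (Suc l)) + C * (\<Sum>k<l. (gain TYPE('d) (Suc k))\<^sup>2)"
      using sum_lessThan_telescope'[of "\<lambda>k. e (Suc k)" l] by (simp add: sum.distrib sum_distrib_left)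
    also have "\<dots> \<le> 2 * B + C * 1"
    proof (intro add_mono mult_left_mono C)
      show "e (Suc 0) - e (Suc l) \<le> 2 * B" using e_bound[of "Suc 0"] e_bound[of "Suc l"] by simp
      have "(\<Sum>k<l. (gain TYPE('d) (Suc k))\<^sup>2) = (\<Sum>k = 1..<Suc l. (gain TYPE('d) k)\<^sup>2)"
        using sum.shift_bounds_Suc_ivl[of "\<lambda>k. (gain TYPE('d) k)\<^sup>2" 0 l] by (simp add: atLeast0LessThan)
      also have "\<dots> \<le> 1 / (real CARD('d) + real 1)" by (rule sum_gain_square_le)
      also have "\<dots> \<le> 1" by simp
      finally show "(\<Sum>k<l. (gain TYPE('d) (Suc k))\<^sup>2) \<le> 1" .
    qed
    finally show ?thesis by simp
  qed
  have summ: "summable (\<lambda>k. gain TYPE('d) (Suc k) * f (Suc k))"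
    by (rule summableI_nonneg_bounded[OF _ partial]) (intro mult_nonneg_nonneg less_imp_le[OF gain_pos] f_nonneg)
  define u where "u k \<omega> = gain TYPE('d) (Suc k) * (indicator (space M) \<omega> * (norm (F_field \<alpha> (X (Suc k) \<omega>)))\<^sup>2)" for k \<omega>
  have u_nonneg: "u k \<omega> \<ge> 0" for k \<omega>
    unfolding u_def by (intro mult_nonneg_nonneg less_imp_le[OF gain_pos]) auto
  have u_int: "integrable M (u k)" for k
    unfolding u_def by (intro integrable_mult_right int[of "\<lambda>x. (norm (F_field \<alpha> x))\<^sup>2"])
  have u_meas [measurable]: "u k \<in> borel_measurable M" for k using u_int by (rule borel_measurable_integrable)
  have "(\<integral>\<^sup>+\<omega>. (\<Sum>k. ennreal (u k \<omega>)) \<partial>M) = (\<Sum>k. \<integral>\<^sup>+\<omega>. ennreal (u k \<omega>) \<partial>M)"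
    by (rule nn_integral_suminf) measurable
  also have "\<dots> = (\<Sum>k. ennreal (gain TYPE('d) (Suc k) * f (Suc k)))"
  proof (intro suminf_cong)
    fix k
    have "(\<integral>\<^sup>+\<omega>. ennreal (u k \<omega>) \<partial>M) = ennreal (\<integral>\<omega>. u k \<omega> \<partial>M)"
      by (rule nn_integral_eq_integral[OF u_int]) (simp add: u_nonneg)
    also have "(\<integral>\<omega>. u k \<omega> \<partial>M) = gain TYPE('d) (Suc k) * f (Suc k)"
      unfolding u_def f_def by (rule integral_mult_right_zero)
    finally show "(\<integral>\<^sup>+\<omega>. ennreal (u k \<omega>) \<partial>M) = ennreal (gain TYPE('d) (Suc k) * f (Suc k))" .
  qed
  also have "\<dots> = ennreal (\<Sum>k. gain TYPE('d) (Suc k) * f (Suc k))"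
    by (rule suminf_ennreal2[OF _ summ]) (intro mult_nonneg_nonneg less_imp_le[OF gain_pos] f_nonneg)
  finally have "(\<integral>\<^sup>+\<omega>. (\<Sum>k. ennreal (u k \<omega>)) \<partial>M) \<noteq> \<infinity>" by simp
  then have "AE \<omega> in M. (\<Sum>k. ennreal (u k \<omega>)) \<noteq> \<infinity>"
    by (rule nn_integral_noteq_infinite[rotated]) measurable
  moreover have "bounded (simplex_product :: (real ^ ('m \<times> 'd)) set)"
    by (intro compact_imp_bounded compact_simplex)
  then obtain L where L: "L \<ge> 0"
    "\<And>x y. x \<in> simplex_product \<Longrightarrow> y \<in> simplex_product \<Longrightarrow> norm (F_field \<alpha> y - F_field \<alpha> x) \<le> L * norm (y - x)"
    using C11_vec_on_norm_bounds[OF C11_F_field] by metis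
  (* on almost every path the weighted sum is finite, and the slow variation applies *)
  show ?thesis
    using calculation AE_space
  proof (eventually_elim, goal_cases)
    case (1 \<omega>)
    show ?case
    proof -
      have True: "\<omega> \<in> space M" using 1 by simp
      define m where "m = real CARD('m)"
      define a where "a k = (norm (F_field \<alpha> (X (Suc k) \<omega>)))\<^sup>2" for k
      have D: "X (Suc k) \<omega> \<in> simplex_product" for k by (rule occupation_in_simplex) simp
      have "summable (\<lambda>k. u k \<omega>)" by (rule summable_suminf_not_top) (use u_nonneg 1 in auto)
      then have sum: "summable (\<lambda>k. gain TYPE('d) (Suc k) * a k)" using True by (simp add: u_def a_def)
      have nF: "norm (F_field \<alpha> x) \<le> 2 * m" if "x \<in> simplex_product" for x
        using simplex_diff_norm[OF pi_map_in_simplex that] by (simp add: F_field_def m_def)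
      have "a \<longlonglongrightarrow> 0"
      proof (rule slow_summable_tendsto_zero[OF _ _ _ _ _ _ sum])
        show "\<not> summable (\<lambda>k. gain TYPE('d) (Suc k))" using not_summable_gain[where 'd = 'd] by (simp add: summable_Suc_iff)
        show "summable (\<lambda>k. (gain TYPE('d) (Suc k))\<^sup>2)"
          using summable_gain_square[where 'd = 'd] by (simp only: summable_Suc_iff[of "\<lambda>k. (gain TYPE('d) k)\<^sup>2"])
        show "\<bar>a (Suc k) - a k\<bar> \<le> (L * (2 * m) * (4 * m)) * gain TYPE('d) (Suc k)" for k
        proof -
          define s t where "s = norm (F_field \<alpha> (X (Suc (Suc k)) \<omega>))" and "t = norm (F_field \<alpha> (X (Suc k) \<omega>))"
          have st: "s \<le> 2 * m" "t \<le> 2 * m" "s \<ge> 0" "t \<ge> 0" using nF[OF D] by (auto simp: s_def t_def)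
          have "\<bar>s - t\<bar> \<le> L * norm (X (Suc (Suc k)) \<omega> - X (Suc k) \<omega>)"
            unfolding s_def t_def using norm_triangle_ineq3 L(2)[OF D D] order_trans by blast
          also have "\<dots> \<le> L * (2 * m * gain TYPE('d) (Suc k))"
            unfolding m_def using L(1) by (intro mult_left_mono occupation_increment) auto
          finally have 1: "\<bar>s - t\<bar> \<le> L * (2 * m * gain TYPE('d) (Suc k))" .
          have "\<bar>a (Suc k) - a k\<bar> = \<bar>s - t\<bar> * (s + t)"
            using st by (simp add: a_def s_def[symmetric] t_def[symmetric] power2_eq_square square_diff_square_factored abs_mult mult.commute)
          also have "\<dots> \<le> (L * (2 * m * gain TYPE('d) (Suc k))) * (4 * m)"
            using 1 st by (intro mult_mono) auto
          finally show ?thesis by (simp add: mult_ac)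
        qed
        show "L * (2 * m) * (4 * m) \<ge> 0" using L by (simp add: m_def)
      qed (auto simp: a_def less_imp_le[OF gain_pos])
      then have "(\<lambda>k. sqrt (a k)) \<longlonglongrightarrow> sqrt 0" by (rule tendsto_real_sqrt)
      then have "(\<lambda>k. norm (F_field \<alpha> (X (Suc k) \<omega>))) \<longlonglongrightarrow> 0" by (simp add: a_def)
      then have "(\<lambda>k. F_field \<alpha> (X (Suc k) \<omega>)) \<longlonglongrightarrow> 0" by (rule tendsto_norm_zero_cancel)
      then show ?thesis by (rule LIMSEQ_imp_Suc)
    qed
  qed
qed


lemma AE_converges_to_equilibrium:
  assumes sym: "\<And>v i j. \<alpha> v i j = \<alpha> v j i" and fin: "finite (equilibria \<alpha>)"
  shows "AE \<omega> in M. \<exists>p\<in>equilibria \<alpha>. (\<lambda>n. X n \<omega>) \<longlonglongrightarrow> p"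
  using AE_F_tendsto_zero[OF sym]
proof eventually_elim
  case (elim \<omega>)
  have "\<exists>p\<in>simplex_product. F_field \<alpha> p = 0 \<and> (\<lambda>n. X n \<omega>) \<longlonglongrightarrow> p"
  proof (rule tendsto_finite_zero_set[OF compact_simplex continuous_F_field _ elim])
    show "eventually (\<lambda>n. X n \<omega> \<in> simplex_product) sequentially"
      using eventually_ge_at_top[of 1] by eventually_elim (rule occupation_in_simplex)
    show "finite {y \<in> simplex_product. F_field \<alpha> y = 0}" using fin by (simp add: equilibria_def)
    show "(\<lambda>n. dist (X (Suc n) \<omega>) (X n \<omega>)) \<longlonglongrightarrow> 0"
    proof (rule tendsto_sandwich[OF _ _ tendsto_const])
      show "eventually (\<lambda>n. dist (X (Suc n) \<omega>) (X n \<omega>) \<le> 2 * real CARD('m) * gain TYPE('d) n) sequentially"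
        using eventually_ge_at_top[of 1]
        by eventually_elim (simp only: dist_norm occupation_increment)
      show "(\<lambda>n. 2 * real CARD('m) * gain TYPE('d) n) \<longlonglongrightarrow> 0"
        by (rule tendsto_mult_right_zero[OF gain_tendsto_zero])
    qed simp
  qed
  then show ?case by (auto simp: equilibria_def)
qed

text \<open>
  If \<open>p\<close> is the only equilibrium in a closed ball, a path that remains in it has no other possible limit point.
\<close>

lemma AE_stay_forever_converges:
  assumes sym: "\<And>v i j. \<alpha> v i j = \<alpha> v j i" and p: "p \<in> equilibria \<alpha>"
    and iso: "\<And>x. x \<in> equilibria \<alpha> \<Longrightarrow> x \<in> cball p \<epsilon> \<Longrightarrow> x = p" and N: "N \<inter> simplex_product \<subseteq> cball p \<epsilon>"
  shows "AE \<omega> in M. \<omega> \<in> stay_forever N n \<longrightarrow> \<omega> \<in> conv p"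
  using AE_F_tendsto_zero[OF sym]
proof eventually_elim
  case (elim \<omega>)
  show ?case
  proof
    assume st: "\<omega> \<in> stay_forever N n"
    have "(\<lambda>n. X n \<omega>) \<longlonglongrightarrow> p"
      unfolding tendsto_iff
    proof (intro allI impI)
      fix e :: real assume e: "e > 0"
      have "eventually (\<lambda>n. X n \<omega> \<in> ball p e) sequentially"
      proof (rule zero_set_attracts[OF _ continuous_F_field _ elim])
        show "compact (simplex_product \<inter> cball p \<epsilon>)"
          by (intro compact_Int compact_simplex compact_cball)
        show "eventually (\<lambda>n. X n \<omega> \<in> simplex_product \<inter> cball p \<epsilon>) sequentially"
          using eventually_ge_at_top[of "max 1 n"]
        proof eventually_elim
          case (elim k)
          then have "X k \<omega> \<in> N" "X k \<omega> \<in> simplex_product"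
            using st occupation_in_simplex[of k W \<omega>] by (auto simp: stay_forever_def)
          then show ?case using N by blast
        qed
        show "{y \<in> simplex_product \<inter> cball p \<epsilon>. F_field \<alpha> y = 0} \<subseteq> ball p e"
        proof
          fix y assume "y \<in> {y \<in> simplex_product \<inter> cball p \<epsilon>. F_field \<alpha> y = 0}"
          then have "y = p" by (intro iso) (auto simp: equilibria_def)
          then show "y \<in> ball p e" using e by simp
        qed
      qed simp
      then show "eventually (\<lambda>n. dist (X n \<omega>) p < e) sequentially" by (simp add: dist_commute)
    qed
    then show "\<omega> \<in> conv p" using st by (simp add: conv_def stay_forever_def)
  qed
qed

lemma prob_stay_forever:
  assumes A: "A \<in> sets M"
  shows "(\<lambda>l. prob (A \<inter> stay N n l)) \<longlonglongrightarrow> prob (A \<inter> stay_forever N n)"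
proof -
  have "decseq (\<lambda>l. A \<inter> stay N n l)" by (auto simp: decseq_def stay_def)
  then have "(\<lambda>l. prob (A \<inter> stay N n l)) \<longlonglongrightarrow> prob (\<Inter>l. A \<inter> stay N n l)"
    using A stay_sets by (intro finite_Lim_measure_decseq) auto
  moreover have "(\<Inter>l. A \<inter> stay N n l) = A \<inter> stay_forever N n" by (auto simp: stay_forever_eq)
  ultimately show ?thesis by (simp only:)
qed

section \<open>Linearly stable equilibria\<close>

lemma next_position_prob_pos:
  assumes A: "A \<in> sets (H n)" and pos: "prob A > 0"
  shows "prob (A \<inter> {\<omega> \<in> space M. W (Suc n) \<omega> = w}) > 0"
proof -
  let ?B = "{\<omega> \<in> space M. W (Suc n) \<omega> = w}"
  have AM: "A \<in> sets M" by (rule sets_history_M[OF A])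
  have B: "?B \<in> sets M" by (rule W_event)
  have "prob (A \<inter> ?B) = (\<integral>\<omega>. indicator (A \<inter> ?B) \<omega> \<partial>M)" using AM B by simp
  also have "\<dots> = (\<integral>\<omega>. indicator A \<omega> * (\<lambda>_. 1) (X n \<omega>) * indicator ?B \<omega> \<partial>M)"
    by (simp add: indicator_inter_arith)
  also have "\<dots> = (\<integral>\<omega>. indicator A \<omega> * (walk_prob \<alpha> (X n \<omega>) w * 1) \<partial>M)"
    using transition_integral[OF A, where g = "\<lambda>_. 1" and w = w] by simp
  finally have eq: "prob (A \<inter> ?B) = (\<integral>\<omega>. indicator A \<omega> * walk_prob \<alpha> (X n \<omega>) w \<partial>M)" by simp
  have int: "integrable M (\<lambda>\<omega>. indicator A \<omega> * walk_prob \<alpha> (X n \<omega>) w)"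
    by (rule integrable_X[OF AM, where g = "\<lambda>x. walk_prob \<alpha> x w"])
  have nonneg: "0 \<le> indicator A \<omega> * walk_prob \<alpha> (X n \<omega>) w" for \<omega>
    by (simp add: less_imp_le[OF walk_prob_pos])
  show ?thesis
  proof (rule ccontr)
    assume "\<not> ?thesis"
    then have "(\<integral>\<omega>. indicator A \<omega> * walk_prob \<alpha> (X n \<omega>) w \<partial>M) = 0"
      using eq measure_nonneg[of M "A \<inter> ?B"] by linarith
    then have "AE \<omega> in M. indicator A \<omega> * walk_prob \<alpha> (X n \<omega>) w = 0"
      using integral_nonneg_eq_0_iff_AE[OF int] nonneg by simp
    then have "AE \<omega> in M. \<omega> \<notin> A"
      by eventually_elim (use walk_prob_pos in \<open>auto simp: indicator_def less_le split: if_splits\<close>)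
    then have "prob A = 0" using AM by (simp add: prob_eq_0)
    then show False using pos by simp
  qed
qed

text \<open>
  For each walk some vertex \<open>v\<close> has a number of visits \<open>S\<close> with \<open>S + 1 \<le> (d + n + 1) * p $ (i, v)\<close>; otherwise
  summation over \<open>v\<close> would give \<open>n + d > d + n + 1\<close>. Always moving to such a vertex keeps all visit numbers below
  \<open>(d + n) * p\<close>, and every finite path has positive probability.
\<close>

lemma steering_path:
  assumes p: "p \<in> (simplex_product :: (real ^ ('m \<times> 'd)) set)"
  shows "\<exists>c. (\<forall>i v. (\<Sum>k = 1..n. of_bool (c k i = v)) \<le> (real CARD('d) + real n) * p $ (i, v)) \<and>
     {\<omega> \<in> space M. \<forall>k\<in>{1..n}. W k \<omega> = c k} \<in> sets (H n) \<and>
     prob {\<omega> \<in> space M. \<forall>k\<in>{1..n}. W k \<omega> = c k} > 0"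
proof (induction n)
  case 0
  have "{\<omega> \<in> space M. \<forall>k\<in>{1..0::nat}. W k \<omega> = c k} = space M" for c by auto
  then show ?case using sets.top[of "H 0"] simplex_nonneg[OF p] by (simp add: prob_space)
next
  case (Suc n)
  then obtain c where c: "\<And>i v. (\<Sum>k = 1..n. of_bool (c k i = v)) \<le> (real CARD('d) + real n) * p $ (i, v)"
    "{\<omega> \<in> space M. \<forall>k\<in>{1..n}. W k \<omega> = c k} \<in> sets (H n)"
    "prob {\<omega> \<in> space M. \<forall>k\<in>{1..n}. W k \<omega> = c k} > 0" by blast
  define S where "S i v = (\<Sum>k = 1..n. of_bool (c k i = v) :: real)" for i v
  define t where "t = real CARD('d) + real (Suc n)"
  have "\<exists>v. S i v + 1 \<le> t * p $ (i, v)" for i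
  proof (rule ccontr)
    assume "\<not> ?thesis"
    then have less: "t * p $ (i, v) < S i v + 1" for v by (simp add: not_le)
    have "t = (\<Sum>v\<in>UNIV. t * p $ (i, v))" by (simp add: sum_distrib_left[symmetric] simplex_block_sum[OF p])
    also have "\<dots> < (\<Sum>v\<in>UNIV. S i v + 1)" by (intro sum_strict_mono less) auto
    also have "\<dots> = real n + real CARD('d)"
      by (simp add: S_def sum.distrib sum.swap[of _ _ UNIV] of_bool_def sum.delta)
    finally show False by (simp add: t_def)
  qed
  then obtain w where w: "\<And>i. S i (w i) + 1 \<le> t * p $ (i, w i)" by metis
  define c' where "c' = c(Suc n := w)"
  have ev: "{\<omega> \<in> space M. \<forall>k\<in>{1..Suc n}. W k \<omega> = c' k}
    = {\<omega> \<in> space M. \<forall>k\<in>{1..n}. W k \<omega> = c k} \<inter> {\<omega> \<in> space M. W (Suc n) \<omega> = w}"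
    by (auto simp: c'_def atLeastAtMostSuc_conv)
  show ?case
  proof (intro exI[of _ c'] conjI allI)
    fix i v
    have "(\<Sum>k = 1..Suc n. of_bool (c' k i = v)) = S i v + of_bool (w i = v)"
      by (simp add: S_def c'_def)
    also have "\<dots> \<le> t * p $ (i, v)"
    proof (cases "w i = v")
      case True then show ?thesis using w[of i] by auto
    next
      case False
      have "(real CARD('d) + real n) * p $ (i, v) \<le> t * p $ (i, v)"
        using simplex_nonneg[OF p] by (intro mult_right_mono) (auto simp: t_def)
      then show ?thesis using False c(1)[of i v] by (simp add: S_def)
    qed
    finally show "(\<Sum>k = 1..Suc n. of_bool (c' k i = v)) \<le> (real CARD('d) + real (Suc n)) * p $ (i, v)"
      by (simp add: t_def)
  next
    have "{\<omega> \<in> space (H (Suc n)). \<forall>k\<in>{1..Suc n}. W k \<omega> = c' k} \<in> sets (H (Suc n))"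
    proof (rule sets.sets_Collect_finite_All)
      fix k assume "k \<in> {1..Suc n}"
      then show "{\<omega> \<in> space (H (Suc n)). W k \<omega> = c' k} \<in> sets (H (Suc n))"
        using measurable_sets[OF W_history[of k "Suc n"], of "{c' k}"] by (simp add: vimage_def Int_def conj_commute)
    qed simp
    then show "{\<omega> \<in> space M. \<forall>k\<in>{1..Suc n}. W k \<omega> = c' k} \<in> sets (H (Suc n))" by simp
    show "prob {\<omega> \<in> space M. \<forall>k\<in>{1..Suc n}. W k \<omega> = c' k} > 0"
      unfolding ev by (rule next_position_prob_pos[OF c(2,3)])
  qed
qed

text \<open>
  An upper bound of order \<open>1 / n\<close> on all coordinates of \<open>X n - p\<close> gives a lower bound too, as they sum to zero
  in each block.
\<close>

lemma steering:
  assumes p: "p \<in> (simplex_product :: (real ^ ('m \<times> 'd)) set)" and n: "n \<ge> 1"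
  obtains A where "A \<in> sets (H n)" "prob A > 0"
    "\<And>\<omega>. \<omega> \<in> A \<Longrightarrow> norm (X n \<omega> - p) \<le> real CARD('m \<times> 'd) * (real CARD('d) / (real CARD('d) + real n))"
proof -
  obtain c where c: "\<And>i v. (\<Sum>k = 1..n. of_bool (c k i = v)) \<le> (real CARD('d) + real n) * p $ (i, v)"
    "{\<omega> \<in> space M. \<forall>k\<in>{1..n}. W k \<omega> = c k} \<in> sets (H n)"
    "prob {\<omega> \<in> space M. \<forall>k\<in>{1..n}. W k \<omega> = c k} > 0" using steering_path[OF p, of n] by blast
  define t where "t = real CARD('d) + real n"
  have t: "t > 0" using n by (simp add: t_def)
  show ?thesis
  proof (rule that[OF c(2,3)])
    fix \<omega> assume w: "\<omega> \<in> {\<omega> \<in> space M. \<forall>k\<in>{1..n}. W k \<omega> = c k}"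
    let ?x = "X n \<omega>"
    have D: "?x \<in> simplex_product" by (rule occupation_in_simplex[OF n])
    have up: "?x $ (i, v) - p $ (i, v) \<le> 1 / t" for i v
    proof -
      have "(\<Sum>k = 1..n. of_bool (W k \<omega> i = v)) = (\<Sum>k = 1..n. of_bool (c k i = v) :: real)"
        by (intro sum.cong) (use w in auto)
      then have "?x $ (i, v) = (1 + (\<Sum>k = 1..n. of_bool (c k i = v))) / t"
        using n by (simp add: occupation_def t_def)
      also have "\<dots> \<le> (1 + t * p $ (i, v)) / t"
        using c(1)[of i v] t by (intro divide_right_mono) (auto simp: t_def)
      also have "\<dots> = 1 / t + p $ (i, v)" using t by (simp add: field_simps)
      finally show ?thesis by simp
    qed
    have low: "p $ (i, v) - ?x $ (i, v) \<le> real CARD('d) / t" for i v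
    proof -
      have "p $ (i, v) - ?x $ (i, v) = (\<Sum>u\<in>UNIV - {v}. ?x $ (i, u) - p $ (i, u))"
        using simplex_block_sum[OF D, of i] simplex_block_sum[OF p, of i]
        by (simp add: sum_subtractf sum.remove[of UNIV v])
      also have "\<dots> \<le> (\<Sum>u\<in>UNIV - {v}. 1 / t)" by (intro sum_mono up)
      also have "\<dots> \<le> (\<Sum>u\<in>(UNIV :: 'd set). 1 / t)" using t by (intro sum_mono2) auto
      finally show ?thesis by simp
    qed
    have "\<bar>(?x - p) $ k\<bar> \<le> real CARD('d) / t" for k
    proof -
      obtain i v where k: "k = (i, v)" by fastforce
      have "1 / t \<le> real CARD('d) / t" using t by (intro divide_right_mono) (auto simp: Suc_le_eq)
      then show ?thesis using up[of i v] low[of i v] by (simp add: k abs_le_iff)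
    qed
    then have "(\<Sum>k\<in>UNIV. \<bar>(?x - p) $ k\<bar>) \<le> (\<Sum>k\<in>(UNIV :: ('m \<times> 'd) set). real CARD('d) / t)"
      by (intro sum_mono)
    then show "norm (?x - p) \<le> real CARD('m \<times> 'd) * (real CARD('d) / (real CARD('d) + real n))"
      using norm_le_l1_cart[of "?x - p"] by (simp add: t_def)
  qed
qed

lemma history_mono:
  assumes "n \<le> l" "A \<in> sets (H n)"
  shows "A \<in> sets (H l)"
proof -
  have "{W k -` A \<inter> space M | k A. k \<in> {1..n}} \<subseteq> {W k -` A \<inter> space M | k A. k \<in> {1..l}}"
  proof
    fix S assume "S \<in> {W k -` A \<inter> space M | k A. k \<in> {1..n}}"
    then obtain k B where kB: "S = W k -` B \<inter> space M" "k \<in> {1..n}" by blast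
    then have "k \<in> {1..l}" using assms(1) by simp
    with kB(1) show "S \<in> {W k -` A \<inter> space M | k A. k \<in> {1..l}}" by blast
  qed
  then have "sets (H n) \<subseteq> sets (H l)"
    unfolding sets_history by (rule sigma_sets_mono')
  then show ?thesis using assms(2) by blast
qed

text \<open>
  The mean of \<open>r - q (X l)\<close> over the paths that have not left \<open>{x. q x < r}\<close> decreases by at most the sum of
  the errors \<open>C * (gain l)\<^sup>2\<close>: paths that leave have a nonpositive value and may be dropped. The sum of these
  errors from time \<open>n\<close> on is at most of order \<open>1 / n\<close>.
\<close>

lemma stay_prob_lower_bound:
  fixes q :: "real ^ ('m \<times> 'd) \<Rightarrow> real"
  assumes n: "n \<ge> 1" and A: "A \<in> sets (H n)" and start: "\<And>\<omega>. \<omega> \<in> A \<Longrightarrow> q (X n \<omega>) \<le> s" and sr: "s < r"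
    and nonneg: "\<And>x. x \<in> simplex_product \<Longrightarrow> 0 \<le> q x" and C: "C \<ge> 0"
    and drift: "\<And>k x. x \<in> simplex_product \<Longrightarrow> q x < r \<Longrightarrow>
       (\<Sum>w\<in>UNIV. walk_prob \<alpha> x w * q (occupation_step k x w)) \<le> q x + C * (gain TYPE('d) k)\<^sup>2"
    and l: "l \<ge> n"
  shows "prob A * (r - s - C / (real CARD('d) + real n)) \<le> r * prob (A \<inter> stay {x. q x < r} n l)"
proof -
  define N where "N = {x :: real ^ ('m \<times> 'd). q x < r}"
  define e where "e l = (\<integral>\<omega>. indicator (A \<inter> stay N n l) \<omega> * (r - q (X l \<omega>)) \<partial>M)" for l
  have AM: "A \<in> sets M" by (rule sets_history_M[OF A])
  have AN: "A \<inter> stay N n l \<in> sets M" for l using AM stay_sets by auto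
  have step_e: "e l - C * (gain TYPE('d) l)\<^sup>2 * prob A \<le> e (Suc l)" if l: "l \<ge> n" for l
  proof -
    let ?A = "A \<inter> stay N n l"
    have Ah: "?A \<in> sets (H l)" using history_mono[OF l A] stay_history by auto
    have int: "integrable M (\<lambda>\<omega>. indicator ?A \<omega> * g (X k \<omega>))" for g :: "_ \<Rightarrow> real" and k
      by (rule integrable_X[OF AN])
    have "(\<integral>\<omega>. indicator ?A \<omega> * (q (X (Suc l) \<omega>) - r) \<partial>M)
        \<le> (\<integral>\<omega>. indicator ?A \<omega> * (q (X l \<omega>) - r + C * (gain TYPE('d) l)\<^sup>2) \<partial>M)"
    proof (rule tower_le[where S = N])
      show "l \<ge> 1" using n l by simp
      show "X l \<omega> \<in> N" if "\<omega> \<in> ?A" for \<omega> using that l by (auto simp: stay_def)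
      show "(\<Sum>w\<in>UNIV. walk_prob \<alpha> x w * (q (occupation_step l x w) - r)) \<le> q x - r + C * (gain TYPE('d) l)\<^sup>2"
        if "x \<in> simplex_product" "x \<in> N" for x
        using drift[OF that(1), of l] that(2)
        by (simp add: N_def right_diff_distrib sum_subtractf sum_distrib_right[symmetric] walk_prob_sum)
    qed (rule Ah)
    also have "\<dots> = (\<integral>\<omega>. C * (gain TYPE('d) l)\<^sup>2 * indicator ?A \<omega> - indicator ?A \<omega> * (r - q (X l \<omega>)) \<partial>M)"
      by (intro Bochner_Integration.integral_cong refl) (simp add: algebra_simps)
    also have "\<dots> = C * (gain TYPE('d) l)\<^sup>2 * prob ?A - e l"
      unfolding e_def using int[of "\<lambda>x. r - q x" l] AN[of l] by (simp add: emeasure_eq_measure)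
    also have "\<dots> \<le> C * (gain TYPE('d) l)\<^sup>2 * prob A - e l"
      using C AM by (intro diff_right_mono mult_left_mono finite_measure_mono) auto
    finally have 1: "(\<integral>\<omega>. indicator ?A \<omega> * (q (X (Suc l) \<omega>) - r) \<partial>M) \<le> C * (gain TYPE('d) l)\<^sup>2 * prob A - e l" .
    have "- (\<integral>\<omega>. indicator ?A \<omega> * (q (X (Suc l) \<omega>) - r) \<partial>M) = (\<integral>\<omega>. indicator ?A \<omega> * (r - q (X (Suc l) \<omega>)) \<partial>M)"
      unfolding Bochner_Integration.integral_minus[symmetric]
      by (intro Bochner_Integration.integral_cong refl) (simp add: algebra_simps)
    also have "\<dots> \<le> e (Suc l)"
      unfolding e_def
    proof (rule integral_mono[OF int integrable_X[OF AN]])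
      show "indicator ?A \<omega> * (r - q (X (Suc l) \<omega>)) \<le> indicator (A \<inter> stay N n (Suc l)) \<omega> * (r - q (X (Suc l) \<omega>))" for \<omega>
      proof (cases "\<omega> \<in> ?A \<and> X (Suc l) \<omega> \<notin> N")
        case True
        then have "\<omega> \<notin> stay N n (Suc l)" using l by (auto simp: stay_def)
        then show ?thesis using True by (auto simp: N_def)
      next
        case False
        then have "\<omega> \<in> ?A \<longleftrightarrow> \<omega> \<in> A \<inter> stay N n (Suc l)" using l by (auto simp: stay_def le_Suc_eq)
        then show ?thesis by (simp add: indicator_def)
      qed
    qed
    finally show ?thesis using 1 by linarith
  qed
  have sum: "e n - C * prob A * (\<Sum>k = n..<l. (gain TYPE('d) k)\<^sup>2) \<le> e l" if "l \<ge> n" for l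
    using that
  proof (induction l rule: dec_induct)
    case (step l)
    have "(\<Sum>k = n..<Suc l. (gain TYPE('d) k)\<^sup>2) = (\<Sum>k = n..<l. (gain TYPE('d) k)\<^sup>2) + (gain TYPE('d) l)\<^sup>2"
      using step.hyps(1) by simp
    then have "C * prob A * (\<Sum>k = n..<Suc l. (gain TYPE('d) k)\<^sup>2)
        = C * prob A * (\<Sum>k = n..<l. (gain TYPE('d) k)\<^sup>2) + C * (gain TYPE('d) l)\<^sup>2 * prob A"
      by (simp only: distrib_left) (simp only: mult_ac)
    then show ?case using step.IH step_e[OF step.hyps(1)] by linarith
  qed simp
  have "prob A * (r - s) \<le> e n"
  proof -
    have "(\<integral>\<omega>. (r - s) * indicator A \<omega> \<partial>M) \<le> e n"
      unfolding e_def
    proof (rule integral_mono)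
      show "integrable M (\<lambda>\<omega>. (r - s) * indicator A \<omega>)" using AM by (simp add: emeasure_eq_measure)
      show "integrable M (\<lambda>\<omega>. indicator (A \<inter> stay N n n) \<omega> * (r - q (X n \<omega>)))" by (rule integrable_X[OF AN])
      show "(r - s) * indicator A \<omega> \<le> indicator (A \<inter> stay N n n) \<omega> * (r - q (X n \<omega>))" if "\<omega> \<in> space M" for \<omega>
      proof (cases "\<omega> \<in> A")
        case True
        then have "q (X n \<omega>) \<le> s" by (rule start)
        moreover have "\<omega> \<in> stay N n n" using \<open>q (X n \<omega>) \<le> s\<close> sr that by (auto simp: stay_def N_def)
        ultimately show ?thesis using True by simp
      qed simp
    qed
    then show ?thesis using AM by (simp add: mult.commute)
  qed
  moreover have "C * prob A * (\<Sum>k = n..<l. (gain TYPE('d) k)\<^sup>2) \<le> C * prob A * (1 / (real CARD('d) + real n))"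
    using C by (intro mult_left_mono sum_gain_square_le) auto
  moreover have "e l \<le> r * prob (A \<inter> stay N n l)"
  proof -
    have "e l \<le> (\<integral>\<omega>. r * indicator (A \<inter> stay N n l) \<omega> \<partial>M)"
      unfolding e_def
    proof (rule integral_mono)
      show "integrable M (\<lambda>\<omega>. r * indicator (A \<inter> stay N n l) \<omega>)" using AN by (simp add: emeasure_eq_measure)
      show "integrable M (\<lambda>\<omega>. indicator (A \<inter> stay N n l) \<omega> * (r - q (X l \<omega>)))" by (rule integrable_X[OF AN])
      show "indicator (A \<inter> stay N n l) \<omega> * (r - q (X l \<omega>)) \<le> r * indicator (A \<inter> stay N n l) \<omega>" for \<omega>
        using nonneg[OF occupation_in_simplex[of l W \<omega>]] n l by (cases "\<omega> \<in> A \<inter> stay N n l") auto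
    qed
    then show ?thesis using AN by simp
  qed
  ultimately show ?thesis using sum[OF l] by (simp add: N_def algebra_simps)
qed

text \<open>
  At a late time the process is steered into the inner part of a sublevel set of the local Lyapunov function. From
  there it remains in the sublevel set with a conditional probability of at least \<open>1 / 3\<close>, and then it
  converges to \<open>p\<close>.
\<close>

lemma stable_prob_pos:
  assumes sym: "\<And>v i j. \<alpha> v i j = \<alpha> v j i" and st: "linearly_stable \<alpha> p"
  shows "prob (conv p) > 0"
proof -
  have hyp: "hyperbolic_equilibrium \<alpha> p" using st unfolding linearly_stable_def by blast
  then have peq: "p \<in> equilibria \<alpha>" unfolding hyperbolic_equilibrium_def by blast
  note p = equilibriumD(1)[OF peq]
  obtain r0 where r0: "r0 > 0" "\<And>x. x \<in> equilibria \<alpha> \<Longrightarrow> dist x p < r0 \<Longrightarrow> x = p"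
    using hyperbolic_isolated[OF hyp] by blast
  obtain q r C where q: "r > 0" "C \<ge> 0" "continuous_on UNIV q" "q p = 0"
    "\<And>x. x \<in> simplex_product \<Longrightarrow> q x < r \<Longrightarrow> dist x p < r0 / 2"
    "\<And>n x. x \<in> simplex_product \<Longrightarrow> q x < r \<Longrightarrow>
       (\<Sum>w\<in>UNIV. walk_prob \<alpha> x w * q (occupation_step n x w)) \<le> q x + C * (gain TYPE('d) n)\<^sup>2"
    "\<And>x. x \<in> simplex_product \<Longrightarrow> 0 \<le> q x"
    by (rule stable_local_lyapunov[of \<alpha>, OF sym st half_gt_zero[OF r0(1)]]) (rule that)
  obtain \<delta> where \<delta>: "\<delta> > 0" "\<And>x. dist x p < \<delta> \<Longrightarrow> q x < r / 3"
  proof -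
    have "isCont q p" using q(3) by (simp add: continuous_on_eq_continuous_at)
    then have "(q \<longlongrightarrow> q p) (nhds p)" unfolding isCont_def by (simp only: tendsto_at_iff_tendsto_nhds)
    then have "eventually (\<lambda>x. q x < r / 3) (nhds p)"
      using q(1,4) by (intro order_tendstoD(2)) auto
    then show ?thesis using that unfolding eventually_nhds_metric by blast
  qed
  have "(\<lambda>n. real CARD('m \<times> 'd) * real CARD('d) * gain TYPE('d) n) \<longlonglongrightarrow> 0"
    "(\<lambda>n. C * gain TYPE('d) n) \<longlonglongrightarrow> 0"
    by (intro tendsto_mult_right_zero gain_tendsto_zero)+
  then have "eventually (\<lambda>n. real CARD('m \<times> 'd) * real CARD('d) * gain TYPE('d) n < \<delta> \<and> C * gain TYPE('d) n < r / 3) sequentially"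
    using \<delta>(1) q(1) by (intro eventually_conj order_tendstoD(2)) auto
  then obtain n0 where n0: "real CARD('m \<times> 'd) * real CARD('d) * gain TYPE('d) n0 < \<delta>" "C * gain TYPE('d) n0 < r / 3"
    unfolding eventually_sequentially by blast
  define n where "n = Suc n0"
  have gn: "gain TYPE('d) n0 = 1 / (real CARD('d) + real n)" by (simp add: gain_def n_def add_ac)
  obtain A where A: "A \<in> sets (H n)" "prob A > 0"
    "\<And>\<omega>. \<omega> \<in> A \<Longrightarrow> norm (X n \<omega> - p) \<le> real CARD('m \<times> 'd) * (real CARD('d) / (real CARD('d) + real n))"
    using steering[OF p, of n] by (auto simp: n_def)
  let ?N = "{x. q x < r}"
  have AM: "A \<in> sets M" by (rule sets_history_M[OF A(1)])
  have bound: "prob A / 3 \<le> prob (A \<inter> stay ?N n l)" if "l \<ge> n" for l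
  proof -
    have "prob A * (r - r / 3 - C / (real CARD('d) + real n)) \<le> r * prob (A \<inter> stay ?N n l)"
    proof (rule stay_prob_lower_bound[OF _ A(1)])
      fix \<omega> assume "\<omega> \<in> A"
      then have "dist (X n \<omega>) p < \<delta>" using A(3)[of \<omega>] n0(1) by (simp add: dist_norm gn)
      then show "q (X n \<omega>) \<le> r / 3" using \<delta>(2) by (simp add: less_imp_le)
    qed (use q that in \<open>auto simp: n_def\<close>)
    moreover have "prob A * (r / 3) \<le> prob A * (r - r / 3 - C / (real CARD('d) + real n))"
      using n0(2) by (intro mult_left_mono) (auto simp: gn)
    ultimately have "r * (prob A / 3) \<le> r * prob (A \<inter> stay ?N n l)" by (simp add: mult_ac)
    then show ?thesis using q(1) by simp
  qed
  have "prob A / 3 \<le> prob (A \<inter> stay_forever ?N n)"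
    by (rule LIMSEQ_le_const[OF prob_stay_forever[OF AM]]) (use bound in blast)
  also have "\<dots> \<le> prob (conv p)"
  proof (rule finite_measure_mono_AE)
    have "AE \<omega> in M. \<omega> \<in> stay_forever ?N n \<longrightarrow> \<omega> \<in> conv p"
    proof (rule AE_stay_forever_converges[OF sym peq, where \<epsilon> = "r0 / 2"])
      show "x = p" if "x \<in> equilibria \<alpha>" "x \<in> cball p (r0 / 2)" for x
        using that r0(1) by (intro r0(2)) (auto simp: dist_commute)
      show "?N \<inter> simplex_product \<subseteq> cball p (r0 / 2)" using q(5) by (force simp: dist_commute)
    qed
    then show "AE \<omega> in M. \<omega> \<in> A \<inter> stay_forever ?N n \<longrightarrow> \<omega> \<in> conv p" by eventually_elim auto
  qed simp
  finally show ?thesis using A(2) by simp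
qed

section \<open>Linearly unstable equilibria\<close>

text \<open>
  The integral over \<open>A \<times> A\<close> with respect to two independent copies of the process. As all integrands are functions of
  finitely many values, an iterated integral suffices.
\<close>

definition pair_integral :: "'w set \<Rightarrow> ('w \<Rightarrow> 'w \<Rightarrow> real) \<Rightarrow> real" where
  "pair_integral A f = (\<integral>\<omega>. indicator A \<omega> * (\<integral>\<omega>'. indicator A \<omega>' * f \<omega> \<omega>' \<partial>M) \<partial>M)"

lemma pair_integral_mono:
  assumes AB: "A \<in> sets M" "B \<in> sets M" "A \<subseteq> B"
    and le: "\<And>\<omega> \<omega>'. \<omega> \<in> A \<Longrightarrow> \<omega>' \<in> A \<Longrightarrow> f (X l \<omega>) (X l \<omega>') \<le> g (X k \<omega>) (X k \<omega>')"
    and nonneg: "\<And>\<omega> \<omega>'. 0 \<le> g (X k \<omega>) (X k \<omega>')"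
  shows "pair_integral A (\<lambda>\<omega> \<omega>'. f (X l \<omega>) (X l \<omega>')) \<le> pair_integral B (\<lambda>\<omega> \<omega>'. g (X k \<omega>) (X k \<omega>'))"
  unfolding pair_integral_def
proof (rule integral_mono)
  show "integrable M (\<lambda>\<omega>. indicator A \<omega> * (\<integral>\<omega>'. indicator A \<omega>' * f (X l \<omega>) (X l \<omega>') \<partial>M))"
    by (rule integrable_X[OF AB(1), where g = "\<lambda>x. \<integral>\<omega>'. indicator A \<omega>' * f x (X l \<omega>') \<partial>M"])
  show "integrable M (\<lambda>\<omega>. indicator B \<omega> * (\<integral>\<omega>'. indicator B \<omega>' * g (X k \<omega>) (X k \<omega>') \<partial>M))"
    by (rule integrable_X[OF AB(2), where g = "\<lambda>x. \<integral>\<omega>'. indicator B \<omega>' * g x (X k \<omega>') \<partial>M"])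
  fix \<omega>
  have inner: "(\<integral>\<omega>'. indicator A \<omega>' * f (X l \<omega>) (X l \<omega>') \<partial>M) \<le> (\<integral>\<omega>'. indicator B \<omega>' * g (X k \<omega>) (X k \<omega>') \<partial>M)"
    if "\<omega> \<in> A"
  proof (rule integral_mono)
    show "integrable M (\<lambda>\<omega>'. indicator A \<omega>' * f (X l \<omega>) (X l \<omega>'))" by (rule integrable_X[OF AB(1)])
    show "integrable M (\<lambda>\<omega>'. indicator B \<omega>' * g (X k \<omega>) (X k \<omega>'))" by (rule integrable_X[OF AB(2)])
    show "indicator A \<omega>' * f (X l \<omega>) (X l \<omega>') \<le> indicator B \<omega>' * g (X k \<omega>) (X k \<omega>')" for \<omega>'
      using le[OF that, of \<omega>'] nonneg[of \<omega> \<omega>'] AB(3) by (auto simp: indicator_def)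
  qed
  have "0 \<le> (\<integral>\<omega>'. indicator B \<omega>' * g (X k \<omega>) (X k \<omega>') \<partial>M)"
    by (intro Bochner_Integration.integral_nonneg) (simp add: nonneg)
  then show "indicator A \<omega> * (\<integral>\<omega>'. indicator A \<omega>' * f (X l \<omega>) (X l \<omega>') \<partial>M)
      \<le> indicator B \<omega> * (\<integral>\<omega>'. indicator B \<omega>' * g (X k \<omega>) (X k \<omega>') \<partial>M)"
    using inner AB(3) by (auto simp: indicator_def)
qed

lemma pair_integral_const:
  assumes "A \<in> sets M"
  shows "pair_integral A (\<lambda>\<omega> \<omega>'. c) = c * (prob A)\<^sup>2"
proof -
  have inner: "(\<integral>\<omega>'. indicator A \<omega>' * c \<partial>M) = c * prob A" using assms by simp
  show ?thesis unfolding pair_integral_def inner using assms by (simp add: power2_eq_square)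
qed

lemma pair_integral_cmult: "pair_integral A (\<lambda>\<omega> \<omega>'. f \<omega> \<omega>' * c) = pair_integral A f * c"
  unfolding pair_integral_def by (simp add: mult.assoc[symmetric])

lemma pair_tower:
  assumes l: "l \<ge> 1" and A: "A \<in> sets (H l)"
  shows "pair_integral A (\<lambda>\<omega> \<omega>'. g (X (Suc l) \<omega>) (X (Suc l) \<omega>'))
    = pair_integral A (\<lambda>\<omega> \<omega>'. \<Sum>w\<in>UNIV. \<Sum>w'\<in>UNIV. walk_prob \<alpha> (X l \<omega>) w * walk_prob \<alpha> (X l \<omega>') w' *
        g (occupation_step l (X l \<omega>) w) (occupation_step l (X l \<omega>') w'))"
proof -
  define G where "G y = (\<integral>\<omega>'. indicator A \<omega>' *
      (\<Sum>w'\<in>UNIV. walk_prob \<alpha> (X l \<omega>') w' * g y (occupation_step l (X l \<omega>') w')) \<partial>M)" for y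
  have "pair_integral A (\<lambda>\<omega> \<omega>'. g (X (Suc l) \<omega>) (X (Suc l) \<omega>'))
      = (\<integral>\<omega>. indicator A \<omega> * G (X (Suc l) \<omega>) \<partial>M)"
    unfolding pair_integral_def G_def by (subst tower[OF l A]) (rule refl)
  also have "\<dots> = (\<integral>\<omega>. indicator A \<omega> * (\<Sum>w\<in>UNIV. walk_prob \<alpha> (X l \<omega>) w * G (occupation_step l (X l \<omega>) w)) \<partial>M)"
    by (rule tower[OF l A])
  also have "\<dots> = pair_integral A (\<lambda>\<omega> \<omega>'. \<Sum>w\<in>UNIV. \<Sum>w'\<in>UNIV. walk_prob \<alpha> (X l \<omega>) w * walk_prob \<alpha> (X l \<omega>') w' *
        g (occupation_step l (X l \<omega>) w) (occupation_step l (X l \<omega>') w'))"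
    unfolding pair_integral_def
  proof (intro Bochner_Integration.integral_cong refl arg_cong2[where f = "(*)"])
    fix \<omega>
    have int: "integrable M (\<lambda>\<omega>'. indicator A \<omega>' * (\<Sum>w'\<in>UNIV. walk_prob \<alpha> (X l \<omega>') w' * g y (occupation_step l (X l \<omega>') w')))" for y
      by (rule integrable_X[OF sets_history_M[OF A], where g = "\<lambda>x. \<Sum>w'\<in>UNIV. walk_prob \<alpha> x w' * g y (occupation_step l x w')"])
    have "(\<Sum>w\<in>UNIV. walk_prob \<alpha> (X l \<omega>) w * G (occupation_step l (X l \<omega>) w))
      = (\<Sum>w\<in>UNIV. \<integral>\<omega>'. walk_prob \<alpha> (X l \<omega>) w * (indicator A \<omega>' *
          (\<Sum>w'\<in>UNIV. walk_prob \<alpha> (X l \<omega>') w' * g (occupation_step l (X l \<omega>) w) (occupation_step l (X l \<omega>') w'))) \<partial>M)"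
      unfolding G_def by (intro sum.cong refl integral_mult_right_zero[symmetric])
    also have "\<dots> = (\<integral>\<omega>'. (\<Sum>w\<in>UNIV. walk_prob \<alpha> (X l \<omega>) w * (indicator A \<omega>' *
          (\<Sum>w'\<in>UNIV. walk_prob \<alpha> (X l \<omega>') w' * g (occupation_step l (X l \<omega>) w) (occupation_step l (X l \<omega>') w')))) \<partial>M)"
      by (rule Bochner_Integration.integral_sum[symmetric]) (intro integrable_mult_right int)
    finally show "(\<Sum>w\<in>UNIV. walk_prob \<alpha> (X l \<omega>) w * G (occupation_step l (X l \<omega>) w))
      = (\<integral>\<omega>'. indicator A \<omega>' * (\<Sum>w\<in>UNIV. \<Sum>w'\<in>UNIV. walk_prob \<alpha> (X l \<omega>) w * walk_prob \<alpha> (X l \<omega>') w' *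
        g (occupation_step l (X l \<omega>) w) (occupation_step l (X l \<omega>') w')) \<partial>M)"
      by (simp add: sum_distrib_left mult_ac)
  qed
  finally show ?thesis .
qed

text \<open>
  On \<open>A\<close> both copies start at time \<open>n\<close> from the same point, where the exponent is \<open>0\<close>. The weight of pairs that
  leave \<open>N\<close> is dropped, and each step contributes the factor of \<^const>\<open>repels_pairs\<close> with \<open>s = n\<close>.
\<close>

lemma pair_decay:
  fixes \<phi> :: "real ^ ('m \<times> 'd) \<Rightarrow> real"
  assumes n: "n \<ge> 1" and A: "A \<in> sets (H n)" "\<And>\<omega>. \<omega> \<in> A \<Longrightarrow> X n \<omega> = x0"
    and c: "c > 0" and \<phi>0: "\<phi> 0 = 0"
    and rep: "repels_pairs \<alpha> N \<phi> c"
    and l: "l \<ge> n"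
  shows "pair_integral (A \<inter> stay N n l) (\<lambda>\<omega> \<omega>'. exp (real n * \<phi> (X l \<omega> - X l \<omega>')))
    \<le> exp (- c * real n * (\<Sum>k = n..<l. (gain TYPE('d) k)\<^sup>2)) * (prob A)\<^sup>2"
  using l
proof (induction l rule: dec_induct)
  case base
  have AM: "A \<in> sets M" by (rule sets_history_M[OF A(1)])
  have "pair_integral (A \<inter> stay N n n) (\<lambda>\<omega> \<omega>'. exp (real n * \<phi> (X n \<omega> - X n \<omega>'))) \<le> pair_integral A (\<lambda>\<omega> \<omega>'. 1)"
    by (rule pair_integral_mono[where f = "\<lambda>x y. exp (real n * \<phi> (x - y))" and g = "\<lambda>x y. 1"])
      (use AM stay_sets A(2) \<phi>0 in auto)
  then show ?case using pair_integral_const[OF AM, of 1] by simp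
next
  case (step l)
  let ?E = "\<lambda>x y. exp (real n * \<phi> (x - y))"
  let ?A = "A \<inter> stay N n l"
  let ?\<kappa> = "1 - c * real n * (gain TYPE('d) l)\<^sup>2"
  have l: "n \<le> l" "1 \<le> l" using step n by auto
  have Ah: "?A \<in> sets (H l)" using history_mono[OF l(1) A(1)] stay_history by auto
  have AM: "?A \<in> sets M" "A \<inter> stay N n (Suc l) \<in> sets M" using sets_history_M[OF A(1)] stay_sets by auto
  have "pair_integral (A \<inter> stay N n (Suc l)) (\<lambda>\<omega> \<omega>'. ?E (X (Suc l) \<omega>) (X (Suc l) \<omega>'))
      \<le> pair_integral ?A (\<lambda>\<omega> \<omega>'. ?E (X (Suc l) \<omega>) (X (Suc l) \<omega>'))"
    by (rule pair_integral_mono[where f = ?E and g = ?E]) (use AM in \<open>auto simp: stay_def\<close>)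
  also have "\<dots> = pair_integral ?A (\<lambda>\<omega> \<omega>'. \<Sum>w\<in>UNIV. \<Sum>w'\<in>UNIV. walk_prob \<alpha> (X l \<omega>) w * walk_prob \<alpha> (X l \<omega>') w' *
        ?E (occupation_step l (X l \<omega>) w) (occupation_step l (X l \<omega>') w'))"
    by (rule pair_tower[OF l(2) Ah, where g = ?E])
  also have "\<dots> \<le> pair_integral ?A (\<lambda>\<omega> \<omega>'. exp (- c * real n * (gain TYPE('d) l)\<^sup>2) * ?E (X l \<omega>) (X l \<omega>'))"
  proof (rule pair_integral_mono[where f = "\<lambda>x y. \<Sum>w\<in>UNIV. \<Sum>w'\<in>UNIV. walk_prob \<alpha> x w * walk_prob \<alpha> y w' *
        ?E (occupation_step l x w) (occupation_step l y w')" and g = "\<lambda>x y. exp (- c * real n * (gain TYPE('d) l)\<^sup>2) * ?E x y"])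
    fix \<omega> \<omega>' assume w: "\<omega> \<in> ?A" "\<omega>' \<in> ?A"
    have "(\<Sum>w\<in>UNIV. \<Sum>w'\<in>UNIV. walk_prob \<alpha> (X l \<omega>) w * walk_prob \<alpha> (X l \<omega>') w' *
        ?E (occupation_step l (X l \<omega>) w) (occupation_step l (X l \<omega>') w')) \<le> ?E (X l \<omega>) (X l \<omega>') * ?\<kappa>"
    proof (rule rep[unfolded repels_pairs_def, rule_format])
      show "X l \<omega> \<in> simplex_product \<inter> N" "X l \<omega>' \<in> simplex_product \<inter> N"
        using w l occupation_in_simplex[OF l(2), of W] by (auto simp: stay_def)
      show "real n * gain TYPE('d) l \<le> 1" using l(1) by (simp add: gain_def divide_simps)
    qed simp
    also have "\<dots> \<le> ?E (X l \<omega>) (X l \<omega>') * exp (- c * real n * (gain TYPE('d) l)\<^sup>2)"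
      using exp_ge_add_one_self[of "- c * real n * (gain TYPE('d) l)\<^sup>2"] by (intro mult_left_mono) auto
    finally show "(\<Sum>w\<in>UNIV. \<Sum>w'\<in>UNIV. walk_prob \<alpha> (X l \<omega>) w * walk_prob \<alpha> (X l \<omega>') w' *
        ?E (occupation_step l (X l \<omega>) w) (occupation_step l (X l \<omega>') w'))
      \<le> exp (- c * real n * (gain TYPE('d) l)\<^sup>2) * ?E (X l \<omega>) (X l \<omega>')" by (simp add: mult.commute)
  qed (use AM in auto)
  also have "\<dots> = pair_integral ?A (\<lambda>\<omega> \<omega>'. ?E (X l \<omega>) (X l \<omega>')) * exp (- c * real n * (gain TYPE('d) l)\<^sup>2)"
    by (subst pair_integral_cmult[symmetric]) (simp add: mult.commute)
  also have "\<dots> \<le> (exp (- c * real n * (\<Sum>k = n..<l. (gain TYPE('d) k)\<^sup>2)) * (prob A)\<^sup>2) * exp (- c * real n * (gain TYPE('d) l)\<^sup>2)"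
    using step.IH by (intro mult_right_mono) auto
  also have "\<dots> = exp (- c * real n * (\<Sum>k = n..<Suc l. (gain TYPE('d) k)\<^sup>2)) * (prob A)\<^sup>2"
    using l(1) by (simp add: exp_add[symmetric] algebra_simps)
  finally show ?case .
qed

text \<open>
  Paths that converge to \<open>p\<close> are eventually always in a ball around \<open>p\<close>, so their probability is bounded by the
  probabilities at single large times.
\<close>

lemma prob_eventually_near:
  assumes A: "A \<in> sets M" and \<delta>: "\<delta> > 0"
    and bound: "\<And>l. l \<ge> l0 \<Longrightarrow> prob (A \<inter> stay N n l \<inter> {\<omega> \<in> space M. X l \<omega> \<in> ball p \<delta>}) \<le> b"
  shows "prob (A \<inter> stay_forever N n \<inter> conv p) \<le> b"
proof -
  (* the paths that are within \<delta> of p from time L on *)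
  define E where "E L = (A \<inter> stay_forever N n) \<inter> stay_forever (ball p \<delta>) L" for L
  have E_sets: "E L \<in> sets M" for L using A stay_forever_sets by (auto simp: E_def)
  have "incseq E" by (auto simp: incseq_def E_def stay_forever_def)
  then have "(\<lambda>L. prob (E L)) \<longlonglongrightarrow> prob (\<Union>L. E L)"
    using E_sets by (intro finite_Lim_measure_incseq) auto
  moreover have "\<exists>L0. \<forall>L\<ge>L0. prob (E L) \<le> b"
  proof (intro exI[of _ l0] allI impI)
    fix L assume L: "L \<ge> l0"
    have "prob (E L) \<le> prob (A \<inter> stay N n L \<inter> {\<omega> \<in> space M. X L \<omega> \<in> ball p \<delta>})"
    proof (rule finite_measure_mono)
      show "E L \<subseteq> A \<inter> stay N n L \<inter> {\<omega> \<in> space M. X L \<omega> \<in> ball p \<delta>}"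
        by (auto simp: E_def stay_forever_def stay_def)
      show "A \<inter> stay N n L \<inter> {\<omega> \<in> space M. X L \<omega> \<in> ball p \<delta>} \<in> sets M"
        by (intro sets.Int A stay_sets X_event)
    qed
    then show "prob (E L) \<le> b" using bound[OF L] by linarith
  qed
  ultimately have "prob (\<Union>L. E L) \<le> b" by (rule LIMSEQ_le_const2)
  moreover have "prob (A \<inter> stay_forever N n \<inter> conv p) \<le> prob (\<Union>L. E L)"
  proof (rule finite_measure_mono)
    show "(\<Union>L. E L) \<in> sets M" using E_sets by auto
    show "A \<inter> stay_forever N n \<inter> conv p \<subseteq> (\<Union>L. E L)"
    proof
      fix \<omega> assume w: "\<omega> \<in> A \<inter> stay_forever N n \<inter> conv p"
      then have "(\<lambda>l. X l \<omega>) \<longlonglongrightarrow> p" by (simp add: conv_def)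
      then obtain L where "\<forall>l\<ge>L. dist (X l \<omega>) p < \<delta>" using \<delta> unfolding lim_sequentially by blast
      then have "\<omega> \<in> E L" using w by (auto simp: E_def stay_forever_def dist_commute)
      then show "\<omega> \<in> (\<Union>L. E L)" by blast
    qed
  qed
  ultimately show ?thesis by linarith
qed

text \<open>
  If both copies are close to \<open>p\<close> at a large time, their difference is small and \<open>exp (n * \<phi>)\<close> is almost \<open>1\<close>. So
  the square of the probability of such paths is at most the integral of lemma \<open>pair_decay\<close>, which has lost a
  factor that does not depend on \<open>n\<close>: the sum of the squared gains from \<open>n\<close> on is of order \<open>1 / n\<close>, and it
  is multiplied by \<open>n\<close>.
\<close>

lemma escape_from_point:
  fixes \<phi> :: "real ^ ('m \<times> 'd) \<Rightarrow> real"
  assumes n: "n \<ge> 1" and A: "A \<in> sets (H n)" "\<And>\<omega>. \<omega> \<in> A \<Longrightarrow> X n \<omega> = x0"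
    and c: "c > 0" and \<phi>: "\<phi> 0 = 0" "continuous_on UNIV \<phi>"
    and rep: "repels_pairs \<alpha> N \<phi> c"
  shows "prob (A \<inter> stay_forever N n \<inter> conv p) \<le> exp (- c / (8 * (real CARD('d) + 2))) * prob A"
proof -
  define K where "K = c / (2 * (real CARD('d) + 2))"
  have AM: "A \<in> sets M" by (rule sets_history_M[OF A(1)])
  have d: "real CARD('d) \<ge> 1" by (simp add: Suc_le_eq)
  have K: "K > 0" using c d by (simp add: K_def)
  (* the exponent may cost half of the gain exp (- K) of the integral *)
  obtain \<delta> where \<delta>: "\<delta> > 0" "\<And>z. dist z 0 < \<delta> \<Longrightarrow> real n * \<phi> z > - (K / 2)"
  proof -
    have "((\<lambda>z. real n * \<phi> z) \<longlongrightarrow> real n * \<phi> 0) (nhds 0)"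
      using \<phi>(2) by (intro tendsto_mult_left) (auto simp: continuous_on_eq_continuous_at isCont_def tendsto_at_iff_tendsto_nhds)
    then have "eventually (\<lambda>z. real n * \<phi> z > - (K / 2)) (nhds 0)"
      using K \<phi>(1) by (intro order_tendstoD(1)) auto
    then show ?thesis using that unfolding eventually_nhds_metric by blast
  qed
  have "prob (A \<inter> stay N n l \<inter> {\<omega> \<in> space M. X l \<omega> \<in> ball p (\<delta> / 2)}) \<le> exp (- K / 4) * prob A"
    (* such l are large enough for half of the sum of all squared gains from n on *)
    if l: "l \<ge> 2 * n + CARD('d) + 1" for l
  proof -
    define B where "B = A \<inter> stay N n l \<inter> {\<omega> \<in> space M. X l \<omega> \<in> ball p (\<delta> / 2)}"
    have BM: "B \<in> sets M"
      unfolding B_def by (intro sets.Int AM stay_sets X_event)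
    have "exp (- (K / 2)) * (prob B)\<^sup>2 = pair_integral B (\<lambda>\<omega> \<omega>'. exp (- (K / 2)))"
      by (rule pair_integral_const[OF BM, symmetric])
    also have "\<dots> \<le> pair_integral (A \<inter> stay N n l) (\<lambda>\<omega> \<omega>'. exp (real n * \<phi> (X l \<omega> - X l \<omega>')))"
    proof (rule pair_integral_mono[where f = "\<lambda>x y. exp (- (K / 2))" and g = "\<lambda>x y. exp (real n * \<phi> (x - y))"])
      fix \<omega> \<omega>' assume "\<omega> \<in> B" "\<omega>' \<in> B"
      then have "dist (X l \<omega>) p < \<delta> / 2" "dist (X l \<omega>') p < \<delta> / 2" by (auto simp: B_def dist_commute)
      then have "dist (X l \<omega>) (X l \<omega>') < \<delta>" using dist_triangle_half_l by (metis dist_commute)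
      then show "exp (- (K / 2)) \<le> exp (real n * \<phi> (X l \<omega> - X l \<omega>'))"
        using \<delta>(2)[of "X l \<omega> - X l \<omega>'"] by (simp add: dist_norm)
    qed (use BM AM stay_sets in \<open>auto simp: B_def\<close>)
    also have "\<dots> \<le> exp (- c * real n * (\<Sum>k = n..<l. (gain TYPE('d) k)\<^sup>2)) * (prob A)\<^sup>2"
      by (rule pair_decay[OF n A c \<phi>(1) rep]) (use l in auto)
    also have "\<dots> \<le> exp (- K) * (prob A)\<^sup>2"
    proof (intro mult_right_mono)
      define t where "t = real CARD('d) + real n + 1"
      have t: "t > 0" by (simp add: t_def)
      have "2 * t \<le> real CARD('d) + real l + 1" using l by (simp add: t_def)
      then have "1 / (real CARD('d) + real l + 1) \<le> 1 / (2 * t)" using t by (intro divide_left_mono) auto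
      moreover have "1 / t - 1 / (real CARD('d) + real l + 1) \<le> (\<Sum>k = n..<l. (gain TYPE('d) k)\<^sup>2)"
        unfolding t_def by (rule sum_gain_square_ge) (use l in simp)
      moreover have "1 / t - 1 / (2 * t) = 1 / (2 * t)" using t by (simp add: field_simps)
      ultimately have 1: "1 / (2 * t) \<le> (\<Sum>k = n..<l. (gain TYPE('d) k)\<^sup>2)" by linarith
      (* here n >= 1 enters *)
      have "t \<le> real n * (real CARD('d) + 2)"
      proof -
        have "1 * (real CARD('d) + 1) \<le> real n * (real CARD('d) + 1)" using n by (intro mult_right_mono) auto
        then show ?thesis by (simp add: t_def algebra_simps)
      qed
      then have h: "1 / (real CARD('d) + 2) \<le> real n / t"
        using t d by (simp add: divide_simps mult.commute)
      have "1 / (2 * (real CARD('d) + 2)) = (1 / (real CARD('d) + 2)) / 2" by (simp add: field_simps)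
      also have "\<dots> \<le> (real n / t) / 2" using h by (rule divide_right_mono) simp
      also have "\<dots> = real n * (1 / (2 * t))" by simp
      also have "\<dots> \<le> real n * (\<Sum>k = n..<l. (gain TYPE('d) k)\<^sup>2)" using 1 by (intro mult_left_mono) auto
      finally have "c * (1 / (2 * (real CARD('d) + 2))) \<le> c * (real n * (\<Sum>k = n..<l. (gain TYPE('d) k)\<^sup>2))"
        using c by (intro mult_left_mono) auto
      then show "exp (- c * real n * (\<Sum>k = n..<l. (gain TYPE('d) k)\<^sup>2)) \<le> exp (- K)"
        by (simp add: K_def mult.assoc)
    qed simp
    finally have "exp (- (K / 2)) * (prob B)\<^sup>2 \<le> exp (- K) * (prob A)\<^sup>2" .
    then have "exp (K / 2) * (exp (- (K / 2)) * (prob B)\<^sup>2) \<le> exp (K / 2) * (exp (- K) * (prob A)\<^sup>2)"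
      by (intro mult_left_mono) auto
    then have "(prob B)\<^sup>2 \<le> exp (- (K / 2)) * (prob A)\<^sup>2"
      by (simp add: mult.assoc[symmetric] exp_add[symmetric])
    also have "exp (- (K / 2)) = (exp (- K / 4))\<^sup>2" by (simp add: power2_eq_square exp_add[symmetric])
    finally have "(prob B)\<^sup>2 \<le> (exp (- K / 4) * prob A)\<^sup>2" by (simp add: power_mult_distrib)
    then show ?thesis unfolding B_def[symmetric] by (rule power2_le_imp_le) simp
  qed
  then have "prob (A \<inter> stay_forever N n \<inter> conv p) \<le> exp (- K / 4) * prob A"
    by (rule prob_eventually_near[OF AM half_gt_zero[OF \<delta>(1)]])
  then show ?thesis by (simp add: K_def)
qed

text \<open>
  Let \<open>S\<close> be the probability of staying in \<open>N\<close> from time \<open>n\<close> on and converging to \<open>p\<close>. Apply the escape estimate to the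
  event of having stayed in \<open>N\<close> up to time \<open>m\<close>: \<open>S\<close> is at most \<open>\<rho> < 1\<close> times its probability. For large \<open>m\<close> that
  probability tends to the one of staying forever, which is \<open>S\<close> again because paths that stay converge
  almost surely. Hence \<open>S \<le> \<rho> * S\<close> and \<open>S = 0\<close>.
\<close>

lemma unstable_prob_zero:
  assumes sym: "\<And>v i j. \<alpha> v i j = \<alpha> v j i" and unst: "linearly_unstable \<alpha> p"
  shows "prob (conv p) = 0"
proof -
  have hyp: "hyperbolic_equilibrium \<alpha> p" using unst unfolding linearly_unstable_def by blast
  then have peq: "p \<in> equilibria \<alpha>" unfolding hyperbolic_equilibrium_def by blast
  obtain r0 where r0: "r0 > 0" "\<And>x. x \<in> equilibria \<alpha> \<Longrightarrow> dist x p < r0 \<Longrightarrow> x = p"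
    using hyperbolic_isolated[OF hyp] by blast
  obtain \<phi> r c where \<phi>: "r > 0" "c > 0" "continuous_on UNIV \<phi>" "\<phi> 0 = 0" "repels_pairs \<alpha> (ball p r) \<phi> c"
    by (rule unstable_pair_step[of \<alpha>, OF sym unst]) (rule that)
  define N where "N = ball p (min r (r0 / 2))"
  have rep: "repels_pairs \<alpha> N \<phi> c"
    using \<phi>(5) unfolding repels_pairs_def N_def by fastforce
  define \<rho> where "\<rho> = exp (- c / (8 * (real CARD('d) + 2)))"
  have \<rho>: "0 < \<rho>" "\<rho> < 1"
  proof -
    have "0 < c / (8 * (real CARD('d) + 2))" using \<phi>(2) by (intro divide_pos_pos) (auto simp: add_nonneg_pos)
    then show "0 < \<rho>" "\<rho> < 1" by (auto simp: \<rho>_def)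
  qed
  have escape: "prob (A \<inter> stay_forever N n \<inter> conv p) \<le> \<rho> * prob A" if n: "n \<ge> 1" and A: "A \<in> sets (H n)" for n A
  proof -
    (* decompose A according to the finitely many values of X n *)
    let ?V = "X n ` space M"
    have fin: "finite ?V" using simple_functionD(1)[OF simple_X] .
    define P where "P x = A \<inter> {\<omega> \<in> space M. X n \<omega> \<in> {x}}" for x
    have Ph: "P x \<in> sets (H n)" for x unfolding P_def by (intro sets.Int A X_event_history order_refl)
    have PM: "P x \<in> sets M" for x by (rule sets_history_M[OF Ph])
    have part: "A = (\<Union>x\<in>?V. P x)" using sets.sets_into_space[OF A] by (auto simp: P_def)
    have disj: "disjoint_family_on P ?V" by (auto simp: disjoint_family_on_def P_def)
    have each: "prob (P x \<inter> stay_forever N n \<inter> conv p) \<le> \<rho> * prob (P x)" for x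
      unfolding \<rho>_def
    proof (rule escape_from_point[OF n Ph _ \<phi>(2,4,3)])
      show "X n \<omega> = x" if "\<omega> \<in> P x" for \<omega> using that by (simp add: P_def)
    qed (rule rep)
    have eq: "A \<inter> stay_forever N n \<inter> conv p = (\<Union>x\<in>?V. P x \<inter> stay_forever N n \<inter> conv p)"
      by (subst part) auto
    have "prob (A \<inter> stay_forever N n \<inter> conv p) \<le> (\<Sum>x\<in>?V. prob (P x \<inter> stay_forever N n \<inter> conv p))"
      unfolding eq
      by (rule finite_measure_subadditive_finite[OF fin]) (auto intro!: sets.Int PM stay_forever_sets conv_sets)
    also have "\<dots> \<le> (\<Sum>x\<in>?V. \<rho> * prob (P x))" by (intro sum_mono each)
    also have "\<dots> = \<rho> * (\<Sum>x\<in>?V. prob (P x))" by (simp only: sum_distrib_left)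
    also have "(\<Sum>x\<in>?V. prob (P x)) = prob (\<Union>x\<in>?V. P x)"
      by (rule finite_measure_finite_Union[OF fin _ disj, symmetric]) (use PM in blast)
    also have "(\<Union>x\<in>?V. P x) = A" by (rule part[symmetric])
    finally show ?thesis .
  qed
  have zero: "prob (stay_forever N n \<inter> conv p) = 0" if n: "n \<ge> 1" for n
  proof -
    define S where "S = prob (stay_forever N n \<inter> conv p)"
    have le: "S \<le> \<rho> * prob (space M \<inter> stay N n m)" if m: "m \<ge> n" for m
    proof -
      have "S \<le> prob (stay N n m \<inter> stay_forever N m \<inter> conv p)"
        unfolding S_def
      proof (rule finite_measure_mono)
        show "stay_forever N n \<inter> conv p \<subseteq> stay N n m \<inter> stay_forever N m \<inter> conv p"
          using m by (auto simp: stay_def stay_forever_def)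
      qed (intro sets.Int stay_sets stay_forever_sets conv_sets)
      also have "\<dots> \<le> \<rho> * prob (stay N n m)" using n m by (intro escape[OF _ stay_history]) simp
      also have "stay N n m = space M \<inter> stay N n m" by (auto simp: stay_def)
      finally show ?thesis .
    qed
    have "S \<le> \<rho> * prob (space M \<inter> stay_forever N n)"
      by (rule LIMSEQ_le_const[OF tendsto_mult_left[OF prob_stay_forever[OF sets.top, of N n], of \<rho>]])
        (use le in blast)
    also have "prob (space M \<inter> stay_forever N n) \<le> S"
      unfolding S_def
    proof (rule finite_measure_mono_AE)
      have "AE \<omega> in M. \<omega> \<in> stay_forever N n \<longrightarrow> \<omega> \<in> conv p"
      proof (rule AE_stay_forever_converges[OF sym peq, where \<epsilon> = "r0 / 2"])
        show "x = p" if "x \<in> equilibria \<alpha>" "x \<in> cball p (r0 / 2)" for x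
          using that r0(1) by (intro r0(2)) (auto simp: dist_commute)
        show "N \<inter> simplex_product \<subseteq> cball p (r0 / 2)" by (auto simp: N_def)
      qed
      then show "AE \<omega> in M. \<omega> \<in> space M \<inter> stay_forever N n \<longrightarrow> \<omega> \<in> stay_forever N n \<inter> conv p"
        by eventually_elim auto
    qed (use stay_forever_sets in auto)
    then have "\<rho> * prob (space M \<inter> stay_forever N n) \<le> \<rho> * S" using \<rho> by (intro mult_left_mono) auto
    finally have "(1 - \<rho>) * S \<le> 0" by (simp add: algebra_simps)
    then have "S \<le> 0" using \<rho> by (simp add: mult_le_0_iff)
    then show ?thesis unfolding S_def using measure_nonneg[of M "stay_forever N n \<inter> conv p"] by linarith
  qed
  have "conv p = (\<Union>n. stay_forever N (Suc n) \<inter> conv p)"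
  proof (intro equalityI subsetI)
    fix \<omega> assume w: "\<omega> \<in> conv p"
    then have "(\<lambda>l. X l \<omega>) \<longlonglongrightarrow> p" by (simp add: conv_def)
    moreover have "min r (r0 / 2) > 0" using \<phi>(1) r0(1) by simp
    ultimately obtain L where "\<forall>l\<ge>L. dist (X l \<omega>) p < min r (r0 / 2)"
      unfolding lim_sequentially by blast
    then have "\<omega> \<in> stay_forever N (Suc L)" using w by (auto simp: stay_forever_def N_def conv_def dist_commute)
    then show "\<omega> \<in> (\<Union>n. stay_forever N (Suc n) \<inter> conv p)" using w by blast
  qed auto
  moreover have "(\<Union>n. stay_forever N (Suc n) \<inter> conv p) \<in> null_sets M"
  proof (rule null_sets_UN)
    show "stay_forever N (Suc n) \<inter> conv p \<in> null_sets M" for n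
      using zero[of "Suc n"] stay_forever_sets by (simp add: null_sets_def emeasure_eq_measure)
  qed
  ultimately show ?thesis by (simp add: measure_eq_0_null_sets)
qed

section \<open>The limit law\<close>

lemma isolated_prob_sum:
  assumes sym: "\<And>v i j. \<alpha> v i j = \<alpha> v j i" and iso: "\<forall>x \<in> equilibria \<alpha>. x isolated_in equilibria \<alpha>"
  shows "((\<lambda>x. prob (conv x)) has_sum 1) (equilibria \<alpha>)"
proof -
  have fin: "finite (equilibria \<alpha>)" by (rule finite_equilibria[OF iso])
  have disj: "disjoint_family_on conv (equilibria \<alpha>)"
    unfolding disjoint_family_on_def conv_def using LIMSEQ_unique by blast
  have "(\<Sum>x\<in>equilibria \<alpha>. prob (conv x)) = prob (\<Union>x\<in>equilibria \<alpha>. conv x)"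
    by (rule finite_measure_finite_Union[OF fin _ disj, symmetric]) (auto intro: conv_sets)
  also have "\<dots> = 1"
  proof (subst prob_eq_1)
    show "(\<Union>x\<in>equilibria \<alpha>. conv x) \<in> events" using fin by auto
    show "AE \<omega> in M. \<omega> \<in> (\<Union>x\<in>equilibria \<alpha>. conv x)"
      using AE_converges_to_equilibrium[OF sym fin] AE_space by eventually_elim (auto simp: conv_def)
  qed
  finally show ?thesis using has_sum_finite[OF fin, of "\<lambda>x. prob (conv x)"] by simp
qed

end

theorem theorem2:
  fixes M :: "'w measure"
    and \<alpha> :: "('m::finite, 'd::finite) params"
    and W :: "nat \<Rightarrow> 'w \<Rightarrow> 'm \<Rightarrow> 'd"
  assumes "CARD('m) \<ge> 2" and "CARD('d) \<ge> 2"
    and "\<And>v i j. \<alpha> v i j = \<alpha> v j i"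
    and "interacting_walks M \<alpha> W"
  shows "(\<forall>x. linearly_stable \<alpha> x \<longrightarrow>
            measure M {w \<in> space M. (\<lambda>n. occupation W n w) \<longlonglongrightarrow> x} > 0) \<and>
         (\<forall>x. linearly_unstable \<alpha> x \<longrightarrow>
            measure M {w \<in> space M. (\<lambda>n. occupation W n w) \<longlonglongrightarrow> x} = 0) \<and>
         ((\<forall>x \<in> equilibria \<alpha>. x isolated_in equilibria \<alpha>) \<longrightarrow>
            ((\<lambda>x. measure M {w \<in> space M. (\<lambda>n. occupation W n w) \<longlonglongrightarrow> x})
               has_sum 1) (equilibria \<alpha>))"
proof -
  interpret interacting_walks M \<alpha> W by (rule assms(4))
  show ?thesis
    using stable_prob_pos[OF assms(3)] unstable_prob_zero[OF assms(3)] isolated_prob_sum[OF assms(3)]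
    unfolding conv_def by blast
qed

end
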